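(* Let $n\ge1$ and let $u:\mathbb R^n\to\mathbb R$ be a bounded solution of $T_\Phi[u]=f(u)$ in $\mathbb R^n$. Let $\alpha>0$ and $\beta\ge 2$ with $\beta>\alpha$, and suppose there is a constant $C>0$ with $\Phi'(t)\le C t^{\beta-1}$ for all $t\in\mathbb R^+$. Assume that the kernel $K$ satisfies one of the following two conditions, where $c$ is a function with $\lambda\le c\le\Lambda$ for some constants $0<\lambda\le\Lambda$: (1) (finite range) there are $0<r_*\le R_*$ such that $$\frac{c(z)}{|z|^{n+\alpha}}\mathbf 1_{\{|z|\le r_*\}}\le K(z)\le \frac{c(z)}{|z|^{n+\alpha}}\mathbf 1_{\{|z|\le R_*\}};$$ (2) (decay at infinity) there is $R_*>0$ such that $$K(z)=\frac{c(z)}{|z|^{n+\alpha}}\ \text{ when } |z|\le R_*,\qquad \int_{r<|z|<2r}|K(z)|\,dz\le C\,D(r)\ \text{ when } r>R_*,$$ where $0\le D\in C(\mathbb R^+)$, $\lim_{r\to\infty}D(r)=0$, and $D(r)<C r^{-\theta}$ for some $\theta>\beta+1$. If either $f(u)\ge0$ (i.e. $f(u(x))\ge 0$ for all $x$) or $u f(u)\le0$ (i.e. $u(x)f(u(x))\le0$ for all $x$), then $u$ must be constant provided $n\le\beta$.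
   Context: The kernel $K:\mathbb R^n\to[0,\infty)$ is measurable and even, $K(z)=K(-z)$. The function $\Phi\in C^2(\mathbb R^+)$ satisfies $\Phi(0)=\Phi'(0)=0$ and $\Phi,\Phi',\Phi''>0$ in $\mathbb R^+$; $\Phi'$ is odd on $\mathbb R$ (so $\Phi$ and $\Phi''$ are extended as even functions). $F\in C^1(\mathbb R)$ and $f=F'$. $C$ denotes a generic positive constant. The operator is $$T_\Phi[u(x)]:=\lim_{\epsilon\to0}\int_{\mathbb R^n\setminus B_\epsilon(x)}\Phi'[u(x)-u(y)]\,K(y-x)\,dy .$$ No specific regularity class for $u$ is fixed; it is understood to be regular enough for the expressions written to make sense. *)

theory Defs
  imports "HOL-Analysis.Analysis"
begin

text \<open>
  The potential is a function on the whole line, even (so that its derivative is odd).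
  \<open>\<real>\<^sup>+\<close> is the open half-line: at \<open>0\<close> only
  \<open>\<Phi>(0) = \<Phi>'(0) = 0\<close> is required, and \<open>\<Phi>''\<close> need not extend to \<open>0\<close>.
\<close>

definition admissible_potential :: "(real \<Rightarrow> real) \<Rightarrow> bool" where
  "admissible_potential \<Phi> \<longleftrightarrow>
     (\<forall>t. \<Phi> (- t) = \<Phi> t) \<and>
     \<Phi> 0 = 0 \<and> (\<Phi> has_real_derivative 0) (at 0) \<and>
     (\<forall>t>0. \<Phi> differentiable (at t)) \<and>
     (\<forall>t>0. deriv \<Phi> differentiable (at t)) \<and>
     continuous_on {0<..} (deriv (deriv \<Phi>)) \<and>
     (\<forall>t>0. \<Phi> t > 0 \<and> deriv \<Phi> t > 0 \<and> deriv (deriv \<Phi>) t > 0)"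

definition admissible_kernel :: "(real ^ 'n \<Rightarrow> real) \<Rightarrow> bool" where
  "admissible_kernel K \<longleftrightarrow>
     K \<in> borel_measurable lebesgue \<and> (\<forall>z. 0 \<le> K z) \<and> (\<forall>z. K (- z) = K z)"

definition T_integrand ::
  "(real \<Rightarrow> real) \<Rightarrow> (real ^ 'n \<Rightarrow> real) \<Rightarrow> (real ^ 'n \<Rightarrow> real) \<Rightarrow> real ^ 'n \<Rightarrow> real ^ 'n \<Rightarrow> real" where
  "T_integrand \<Phi> K u x y = deriv \<Phi> (u x - u y) * K (y - x)"

text \<open>
  \<open>T_has_value \<Phi> K u x L\<close> says that the principal value \<open>T\<^sub>\<Phi>[u(x)]\<close> exists and equals \<open>L\<close>.
  Integrability off each ball is demanded explicitly because the Bochner integral of a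
  non-integrable function is \<open>0\<close>.
\<close>

definition T_has_value ::
  "(real \<Rightarrow> real) \<Rightarrow> (real ^ 'n \<Rightarrow> real) \<Rightarrow> (real ^ 'n \<Rightarrow> real) \<Rightarrow> real ^ 'n \<Rightarrow> real \<Rightarrow> bool" where
  "T_has_value \<Phi> K u x L \<longleftrightarrow>
     (\<forall>\<epsilon>>0. set_integrable lebesgue (- ball x \<epsilon>) (T_integrand \<Phi> K u x)) \<and>
     ((\<lambda>\<epsilon>. set_lebesgue_integral lebesgue (- ball x \<epsilon>) (T_integrand \<Phi> K u x)) \<longlongrightarrow> L) (at_right 0)"

text \<open>In the two kernel conditions the singular point \<open>z = 0\<close> is left out, since \<open>c / 0 = 0\<close> in HOL.\<close>

definition finite_range_kernel ::
  "(real ^ 'n \<Rightarrow> real) \<Rightarrow> (real ^ 'n \<Rightarrow> real) \<Rightarrow> real \<Rightarrow> bool" where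
  "finite_range_kernel K c \<alpha> \<longleftrightarrow>
     (\<exists>r R. 0 < r \<and> r \<le> R \<and>
       (\<forall>z. z \<noteq> 0 \<longrightarrow>
          c z / norm z powr (real CARD('n) + \<alpha>) * indicator {z. norm z \<le> r} z \<le> K z \<and>
          K z \<le> c z / norm z powr (real CARD('n) + \<alpha>) * indicator {z. norm z \<le> R} z))"

text \<open>The shell integrals are extended nonnegative integrals, so the bound forces them to be finite.\<close>

definition decaying_kernel ::
  "(real ^ 'n \<Rightarrow> real) \<Rightarrow> (real ^ 'n \<Rightarrow> real) \<Rightarrow> real \<Rightarrow> real \<Rightarrow> bool" where
  "decaying_kernel K c \<alpha> \<beta> \<longleftrightarrow>
     (\<exists>R>0.
       (\<forall>z. z \<noteq> 0 \<and> norm z \<le> R \<longrightarrow> K z = c z / norm z powr (real CARD('n) + \<alpha>)) \<and>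
       (\<exists>D :: real \<Rightarrow> real.
          continuous_on {0<..} D \<and> (\<forall>r>0. 0 \<le> D r) \<and> (D \<longlongrightarrow> 0) at_top \<and>
          (\<exists>C>0. \<forall>r>R. (\<integral>\<^sup>+z\<in>{z. r < norm z \<and> norm z < 2 * r}. ennreal \<bar>K z\<bar> \<partial>lebesgue)
                          \<le> ennreal (C * D r)) \<and>
          (\<exists>C>0. \<exists>\<theta>>\<beta> + 1. \<forall>r>R. D r < C * r powr (- \<theta>))))"

end

theory Submission
  imports Defs
begin

text \<open>
  The operator is the Euler operator of a convex nonlocal energy, so the natural proof tests the
  equation with \<open>(M - u) \<eta>\<^sup>k\<close>, where \<open>M\<close> bounds \<open>\<bar>u\<bar>\<close> and \<open>\<eta>\<close> is a cutoff between the balls of radius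
  \<open>R\<close> and \<open>2 R\<close>. If \<open>f(u) \<ge> 0\<close>, symmetrising the double integral gives a Caccioppoli inequality

    \<open>\<integral>\<integral> \<Phi>'(d) d \<eta>\<^sup>k K \<le> s \<integral>\<integral> \<Phi>'(d) d \<eta>\<^sup>k 1{\<eta>(x) \<noteq> \<eta>(y)} K + C s\<^sup>1\<^sup>-\<^sup>\<beta> \<integral>\<integral> \<bar>\<eta>(x) - \<eta>(y)\<bar>\<^sup>\<beta> K\<close>

  for all \<open>s > 0\<close>, with \<open>d = u(x) - u(y)\<close>. The last double integral is of order \<open>R\<close> to the power \<open>n - \<beta>\<close>,
  hence bounded for large \<open>R\<close> because \<open>n \<le> \<beta>\<close> (lemma \<open>caccioppoli\<close>). With \<open>s = 1/2\<close> the total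
  energy is finite; then the middle term vanishes as \<open>R \<longrightarrow> \<infinity>\<close> for each fixed \<open>s\<close>, and letting
  \<open>s \<longrightarrow> \<infinity>\<close> shows that the energy is \<open>0\<close> (lemma \<open>energy_vanishes\<close>), so \<open>u\<close> is constant.

  The difficulty is that \<open>u\<close> is merely bounded and measurable, and that the equation holds only
  pointwise, as a limit of truncated integrals \<open>T\<^sub>\<epsilon>[u](x)\<close> with no uniformity in \<open>x\<close>; the weak form above
  is not available. It is recovered in two steps.

  First, \<open>u\<close> is continuous (lemma \<open>pointwise_solution_continuous\<close>). Let \<open>F\<^sub>N\<close> be the set of points at
  which \<open>\<bar>T\<^sub>\<epsilon>[u]\<bar> \<le> N\<close> for all \<open>\<epsilon> < 1/(N+1)\<close>. As the mass of \<open>K\<close> outside the \<open>\<epsilon>\<close>-ball tends to infinity, a bound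
  on \<open>T\<^sub>\<epsilon>[u](x)\<close> determines the number \<open>u(x)\<close>; this makes \<open>F\<^sub>N\<close> closed and \<open>u\<close> continuous on it. If the
  closed set \<open>P\<close> of points near which \<open>u\<close> fails to be continuous were nonempty, then by Baire's theorem some
  \<open>F\<^sub>N\<close> would contain a relatively open piece of \<open>P\<close>. At a point \<open>x\<^sub>0\<close> of that piece \<open>u\<close> is nevertheless
  continuous: if \<open>u\<close> took values near \<open>l < u(x\<^sub>0)\<close> at points \<open>x \<notin> P\<close> close to \<open>x\<^sub>0\<close>, one could touch \<open>u\<close> from below
  by a flat parabola near \<open>x\<close>, at the scale \<open>d = dist(x, P)\<close>, and the truncated integrals there would be
  below \<open>- c d\<close> to the power \<open>- \<alpha>\<close>, because near the nearest point of \<open>P\<close> the function is, on a definite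
  fraction of the scale-\<open>d\<close> shell, not much smaller than \<open>u(x\<^sub>0)\<close> (lemma
  \<open>lsc_at_uniformly_bounded_point\<close>).

  Secondly, a continuous supersolution is replaced by its inf-convolution. By translation invariance and
  monotonicity of \<open>\<Phi>'\<close> this is again a supersolution; it is Lipschitz and is touched from above by a
  parabola of fixed opening at every point, which bounds \<open>T\<^sub>\<epsilon>\<close> from below uniformly, so that Fatou's lemma gives
  the weak inequality (lemma \<open>weak_supersolution\<close>). Both uses of parabolas rest on one estimate: the
  principal value of \<open>g(a \<bullet> z + b \<bar>z\<bar>\<^sup>2)\<close> against \<open>\<bar>z\<bar>\<close> to the power \<open>- n - \<alpha>\<close> is finite for every monotone
  odd \<open>g\<close> of growth \<open>\<beta> - 1\<close>, although \<open>g\<close> need not be differentiable (lemma \<open>parabola_gap\<close>).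

  The case \<open>u f(u) \<le> 0\<close> follows by applying the result for supersolutions to \<open>min u 0\<close> and \<open>min (- u) 0\<close>.
\<close>

section \<open>Lebesgue measure under translation, reflection and dilation\<close>

lemma nn_integral_lborel_translate:
  fixes f :: "'a::euclidean_space \<Rightarrow> ennreal"
  assumes [measurable]: "f \<in> borel_measurable borel"
  shows "(\<integral>\<^sup>+x. f (c + x) \<partial>lborel) = (\<integral>\<^sup>+x. f x \<partial>lborel)"
  by (subst (2) lborel_distr_plus[of c, symmetric]) (simp add: nn_integral_distr)

lemma integral_lborel_translate:
  fixes f :: "'a::euclidean_space \<Rightarrow> real"
  assumes [measurable]: "f \<in> borel_measurable borel"
  shows "(LINT x|lborel. f (c + x)) = (LINT x|lborel. f x)"
  by (subst (2) lborel_distr_plus[of c, symmetric]) (simp add: integral_distr)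

lemma integrable_lborel_translate:
  fixes f :: "'a::euclidean_space \<Rightarrow> real"
  assumes "integrable lborel f"
  shows "integrable lborel (\<lambda>x. f (c + x))"
proof -
  have "integrable (distr lborel borel ((+) c)) f"
    by (simp add: lborel_distr_plus assms)
  then show ?thesis
    by (subst (asm) integrable_distr_eq) (use assms in auto)
qed

lemma AE_lborel_translate:
  fixes c :: "'a::euclidean_space"
  assumes "AE z in lborel. P z"
  shows "AE z in lborel. P (c + z)"
proof (rule AE_distrD[where M' = borel and f = "(+) c"])
  show "(+) c \<in> lborel \<rightarrow>\<^sub>M borel" by simp
  show "AE z in distr lborel borel ((+) c). P z"
    by (subst lborel_distr_plus) (rule assms)
qed

lemma nn_integral_lborel_scale:
  fixes f :: "'a::euclidean_space \<Rightarrow> ennreal"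
  assumes [measurable]: "f \<in> borel_measurable borel" and "0 < s"
  shows "(\<integral>\<^sup>+x. f x \<partial>lborel) = ennreal (s ^ DIM('a)) * (\<integral>\<^sup>+x. f (s *\<^sub>R x) \<partial>lborel)"
  using \<open>0 < s\<close>
  by (subst lborel_affine[of s 0]) (simp_all add: nn_integral_density nn_integral_distr nn_integral_cmult)

lemma lborel_distr_reflect:
  "distr lborel borel (\<lambda>x. - x) = (lborel :: 'a::euclidean_space measure)"
  by (subst (2) lborel_affine[of "-1" 0]) (simp_all add: density_1)

lemma integral_lborel_reflect:
  fixes f :: "'a::euclidean_space \<Rightarrow> real"
  assumes [measurable]: "f \<in> borel_measurable borel"
  shows "(LINT x|lborel. f (- x)) = (LINT x|lborel. f x)"
  by (subst (2) lborel_distr_reflect[symmetric]) (simp add: integral_distr)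

lemma AE_open_everywhere:
  fixes Q :: "'a::euclidean_space \<Rightarrow> bool"
  assumes "AE z in lborel. Q z" "open {z. \<not> Q z}"
  shows "Q z"
proof (rule ccontr)
  assume z: "\<not> Q z"
  have "{z. \<not> Q z} \<in> null_sets lborel"
    using assms by (subst AE_iff_null_sets) auto
  then have "negligible {z. \<not> Q z}"
    by (simp add: negligible_iff_null_sets null_sets_completionI)
  then show False using open_not_negligible[OF assms(2)] z by auto
qed

text \<open>
  For an open set the indicator of \<open>U\<close> is lower semicontinuous, so the part of \<open>U\<close> that a small
  translation moves out of \<open>U\<close> vanishes by dominated convergence; the part that enters has the same measure.
\<close>

lemma L1_translation_continuous_open:
  fixes U :: "'a::euclidean_space set" and h :: "nat \<Rightarrow> 'a"
  assumes U: "open U" "emeasure lborel U < \<infinity>" and h: "h \<longlonglongrightarrow> 0"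
  shows "(\<lambda>j. LINT x|lborel. \<bar>indicator U (h j + x) - indicator U x :: real\<bar>) \<longlonglongrightarrow> 0"
proof -
  have [measurable]: "U \<in> sets borel" using U by auto
  have iU: "integrable lborel (indicator U :: 'a \<Rightarrow> real)" using U by simp
  note iUh = integrable_lborel_translate[OF iU]
  let ?m = "\<lambda>j x. indicator U x * (1 - indicator U (h j + x)) :: real"
  have im: "integrable lborel (?m j)" for j
    by (rule Bochner_Integration.integrable_bound[OF iU]) (auto simp: indicator_def)
  have "(\<lambda>j. LINT x|lborel. ?m j x) \<longlonglongrightarrow> (LINT x|(lborel :: 'a measure). (0::real))"
  proof (rule integral_dominated_convergence[where w = "indicator U"])
    show "integrable lborel (indicator U :: 'a \<Rightarrow> real)" by (rule iU)
    show "AE x in lborel. (\<lambda>j. ?m j x) \<longlonglongrightarrow> 0"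
    proof (rule AE_I2)
      fix x :: 'a
      show "(\<lambda>j. ?m j x) \<longlonglongrightarrow> 0"
      proof (cases "x \<in> U")
        case True
        have "(\<lambda>j. h j + x) \<longlonglongrightarrow> 0 + x" by (intro tendsto_intros h)
        then have "\<forall>\<^sub>F j in sequentially. h j + x \<in> U"
          using topological_tendstoD[OF _ U(1)] True by auto
        then show ?thesis
          by (intro tendsto_eventually) (elim eventually_mono, simp add: True)
      qed simp
    qed
  qed (auto simp: indicator_def)
  then have "(\<lambda>j. LINT x|lborel. ?m j x) \<longlonglongrightarrow> 0" by simp
  then have lim: "(\<lambda>j. 2 * (LINT x|lborel. ?m j x)) \<longlonglongrightarrow> 0"
    by (rule tendsto_mult_right_zero)
  have "(LINT x|lborel. \<bar>indicator U (h j + x) - indicator U x :: real\<bar>) = 2 * (LINT x|lborel. ?m j x)" for j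
  proof -
    have "\<bar>indicator U (h j + x) - indicator U x :: real\<bar> = 2 * ?m j x + (indicator U (h j + x) - indicator U x)" for x
      by (auto simp: indicator_def)
    then have "(LINT x|lborel. \<bar>indicator U (h j + x) - indicator U x :: real\<bar>)
       = 2 * (LINT x|lborel. ?m j x) + ((LINT x|lborel. indicator U (h j + x)) - (LINT x|lborel. indicator U x))"
      using im iU iUh by simp
    also have "(LINT x|lborel. indicator U (h j + x) :: real) = (LINT x|lborel. indicator U x)"
      by (rule integral_lborel_translate) simp
    finally show ?thesis by simp
  qed
  with lim show ?thesis by simp
qed

lemma L1_translation_perturb:
  fixes f s :: "'a::euclidean_space \<Rightarrow> real"
  assumes f: "integrable lborel f" and s: "integrable lborel s"
  shows "(LINT x|lborel. \<bar>f (h + x) - f x\<bar>)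
     \<le> (LINT x|lborel. \<bar>s (h + x) - s x\<bar>) + 2 * (LINT x|lborel. \<bar>f x - s x\<bar>)"
proof -
  note fh = integrable_lborel_translate[OF f, of h] and sh = integrable_lborel_translate[OF s, of h]
  have "(LINT x|lborel. \<bar>f (h + x) - f x\<bar>)
     \<le> (LINT x|lborel. \<bar>s (h + x) - s x\<bar> + \<bar>f (h + x) - s (h + x)\<bar> + \<bar>f x - s x\<bar>)"
    using f s fh sh by (intro integral_mono) auto
  also have "\<dots> = (LINT x|lborel. \<bar>s (h + x) - s x\<bar>) + (LINT x|lborel. \<bar>f (h + x) - s (h + x)\<bar>)
       + (LINT x|lborel. \<bar>f x - s x\<bar>)"
    using f s fh sh by simp
  also have "(LINT x|lborel. \<bar>f (h + x) - s (h + x)\<bar>) = (LINT x|lborel. \<bar>f x - s x\<bar>)"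
    using f s by (intro integral_lborel_translate[of "\<lambda>x. \<bar>f x - s x\<bar>"]) auto
  finally show ?thesis by simp
qed

text \<open>
  Translation is an isometry of \<open>L\<^sup>1\<close>, so it suffices to treat a dense class: first indicators, by outer
  regularity, and then general integrable functions.
\<close>

lemma L1_translation_approx:
  fixes f :: "'a::euclidean_space \<Rightarrow> real"
  assumes f: "integrable lborel f"
    and approx: "\<And>e. 0 < e \<Longrightarrow> \<exists>s. integrable lborel s \<and> (LINT x|lborel. \<bar>f x - s x\<bar>) < e \<and>
       (\<lambda>j. LINT x|lborel. \<bar>s (h j + x) - s x\<bar>) \<longlonglongrightarrow> 0"
  shows "(\<lambda>j. LINT x|lborel. \<bar>f (h j + x) - f x\<bar>) \<longlonglongrightarrow> 0"
proof (rule LIMSEQ_I)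
  fix e :: real assume "0 < e"
  then obtain s where s: "integrable lborel s" "(LINT x|lborel. \<bar>f x - s x\<bar>) < e / 4"
    "(\<lambda>j. LINT x|lborel. \<bar>s (h j + x) - s x\<bar>) \<longlonglongrightarrow> 0"
    using approx[of "e / 4"] by auto
  obtain N where N: "\<And>j. N \<le> j \<Longrightarrow> norm ((LINT x|lborel. \<bar>s (h j + x) - s x\<bar>) - 0) < e / 2"
    using LIMSEQ_D[OF s(3), of "e / 2"] \<open>0 < e\<close> by auto
  have "norm ((LINT x|lborel. \<bar>f (h j + x) - f x\<bar>) - 0) < e" if "N \<le> j" for j
    using N[OF that] s(2) L1_translation_perturb[OF f s(1), of "h j"] by simp
  then show "\<exists>no. \<forall>n\<ge>no. norm ((LINT x|lborel. \<bar>f (h n + x) - f x\<bar>) - 0) < e" by blast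
qed

lemma L1_translation_continuous:
  fixes f :: "'a::euclidean_space \<Rightarrow> real" and h :: "nat \<Rightarrow> 'a"
  assumes f: "integrable lborel f" and h: "h \<longlonglongrightarrow> 0"
  shows "(\<lambda>j. LINT x|lborel. \<bar>f (h j + x) - f x\<bar>) \<longlonglongrightarrow> 0"
  using f
proof (induct rule: integrable_induct)
  case (base A c)
  show ?case
  proof (rule L1_translation_approx)
    show iA: "integrable lborel (\<lambda>x. indicator A x *\<^sub>R c)" using base by simp
    fix e :: real assume e: "0 < e"
    have A: "A \<in> sets borel" "A \<in> sets lebesgue" using base by auto
    define e' where "e' = e / (\<bar>c\<bar> + 1)"
    have e': "0 < e'" "\<bar>c\<bar> * e' < e" using e by (auto simp: e'_def field_simps)
    obtain U where U: "open U" "A \<subseteq> U" "emeasure lebesgue (U - A) < ennreal e'"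
      using sets_lebesgue_outer_open[OF A(2) e'(1)] by metis
    have meas: "U \<in> sets borel" "U - A \<in> sets borel" using U A by auto
    have UA: "emeasure lborel (U - A) < ennreal e'" using U(3) meas by simp
    have "emeasure lborel U \<le> emeasure lborel A + emeasure lborel (U - A)"
      using U(2) A meas by (subst plus_emeasure) (auto simp: Un_absorb1)
    moreover have finD: "emeasure lborel (U - A) < \<infinity>" using less_trans[OF UA ennreal_less_top] by simp
    ultimately have fin: "emeasure lborel U < \<infinity>"
      using base(2) le_less_trans[of "emeasure lborel U" "emeasure lborel A + emeasure lborel (U - A)" top]
      by (simp add: ennreal_add_less_top)
    have iU: "integrable lborel (\<lambda>x. c * indicator U x)" using fin meas by simp
    have "(LINT x|lborel. \<bar>indicator A x *\<^sub>R c - c * indicator U x\<bar>) = (LINT x|lborel. \<bar>c\<bar> * indicator (U - A) x)"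
      using U(2) by (intro Bochner_Integration.integral_cong) (auto simp: indicator_def)
    also have "\<dots> = \<bar>c\<bar> * measure lborel (U - A)" using meas finD by simp
    also have "\<dots> \<le> \<bar>c\<bar> * e'"
      using UA e' finD by (intro mult_left_mono) (auto simp: measure_def intro!: enn2real_leI)
    also have "\<dots> < e" by (rule e')
    finally have "(LINT x|lborel. \<bar>indicator A x *\<^sub>R c - c * indicator U x\<bar>) < e" .
    moreover have "(\<lambda>j. \<bar>c\<bar> * (LINT x|lborel. \<bar>indicator U (h j + x) - indicator U x\<bar>)) \<longlonglongrightarrow> 0"
      by (rule tendsto_mult_right_zero[OF L1_translation_continuous_open[OF U(1) fin h]])
    then have "(\<lambda>j. LINT x|lborel. \<bar>c * indicator U (h j + x) - c * indicator U x\<bar>) \<longlonglongrightarrow> 0"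
      by (simp add: abs_mult flip: right_diff_distrib)
    ultimately show "\<exists>s. integrable lborel s \<and> (LINT x|lborel. \<bar>indicator A x *\<^sub>R c - s x\<bar>) < e \<and>
       (\<lambda>j. LINT x|lborel. \<bar>s (h j + x) - s x\<bar>) \<longlonglongrightarrow> 0"
      using iU by blast
  qed
next
  case (add f g)
  note fh = integrable_lborel_translate[OF add(1)] and gh = integrable_lborel_translate[OF add(3)]
  have lim: "(\<lambda>j. (LINT x|lborel. \<bar>f (h j + x) - f x\<bar>) + (LINT x|lborel. \<bar>g (h j + x) - g x\<bar>)) \<longlonglongrightarrow> 0 + 0"
    by (rule tendsto_add[OF add(2) add(4)])
  have le: "(LINT x|lborel. \<bar>(f (h j + x) + g (h j + x)) - (f x + g x)\<bar>)
      \<le> (LINT x|lborel. \<bar>f (h j + x) - f x\<bar>) + (LINT x|lborel. \<bar>g (h j + x) - g x\<bar>)" for j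
  proof -
    have "(LINT x|lborel. \<bar>(f (h j + x) + g (h j + x)) - (f x + g x)\<bar>)
        \<le> (LINT x|lborel. \<bar>f (h j + x) - f x\<bar> + \<bar>g (h j + x) - g x\<bar>)"
      using add(1,3) fh[of "h j"] gh[of "h j"] by (intro integral_mono) auto
    also have "\<dots> = (LINT x|lborel. \<bar>f (h j + x) - f x\<bar>) + (LINT x|lborel. \<bar>g (h j + x) - g x\<bar>)"
      using add(1,3) fh[of "h j"] gh[of "h j"] by (intro Bochner_Integration.integral_add) auto
    finally show ?thesis .
  qed
  show ?case
  proof (rule Lim_null_comparison)
    show "\<forall>\<^sub>F j in sequentially. norm (LINT x|lborel. \<bar>(f (h j + x) + g (h j + x)) - (f x + g x)\<bar>)
       \<le> (LINT x|lborel. \<bar>f (h j + x) - f x\<bar>) + (LINT x|lborel. \<bar>g (h j + x) - g x\<bar>)"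
      using le by (intro always_eventually allI) simp
    show "(\<lambda>j. (LINT x|lborel. \<bar>f (h j + x) - f x\<bar>) + (LINT x|lborel. \<bar>g (h j + x) - g x\<bar>)) \<longlonglongrightarrow> 0"
      using lim by (simp only: add_0)
  qed
next
  case (lim f s)
  show ?case
  proof (rule L1_translation_approx[OF lim(5)])
    fix e :: real assume e: "0 < e"
    have "(\<lambda>i. LINT x|lborel. \<bar>f x - s i x\<bar>) \<longlonglongrightarrow> (LINT x|(lborel :: 'a measure). (0::real))"
    proof (rule integral_dominated_convergence[where w = "\<lambda>x. 3 * \<bar>f x\<bar>"])
      show "AE x in lborel. (\<lambda>i. \<bar>f x - s i x\<bar>) \<longlonglongrightarrow> 0"
      proof (rule AE_I2)
        fix x :: 'a
        have "(\<lambda>i. \<bar>f x - s i x\<bar>) \<longlonglongrightarrow> \<bar>f x - f x\<bar>" by (intro tendsto_intros lim(3)) simp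
        then show "(\<lambda>i. \<bar>f x - s i x\<bar>) \<longlonglongrightarrow> 0" by simp
      qed
      show "AE x in lborel. norm \<bar>f x - s i x\<bar> \<le> 3 * \<bar>f x\<bar>" for i
      proof (rule AE_I2)
        fix x :: 'a
        show "norm \<bar>f x - s i x\<bar> \<le> 3 * \<bar>f x\<bar>" using lim(4)[of x i] by simp
      qed
    qed (use lim in auto)
    then have "(\<lambda>i. LINT x|lborel. \<bar>f x - s i x\<bar>) \<longlonglongrightarrow> 0" by simp
    from order_tendstoD(2)[OF this e] obtain i where "(LINT x|lborel. \<bar>f x - s i x\<bar>) < e"
      by (auto simp: eventually_sequentially)
    then show "\<exists>s. integrable lborel s \<and> (LINT x|lborel. \<bar>f x - s x\<bar>) < e \<and>
       (\<lambda>j. LINT x|lborel. \<bar>s (h j + x) - s x\<bar>) \<longlonglongrightarrow> 0"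
      using lim(1,2) by blast
  qed
qed

lemma integral_linear_combination:
  fixes a b c :: "'b \<Rightarrow> real"
  assumes "integrable N a" "integrable N b" "integrable N c"
  shows "(LINT p|N. s * a p + t * b p - c p) = s * (LINT p|N. a p) + t * (LINT p|N. b p) - (LINT p|N. c p)"
  using assms by simp

text \<open>
  Fatou's lemma in the form in which a uniform bound passes to a pointwise limit.
\<close>

lemma nn_integral_limit_le:
  fixes F :: "nat \<Rightarrow> 'b \<Rightarrow> ennreal"
  assumes "\<And>i. F i \<in> borel_measurable N" and lim: "\<And>x. (\<lambda>i. F i x) \<longlonglongrightarrow> G x"
    and le: "\<And>i. (\<integral>\<^sup>+x. F i x \<partial>N) \<le> B"
  shows "(\<integral>\<^sup>+x. G x \<partial>N) \<le> B"
proof -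
  have "(\<integral>\<^sup>+x. G x \<partial>N) = (\<integral>\<^sup>+x. liminf (\<lambda>i. F i x) \<partial>N)"
    using lim by (intro nn_integral_cong) (metis lim_imp_Liminf sequentially_bot)
  also have "\<dots> \<le> liminf (\<lambda>i. \<integral>\<^sup>+x. F i x \<partial>N)"
    by (rule nn_integral_liminf) (rule assms(1))
  also have "\<dots> \<le> liminf (\<lambda>i. B)"
    by (intro Liminf_mono always_eventually allI le)
  finally show ?thesis by (simp add: Liminf_const)
qed

section \<open>Integrals over dyadic shells\<close>

abbreviation shell :: "real \<Rightarrow> 'a::real_normed_vector set" where
  "shell r \<equiv> {z. r \<le> norm z \<and> norm z < 2 * r}"

abbreviation open_shell :: "real \<Rightarrow> 'a::real_normed_vector set" where
  "open_shell r \<equiv> {z. r < norm z \<and> norm z < 2 * r}"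

lemma dyadic_shell_above:
  fixes t r q :: real
  assumes "0 < r" "r \<le> t" "1 < q"
  obtains k :: nat where "r * q ^ k \<le> t" "t < r * q ^ Suc k"
proof -
  obtain j where j: "t / r < q ^ j" using real_arch_pow[OF assms(3)] by blast
  define i where "i = (LEAST j. t / r < q ^ j)"
  have i: "t / r < q ^ i" unfolding i_def by (rule LeastI, rule j)
  with assms have "i \<noteq> 0" by (intro notI) auto
  then obtain k where k: "i = Suc k" using not0_implies_Suc by blast
  then have "\<not> t / r < q ^ k" unfolding i_def by (intro not_less_Least) auto
  then show thesis using that[of k] i k assms by (auto simp: field_simps)
qed

lemma power_powr_swap:
  fixes x :: real
  shows "0 < x \<Longrightarrow> (x ^ j) powr s = (x powr s) ^ j"
  by (simp flip: powr_realpow add: powr_powr mult.commute)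

lemma negative_power_unbounded:
  fixes B s :: real
  assumes "0 < s"
  obtains r0 where "0 < r0" "\<And>d. 0 < d \<Longrightarrow> d < r0 \<Longrightarrow> B < d powr (- s)"
proof (rule that)
  let ?B = "\<bar>B\<bar> + 1"
  show "0 < ?B powr (- 1 / s)" by simp
  fix d :: real assume d: "0 < d" "d < ?B powr (- 1 / s)"
  have "B < ?B" by simp
  also have "?B = (?B powr (- 1 / s)) powr (- s)" using assms by (simp add: powr_powr)
  also have "\<dots> < d powr (- s)" using d assms by (intro powr_less_mono2_neg) auto
  finally show "B < d powr (- s)" .
qed

lemma suminf_ennreal_geometric:
  assumes "0 \<le> q" "q < 1" "0 \<le> A"
  shows "(\<Sum>j. ennreal (A * q ^ j)) = ennreal (A / (1 - q))"
proof -
  have "(\<lambda>j. A * q ^ j) sums (A * (1 / (1 - q)))"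
    using assms by (intro sums_mult geometric_sums) auto
  then show ?thesis using assms by (intro suminf_ennreal_eq) auto
qed

lemma nn_integral_countable_cover:
  fixes f :: "'a::euclidean_space \<Rightarrow> ennreal"
  assumes [measurable]: "f \<in> borel_measurable borel" "\<And>j::nat. S j \<in> sets borel" "A \<in> sets borel"
    and sub: "A \<subseteq> (\<Union>j. S j)"
    and le: "\<And>j. (\<integral>\<^sup>+z. f z * indicator (S j) z \<partial>lborel) \<le> B j"
  shows "(\<integral>\<^sup>+z. f z * indicator A z \<partial>lborel) \<le> (\<Sum>j. B j)"
proof -
  have "f z * indicator A z \<le> (\<Sum>j. f z * indicator (S j) z)" for z
  proof (cases "z \<in> A")
    case True
    then obtain j where "z \<in> S j" using sub by blast
    then have "f z * indicator A z = (\<Sum>i\<in>{j}. f z * indicator (S i) z)" using True by simp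
    also have "\<dots> \<le> (\<Sum>j. f z * indicator (S j) z)" by (intro sum_le_suminf) auto
    finally show ?thesis .
  qed simp
  then have "(\<integral>\<^sup>+z. f z * indicator A z \<partial>lborel) \<le> (\<integral>\<^sup>+z. (\<Sum>j. f z * indicator (S j) z) \<partial>lborel)"
    by (intro nn_integral_mono) auto
  also have "\<dots> = (\<Sum>j. \<integral>\<^sup>+z. f z * indicator (S j) z \<partial>lborel)"
    by (intro nn_integral_suminf) auto
  also have "\<dots> \<le> (\<Sum>j. B j)" by (intro suminf_le le) auto
  finally show ?thesis .
qed

text \<open>
  The three bounds on power weights come from their homogeneity: a shell of radius \<open>r\<close> contributes \<open>r\<^sup>s\<close>,
  and the dyadic shells inside a ball (for \<open>s > 0\<close>) or outside it (for negative exponents) sum geometrically.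
\<close>

lemma nn_integral_power_shell:
  fixes s :: real
  obtains C where "0 < C" and
    "\<And>r. 0 < r \<Longrightarrow>
       (\<integral>\<^sup>+z. ennreal (norm z powr (s - DIM('a))) * indicator {z. r \<le> norm z \<and> norm z \<le> 2 * r} z
           \<partial>(lborel :: 'a::euclidean_space measure)) \<le> ennreal (C * r powr s)"
proof
  let ?n = "DIM('a)"
  let ?V = "unit_ball_vol ?n"
  show "0 < 2 powr \<bar>s - ?n\<bar> * (2 ^ ?n * ?V)" by simp
  fix r :: real assume r: "0 < r"
  have bound: "t powr (s - ?n) \<le> 2 powr \<bar>s - ?n\<bar> * r powr (s - ?n)" if "r \<le> t" "t \<le> 2 * r" for t
  proof -
    define q where "q = t / r"
    have q: "1 \<le> q" "q \<le> 2" "t = q * r" using that r by (auto simp: q_def field_simps)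
    have "q powr (s - ?n) \<le> q powr \<bar>s - ?n\<bar>" using q by (intro powr_mono) auto
    also have "\<dots> \<le> 2 powr \<bar>s - ?n\<bar>" using q by (intro powr_mono2) auto
    finally show ?thesis using q r by (simp add: powr_mult mult_right_mono)
  qed
  have "(\<integral>\<^sup>+z. ennreal (norm z powr (s - ?n)) * indicator {z. r \<le> norm z \<and> norm z \<le> 2 * r} z
           \<partial>(lborel :: 'a measure))
     \<le> (\<integral>\<^sup>+z. ennreal (2 powr \<bar>s - ?n\<bar> * r powr (s - ?n)) * indicator (cball 0 (2 * r)) z
           \<partial>(lborel :: 'a measure))"
    by (intro nn_integral_mono) (auto simp: indicator_def bound ennreal_leI)
  also have "\<dots> = ennreal (2 powr \<bar>s - ?n\<bar> * r powr (s - ?n)) * emeasure lborel (cball 0 (2 * r) :: 'a set)"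
    by (simp add: nn_integral_cmult_indicator)
  also have "emeasure lborel (cball 0 (2 * r) :: 'a set) = ennreal (?V * (2 * r) ^ ?n)"
    using r by (simp add: emeasure_cball)
  also have "ennreal (2 powr \<bar>s - ?n\<bar> * r powr (s - ?n)) * ennreal (?V * (2 * r) ^ ?n)
     = ennreal (2 powr \<bar>s - ?n\<bar> * (2 ^ ?n * ?V) * (r powr (s - ?n) * r ^ ?n))"
    by (subst ennreal_mult[symmetric]) (use r in \<open>auto simp: power_mult_distrib algebra_simps\<close>)
  also have "r powr (s - ?n) * r ^ ?n = r powr s"
    using r by (simp flip: powr_realpow add: powr_add[symmetric])
  finally show "(\<integral>\<^sup>+z. ennreal (norm z powr (s - ?n)) * indicator {z. r \<le> norm z \<and> norm z \<le> 2 * r} z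
           \<partial>(lborel :: 'a measure)) \<le> ennreal (2 powr \<bar>s - ?n\<bar> * (2 ^ ?n * ?V) * r powr s)" .
qed

lemma nn_integral_power_ball:
  fixes s :: real
  assumes "0 < s"
  obtains C where "0 < C" and
    "\<And>r. 0 < r \<Longrightarrow>
       (\<integral>\<^sup>+z. ennreal (norm z powr (s - DIM('a))) * indicator (ball 0 r) z
           \<partial>(lborel :: 'a::euclidean_space measure)) \<le> ennreal (C * r powr s)"
proof -
  obtain C where C: "0 < C" "\<And>r. 0 < r \<Longrightarrow>
       (\<integral>\<^sup>+z. ennreal (norm z powr (s - DIM('a))) * indicator {z. r \<le> norm z \<and> norm z \<le> 2 * r} z
           \<partial>(lborel :: 'a measure)) \<le> ennreal (C * r powr s)"
    using nn_integral_power_shell[where 'a='a] by blast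
  define q where "q = (1/2 :: real) powr s"
  have q: "0 < q" "q < 1" using assms powr_less_mono2[of s "1/2" 1] by (auto simp: q_def)
  show thesis
  proof
    show "0 < C / (1 - q)" using C q by simp
    fix r :: real assume r: "0 < r"
    define S :: "nat \<Rightarrow> 'a set" where "S j = {z. r * (1/2) ^ Suc j \<le> norm z \<and> norm z \<le> 2 * (r * (1/2) ^ Suc j)}" for j
    have cover: "ball 0 r - {0} \<subseteq> (\<Union>j. S j)"
    proof
      fix z :: 'a assume z: "z \<in> ball 0 r - {0}"
      then have z': "0 < norm z / r" "norm z / r < 1" using r by auto
      obtain j where j: "(1/2) ^ j < norm z / r" using real_arch_pow_inv[OF z'(1), of "1/2"] by auto
      define i where "i = (LEAST j. (1/2::real) ^ j < norm z / r)"
      have i: "(1/2) ^ i < norm z / r" unfolding i_def by (rule LeastI, rule j)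
      with z' have "i \<noteq> 0" by (intro notI) auto
      then obtain k where k: "i = Suc k" using not0_implies_Suc by blast
      then have "\<not> (1/2) ^ k < norm z / r" unfolding i_def by (intro not_less_Least) auto
      then have "z \<in> S k" using i k r by (auto simp: S_def field_simps)
      then show "z \<in> (\<Union>j. S j)" by blast
    qed
    have le: "(\<integral>\<^sup>+z. ennreal (norm z powr (s - DIM('a))) * indicator (S j) z \<partial>lborel)
        \<le> ennreal (C * r powr s * q ^ j)" for j
    proof -
      have "((1/2) ^ Suc j) powr s = q ^ Suc j"
        unfolding q_def by (rule power_powr_swap) simp
      then have pw: "(r * (1/2) ^ Suc j) powr s = r powr s * q ^ Suc j"
        using r powr_mult[of r "(1/2) ^ Suc j" s] by simp
      have "(\<integral>\<^sup>+z. ennreal (norm z powr (s - DIM('a))) * indicator (S j) z \<partial>lborel)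
        \<le> ennreal (C * (r * (1/2) ^ Suc j) powr s)"
        unfolding S_def using r by (intro C) auto
      also have "\<dots> \<le> ennreal (C * r powr s * q ^ j)"
        unfolding pw mult.assoc using C q r power_decreasing[of j "Suc j" q]
        by (intro ennreal_leI mult_left_mono) auto
      finally show ?thesis .
    qed
    have "(\<integral>\<^sup>+z. ennreal (norm z powr (s - DIM('a))) * indicator (ball 0 r) z \<partial>(lborel :: 'a measure))
      = (\<integral>\<^sup>+z. ennreal (norm z powr (s - DIM('a))) * indicator (ball 0 r - {0}) z \<partial>(lborel :: 'a measure))"
      by (rule nn_integral_cong_AE, rule AE_mp[OF AE_lborel_singleton[of 0]]) (auto simp: indicator_def)
    also have "\<dots> \<le> (\<Sum>j. ennreal (C * r powr s * q ^ j))"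
      by (rule nn_integral_countable_cover[OF _ _ _ cover le]) (auto simp: S_def)
    also have "\<dots> = ennreal (C / (1 - q) * r powr s)"
      using C q by (subst suminf_ennreal_geometric) auto
    finally show "(\<integral>\<^sup>+z. ennreal (norm z powr (s - DIM('a))) * indicator (ball 0 r) z
           \<partial>(lborel :: 'a measure)) \<le> ennreal (C / (1 - q) * r powr s)" .
  qed
qed

lemma nn_integral_power_outside_ball:
  fixes s :: real
  assumes "0 < s"
  obtains C where "0 < C" and
    "\<And>r. 0 < r \<Longrightarrow>
       (\<integral>\<^sup>+z. ennreal (norm z powr (- s - DIM('a))) * indicator {z. r \<le> norm z} z
           \<partial>(lborel :: 'a::euclidean_space measure)) \<le> ennreal (C * r powr (- s))"
proof -
  obtain C where C: "0 < C" "\<And>r. 0 < r \<Longrightarrow>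
       (\<integral>\<^sup>+z. ennreal (norm z powr (- s - DIM('a))) * indicator {z. r \<le> norm z \<and> norm z \<le> 2 * r} z
           \<partial>(lborel :: 'a measure)) \<le> ennreal (C * r powr (- s))"
    using nn_integral_power_shell[where 'a='a] by blast
  define q where "q = 2 powr (- s)"
  have q: "0 < q" "q < 1" using assms by (auto simp: q_def powr_less_one)
  show thesis
  proof
    show "0 < C / (1 - q)" using C q by simp
    fix r :: real assume r: "0 < r"
    define S :: "nat \<Rightarrow> 'a set" where "S j = {z. r * 2 ^ j \<le> norm z \<and> norm z \<le> 2 * (r * 2 ^ j)}" for j
    have cover: "{z. r \<le> norm z} \<subseteq> (\<Union>j. S j)"
    proof
      fix z :: 'a assume z: "z \<in> {z. r \<le> norm z}"
      then obtain k :: nat where "r * 2 ^ k \<le> norm z" "norm z < r * 2 ^ Suc k"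
        using dyadic_shell_above[OF r, of "norm z" 2] by auto
      then have "z \<in> S k" by (auto simp: S_def)
      then show "z \<in> (\<Union>j. S j)" by blast
    qed
    have le: "(\<integral>\<^sup>+z. ennreal (norm z powr (- s - DIM('a))) * indicator (S j) z \<partial>lborel)
        \<le> ennreal (C * r powr (- s) * q ^ j)" for j
    proof -
      have "(2 ^ j) powr (- s) = q ^ j"
        unfolding q_def by (rule power_powr_swap) simp
      then have pw: "(r * 2 ^ j) powr (- s) = r powr (- s) * q ^ j"
        using r by (simp add: powr_mult)
      have "(\<integral>\<^sup>+z. ennreal (norm z powr (- s - DIM('a))) * indicator (S j) z \<partial>lborel)
        \<le> ennreal (C * (r * 2 ^ j) powr (- s))"
        unfolding S_def using r by (intro C) auto
      then show ?thesis unfolding pw by (simp add: mult.assoc)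
    qed
    have "(\<integral>\<^sup>+z. ennreal (norm z powr (- s - DIM('a))) * indicator {z. r \<le> norm z} z \<partial>(lborel :: 'a measure))
       \<le> (\<Sum>j. ennreal (C * r powr (- s) * q ^ j))"
      by (rule nn_integral_countable_cover[OF _ _ _ cover le]) (auto simp: S_def)
    also have "\<dots> = ennreal (C / (1 - q) * r powr (- s))"
      using C q by (subst suminf_ennreal_geometric) auto
    finally show "(\<integral>\<^sup>+z. ennreal (norm z powr (- s - DIM('a))) * indicator {z. r \<le> norm z} z
           \<partial>(lborel :: 'a measure)) \<le> ennreal (C / (1 - q) * r powr (- s))" .
  qed
qed

text \<open>
  Shells of ratio \<open>2\<close> whose radii grow by the factor \<open>3/2\<close> overlap, so the open shells cover the whole exterior.
  The hypothesis is only about radii \<open>r > R\<close>; the first shell, of radius \<open>R\<close> itself, is obtained as a limit.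
\<close>

lemma tail_moment_finite:
  fixes k :: "'a::euclidean_space \<Rightarrow> real"
  assumes k [measurable]: "k \<in> borel_measurable borel" and k0: "\<And>z. 0 \<le> k z"
    and R: "0 < R" and B: "0 \<le> B" and \<beta>: "0 \<le> \<beta>" "\<beta> < \<theta>"
    and shell: "\<And>r. R < r \<Longrightarrow>
       (\<integral>\<^sup>+z. ennreal (k z) * indicator (open_shell r) z \<partial>lborel) \<le> ennreal (B * r powr (- \<theta>))"
  shows "(\<integral>\<^sup>+z. ennreal (norm z powr \<beta> * k z) * indicator {z. R < norm z} z \<partial>lborel) < \<infinity>"
proof -
  have shell_R: "(\<integral>\<^sup>+z. ennreal (k z) * indicator (open_shell R) z \<partial>lborel) \<le> ennreal (B * R powr (- \<theta>))"
  proof -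
    define r where "r i = R + R / real (Suc i)" for i
    have r: "R < r i" for i using R by (simp add: r_def)
    have r_lim: "r \<longlonglongrightarrow> R"
    proof -
      have "(\<lambda>i. R + R * (1 / real (Suc i))) \<longlonglongrightarrow> R + R * 0"
        by (intro tendsto_add tendsto_mult tendsto_const LIMSEQ_Suc lim_1_over_n)
      then show ?thesis by (simp add: r_def[abs_def])
    qed
    let ?F = "\<lambda>i z. ennreal (k z) * indicator {z. r i < norm z \<and> norm z < 2 * R} z"
    have m: "?F i \<in> borel_measurable lborel" for i by measurable
    have l: "(\<lambda>i. ?F i z) \<longlonglongrightarrow> ennreal (k z) * indicator (open_shell R) z" for z
    proof (cases "R < norm z")
      case True
      have "\<forall>\<^sub>F i in sequentially. r i < norm z" by (rule order_tendstoD(2)[OF r_lim True])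
      then have "\<forall>\<^sub>F i in sequentially. ?F i z = ennreal (k z) * indicator (open_shell R) z"
        by eventually_elim (use True in \<open>simp add: indicator_def\<close>)
      then show ?thesis by (rule tendsto_eventually)
    next
      case False
      have "?F i z = 0" for i using r[of i] False by (simp add: indicator_def)
      moreover have "ennreal (k z) * indicator (open_shell R) z = 0" using False by simp
      ultimately show ?thesis by (simp only: tendsto_const)
    qed
    have b: "(\<integral>\<^sup>+z. ?F i z \<partial>lborel) \<le> ennreal (B * R powr (- \<theta>))" for i
    proof -
      have "(\<integral>\<^sup>+z. ?F i z \<partial>lborel) \<le> (\<integral>\<^sup>+z. ennreal (k z) * indicator (open_shell (r i)) z \<partial>lborel)"
        using r[of i] by (intro nn_integral_mono mult_left_mono) (auto simp: indicator_def)
      also have "\<dots> \<le> ennreal (B * r i powr (- \<theta>))" by (rule shell[OF r])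
      also have "\<dots> \<le> ennreal (B * R powr (- \<theta>))"
        using r[of i] R B \<beta> by (intro ennreal_leI mult_left_mono powr_mono2') auto
      finally show ?thesis .
    qed
    show ?thesis by (rule nn_integral_limit_le[where F = "?F", OF m l b])
  qed
  define R' where "R' j = R * (3 / 2) ^ j" for j :: nat
  have R': "0 < R' j" "R \<le> R' j" for j using R by (auto simp: R'_def mult_le_cancel_left1)
  have shell': "(\<integral>\<^sup>+z. ennreal (k z) * indicator (open_shell (R' j)) z \<partial>lborel) \<le> ennreal (B * R' j powr (- \<theta>))" for j
    using shell[of "R' j"] shell_R R'(2)[of j] by (cases "R < R' j") auto
  define q where "q = (3 / 2 :: real) powr (\<beta> - \<theta>)"
  have q: "0 < q" "q < 1" using \<beta> by (auto simp: q_def powr_less_one)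
  define A where "A = 2 powr \<beta> * B * R powr (\<beta> - \<theta>)"
  have A: "0 \<le> A" using B by (simp add: A_def)
  have "(\<integral>\<^sup>+z. ennreal (norm z powr \<beta> * k z) * indicator {z. R < norm z} z \<partial>lborel) \<le> (\<Sum>j. ennreal (A * q ^ j))"
  proof (rule nn_integral_countable_cover[where S = "\<lambda>j. (open_shell (R' j))"])
    show "{z :: 'a. R < norm z} \<subseteq> (\<Union>j. (open_shell (R' j)))"
    proof
      fix z :: 'a assume "z \<in> {z. R < norm z}"
      then have z: "R < norm z" by simp
      obtain i where i: "R' i \<le> norm z" "norm z < R' (Suc i)"
        using dyadic_shell_above[of R "norm z" "3 / 2"] R z unfolding R'_def by auto
      show "z \<in> (\<Union>j. (open_shell (R' j)))"
      proof (cases "R' i < norm z")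
        case True
        moreover have "R' (Suc i) \<le> 2 * R' i" using R'(1)[of i] by (simp add: R'_def)
        ultimately show ?thesis using i by force
      next
        case False
        then have eq: "norm z = R' i" using i by simp
        then have "i \<noteq> 0" using z by (intro notI) (simp add: R'_def)
        then obtain l where l: "i = Suc l" using not0_implies_Suc by blast
        have "R' i = 3 / 2 * R' l" by (simp add: R'_def l)
        then have "R' l < norm z \<and> norm z < 2 * R' l" using eq R'(1)[of l] by simp
        then show ?thesis by blast
      qed
    qed
    show "(\<integral>\<^sup>+z. ennreal (norm z powr \<beta> * k z) * indicator (open_shell (R' j)) z \<partial>lborel)
        \<le> ennreal (A * q ^ j)" for j
    proof -
      let ?S = "(open_shell (R' j)) :: 'a set"
      have "(\<integral>\<^sup>+z. ennreal (norm z powr \<beta> * k z) * indicator ?S z \<partial>lborel)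
        \<le> (\<integral>\<^sup>+z. ennreal ((2 * R' j) powr \<beta>) * (ennreal (k z) * indicator ?S z) \<partial>lborel)"
      proof (rule nn_integral_mono)
        fix z :: 'a
        have "norm z powr \<beta> * k z \<le> (2 * R' j) powr \<beta> * k z" if "norm z < 2 * R' j"
          using that \<beta> k0 by (intro mult_right_mono powr_mono2) auto
        then show "ennreal (norm z powr \<beta> * k z) * indicator ?S z \<le> ennreal ((2 * R' j) powr \<beta>) * (ennreal (k z) * indicator ?S z)"
          using k0[of z] by (cases "z \<in> ?S") (simp_all add: ennreal_leI flip: ennreal_mult)
      qed
      also have "\<dots> = ennreal ((2 * R' j) powr \<beta>) * (\<integral>\<^sup>+z. ennreal (k z) * indicator ?S z \<partial>lborel)"
        by (rule nn_integral_cmult) measurable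
      also have "\<dots> \<le> ennreal ((2 * R' j) powr \<beta>) * ennreal (B * R' j powr (- \<theta>))"
        by (intro mult_left_mono shell') simp
      also have "\<dots> = ennreal ((2 * R' j) powr \<beta> * (B * R' j powr (- \<theta>)))"
        using B by (intro ennreal_mult[symmetric]) auto
      also have "(2 * R' j) powr \<beta> * (B * R' j powr (- \<theta>)) = A * q ^ j"
      proof -
        have "R' j powr \<beta> * R' j powr (- \<theta>) = R' j powr (\<beta> - \<theta>)" by (simp flip: powr_add)
        also have "\<dots> = R powr (\<beta> - \<theta>) * q ^ j"
          using R power_powr_swap[of "3 / 2" j "\<beta> - \<theta>"] by (simp add: R'_def powr_mult q_def)
        finally have "R' j powr \<beta> * R' j powr (- \<theta>) = R powr (\<beta> - \<theta>) * q ^ j" .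
        then show ?thesis using R'(1)[of j] by (simp add: powr_mult A_def mult_ac)
      qed
      finally show ?thesis .
    qed
  qed measurable
  also have "\<dots> = ennreal (A / (1 - q))" using q A by (intro suminf_ennreal_geometric) auto
  also have "\<dots> < \<infinity>" by simp
  finally show ?thesis .
qed

section \<open>Monotone nonlinearities of power growth\<close>

text \<open>
  This is what the argument needs of \<open>g = \<Phi>'\<close>. No bound on the modulus of continuity of \<open>g\<close> is available,
  since \<open>\<Phi>''\<close> is uncontrolled near \<open>0\<close>.
\<close>

locale growth_nonlinearity =
  fixes g :: "real \<Rightarrow> real" and \<beta> C :: real
  assumes g_strict_mono: "strict_mono g" and g_cont: "continuous_on UNIV g"
    and g_odd: "g (- t) = - g t" and beta_ge_2: "2 \<le> \<beta>" and C_pos: "0 < C"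
    and g_growth: "0 \<le> t \<Longrightarrow> g t \<le> C * t powr (\<beta> - 1)"
begin

lemma g_mono: "s \<le> t \<Longrightarrow> g s \<le> g t"
  using g_strict_mono by (simp add: strict_mono_less_eq)

lemma g_less: "s < t \<Longrightarrow> g s < g t"
  using g_strict_mono by (simp add: strict_mono_less)

lemma g_0: "g 0 = 0"
  using g_odd[of 0] by simp

lemma g_nonneg: "0 \<le> t \<Longrightarrow> 0 \<le> g t"
  using g_mono[of 0 t] g_0 by simp

lemma g_pos: "0 < t \<Longrightarrow> 0 < g t"
  using g_less[of 0 t] g_0 by simp

lemma g_abs: "\<bar>g t\<bar> = g \<bar>t\<bar>"
  using g_nonneg[of t] g_nonneg[of "- t"] g_odd[of t] by (auto simp: abs_if)

lemma g_mult_nonneg: "0 \<le> g t * t"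
  using g_nonneg[of t] g_nonneg[of "- t"] g_odd[of t] by (cases "0 \<le> t") (auto simp: zero_le_mult_iff)

lemma g_mult_pos: "t \<noteq> 0 \<Longrightarrow> 0 < g t * t"
  using g_pos[of t] g_pos[of "- t"] g_odd[of t] by (cases "0 < t") (auto simp: zero_less_mult_iff)

lemma g_diff_bound: "\<bar>s\<bar> \<le> M \<Longrightarrow> \<bar>t\<bar> \<le> M \<Longrightarrow> \<bar>g (s - t)\<bar> \<le> g (2 * M)"
  unfolding g_abs by (rule g_mono) auto

lemma g_borel [measurable]: "g \<in> borel_measurable borel"
  using g_cont by (rule borel_measurable_continuous_onI)

lemma g_cont_comp [continuous_intros]: "continuous_on S h \<Longrightarrow> continuous_on S (\<lambda>x. g (h x))"
  using continuous_on_compose2[OF g_cont] by blast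

lemma g_gap:
  assumes "0 < \<kappa>" "0 \<le> B"
  obtains m where "0 < m" "\<And>t. \<bar>t\<bar> \<le> B \<Longrightarrow> g t + m \<le> g (t + \<kappa>)"
proof -
  have "continuous_on {-B..B} (\<lambda>t. g (t + \<kappa>) - g t)" by (intro continuous_intros)
  then have "\<exists>t0\<in>{-B..B}. \<forall>t\<in>{-B..B}. g (t0 + \<kappa>) - g t0 \<le> g (t + \<kappa>) - g t"
    using assms by (intro continuous_attains_inf) auto
  then obtain t0 where t0: "\<And>t. t \<in> {-B..B} \<Longrightarrow> g (t0 + \<kappa>) - g t0 \<le> g (t + \<kappa>) - g t"
    by blast
  show thesis
  proof (rule that)
    show "0 < g (t0 + \<kappa>) - g t0" using g_less[of t0 "t0 + \<kappa>"] assms by simp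
    show "g t + (g (t0 + \<kappa>) - g t0) \<le> g (t + \<kappa>)" if "\<bar>t\<bar> \<le> B" for t
      using t0[of t] that by (auto simp: abs_le_iff)
  qed
qed

text \<open>
  Choice of the height of the touching parabola in the continuity argument.
\<close>

lemma small_eta:
  assumes "0 < A" "0 < B" "0 < c" "0 < k"
  obtains \<eta> where "0 < \<eta>" "\<eta> \<le> k" "A * \<eta> powr (\<beta> - 1) + B * g (2 * \<eta>) \<le> c"
proof -
  have "((\<lambda>\<eta>. A * \<eta> powr (\<beta> - 1) + B * g (2 * \<eta>)) \<longlongrightarrow> A * 0 powr (\<beta> - 1) + B * g (2 * 0)) (at_right 0)"
  proof (intro tendsto_add tendsto_mult tendsto_const)
    show "((\<lambda>\<eta>. \<eta> powr (\<beta> - 1)) \<longlongrightarrow> 0 powr (\<beta> - 1)) (at_right 0)"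
    proof (rule tendsto_powr')
      show "0 \<noteq> (0::real) \<or> 0 < \<beta> - 1 \<and> (\<forall>\<^sub>F \<eta> in at_right (0::real). 0 \<le> \<eta>)"
        using beta_ge_2 by (auto simp: eventually_at_filter)
    qed (rule tendsto_ident_at, rule tendsto_const)
    have "isCont g (2 * 0)" using g_cont by (simp add: continuous_on_eq_continuous_at)
    then show "((\<lambda>\<eta>. g (2 * \<eta>)) \<longlongrightarrow> g (2 * 0)) (at_right 0)"
      by (rule isCont_tendsto_compose) (intro tendsto_intros)
  qed
  then have "((\<lambda>\<eta>. A * \<eta> powr (\<beta> - 1) + B * g (2 * \<eta>)) \<longlongrightarrow> 0) (at_right 0)" by (simp add: g_0)
  from order_tendstoD(2)[OF this assms(3)]
  obtain b where b: "0 < b" "\<And>\<eta>. 0 < \<eta> \<Longrightarrow> \<eta> < b \<Longrightarrow> A * \<eta> powr (\<beta> - 1) + B * g (2 * \<eta>) < c"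
    unfolding eventually_at_right_field by auto
  show thesis
    using that[of "min k (b / 2)"] b(1) b(2)[of "min k (b / 2)"] assms(4) by force
qed

text \<open>
  If \<open>p\<close> is large compared with \<open>b\<close>, then \<open>p s + b s\<^sup>2\<close> is dominated by \<open>p t - b t\<^sup>2\<close> at the shifted point
  \<open>t = s + 13 b / p\<close>, and shifting the argument of a monotone function changes its integral over \<open>[1, 2]\<close> at
  most by the length of the shift times the maximum. Otherwise both terms are of size \<open>b\<close> and are estimated separately.
  In this way monotonicity replaces a modulus of continuity.
\<close>

lemma parabola_gap_1d_nonneg:
  assumes p: "0 \<le> p" and b: "0 \<le> b"
  shows "integral {1..2} (\<lambda>s. g (p * s + b * s\<^sup>2) - g (p * s - b * s\<^sup>2))
           \<le> 2 * C * 30 powr \<beta> * b * (max p b) powr (\<beta> - 2)"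
proof (cases "b = 0")
  case True
  then show ?thesis by simp
next
  case False
  with b have b0: "0 < b" by simp
  let ?G = "\<lambda>s. g (p * s - b * s\<^sup>2)" and ?K = "\<lambda>s. g (p * s + b * s\<^sup>2)"
  have int: "(\<lambda>s. g (h s)) integrable_on {x..y}" if "continuous_on UNIV h" for h and x y :: real
    by (intro integrable_continuous_real continuous_intros continuous_on_subset[OF that]) auto
  have cG: "continuous_on UNIV (\<lambda>s. p * s - b * s\<^sup>2)" "continuous_on UNIV (\<lambda>s. p * s + b * s\<^sup>2)"
    by (intro continuous_intros)+
  show ?thesis
  proof (cases "13 * b \<le> p")
    case True
    with b0 have p0: "0 < p" by linarith
    \<comment> \<open>For \<open>t \<le> 2\<close> and \<open>\<sigma> \<le> 1\<close> one has \<open>t\<^sup>2 + (t + \<sigma>)\<^sup>2 \<le> 4 + 9 = 13\<close>.\<close>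
    define \<sigma> where "\<sigma> = 13 * b / p"
    have s: "0 < \<sigma>" "\<sigma> \<le> 1" "p * \<sigma> = 13 * b" using True p0 b0 by (auto simp: \<sigma>_def)
    have "?K t \<le> ?G (t + \<sigma>)" if "t \<in> {1..2}" for t
    proof (rule g_mono)
      have "t\<^sup>2 \<le> 2\<^sup>2" "(t + \<sigma>)\<^sup>2 \<le> 3\<^sup>2" using that s by (intro power_mono; simp)+
      then have "b * t\<^sup>2 + b * (t + \<sigma>)\<^sup>2 \<le> b * 4 + b * 9"
        using b0 by (intro add_mono mult_left_mono) auto
      then show "p * t + b * t\<^sup>2 \<le> p * (t + \<sigma>) - b * (t + \<sigma>)\<^sup>2"
        using s(3) by (simp add: algebra_simps)
    qed
    then have "integral {1..2} ?K \<le> integral {1..2} (\<lambda>t. ?G (t + \<sigma>))"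
      by (intro integral_le int continuous_intros) auto
    also have "\<dots> = integral {1 + \<sigma>..2 + \<sigma>} ?G"
      using integral_shift_Icc_real[of 1 2 ?G \<sigma>] by (simp add: o_def add.commute)
    finally have 1: "integral {1..2} ?K \<le> integral {1 + \<sigma>..2 + \<sigma>} ?G" .
    have 2: "integral {1..2} ?G + integral {2..2 + \<sigma>} ?G = integral {1..1 + \<sigma>} ?G + integral {1 + \<sigma>..2 + \<sigma>} ?G"
      using s by (subst (1 2) Henstock_Kurzweil_Integration.integral_combine) (auto intro!: int cG)
    have 3: "0 \<le> integral {1..1 + \<sigma>} ?G"
    proof (intro integral_nonneg int cG g_nonneg)
      fix t assume t: "t \<in> {1..1 + \<sigma>}"
      then have "b * t \<le> b * 2" using s b0 by (intro mult_left_mono) auto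
      then have "b * t \<le> p" using True b0 by linarith
      then have "b * t * t \<le> p * t" using t s by (intro mult_right_mono) auto
      then show "0 \<le> p * t - b * t\<^sup>2" by (simp add: power2_eq_square mult.assoc)
    qed
    have "integral {2..2 + \<sigma>} ?G \<le> integral {2..2 + \<sigma>} (\<lambda>_. C * (3 * p) powr (\<beta> - 1))"
    proof (intro integral_le int cG integrable_const_ivl)
      fix t assume t: "t \<in> {2..2 + \<sigma>}"
      have "p * t \<le> p * 3" using t s p0 by (intro mult_left_mono) auto
      then have "p * t - b * t\<^sup>2 \<le> 3 * p" using b0 zero_le_power2[of t] by (smt (verit) mult_nonneg_nonneg)
      then have "?G t \<le> g (3 * p)" by (rule g_mono)
      also have "\<dots> \<le> C * (3 * p) powr (\<beta> - 1)" using p0 by (intro g_growth) auto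
      finally show "?G t \<le> C * (3 * p) powr (\<beta> - 1)" .
    qed
    then have 4: "integral {2..2 + \<sigma>} ?G \<le> \<sigma> * (C * (3 * p) powr (\<beta> - 1))" using s by (simp add: mult_ac)
    have "integral {1..2} (\<lambda>s. ?K s - ?G s) = integral {1..2} ?K - integral {1..2} ?G"
      by (intro integral_diff int cG)
    also have "\<dots> \<le> \<sigma> * (C * (3 * p) powr (\<beta> - 1))" using 1 2 3 4 by linarith
    also have "\<dots> = 13 * 3 powr (\<beta> - 1) * C * b * p powr (\<beta> - 2)"
    proof -
      have "p powr (\<beta> - 1) = p powr (\<beta> - 2) * p" using p0 powr_mult_base[of p "\<beta> - 2"] by (simp add: mult.commute)
      then show ?thesis using p0 by (simp add: \<sigma>_def powr_mult)
    qed
    also have "\<dots> \<le> 2 * 30 powr \<beta> * C * b * (max p b) powr (\<beta> - 2)"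
    proof -
      have "3 powr (\<beta> - 1) \<le> 30 powr (\<beta> - 1)" using beta_ge_2 by (intro powr_mono2) auto
      moreover have "30 powr \<beta> = 30 powr (\<beta> - 1) * 30" using powr_mult_base[of 30 "\<beta> - 1"] by simp
      ultimately have "13 * 3 powr (\<beta> - 1) \<le> 2 * 30 powr \<beta>" by (smt (verit) powr_ge_zero)
      moreover have "p powr (\<beta> - 2) \<le> (max p b) powr (\<beta> - 2)" using p0 beta_ge_2 by (intro powr_mono2) auto
      ultimately show ?thesis
        using C_pos b0 by (intro mult_mono[OF mult_right_mono[OF mult_right_mono]]) auto
    qed
    finally show ?thesis by (simp add: mult_ac)
  next
    case False
    have bd: "\<bar>g t\<bar> \<le> C * (30 * b) powr (\<beta> - 1)" if "\<bar>t\<bar> \<le> 30 * b" for t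
    proof -
      have "\<bar>g t\<bar> \<le> g (30 * b)" unfolding g_abs using that by (rule g_mono)
      also have "\<dots> \<le> C * (30 * b) powr (\<beta> - 1)" using b0 by (intro g_growth) auto
      finally show ?thesis .
    qed
    have "integral {1..2} (\<lambda>s. ?K s - ?G s) \<le> integral {1..2::real} (\<lambda>_. 2 * (C * (30 * b) powr (\<beta> - 1)))"
    proof (intro integral_le integrable_diff int cG integrable_const_ivl)
      fix t :: real assume t: "t \<in> {1..2}"
      have "0 \<le> p * t" "p * t \<le> p * 2" using t p by (auto intro!: mult_left_mono)
      moreover have "0 \<le> b * t\<^sup>2" "b * t\<^sup>2 \<le> b * 4"
        using t b0 power_mono[of t 2 2] by (auto intro!: mult_left_mono)
      ultimately have "\<bar>p * t + b * t\<^sup>2\<bar> \<le> 30 * b" "\<bar>p * t - b * t\<^sup>2\<bar> \<le> 30 * b"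
        using False b0 unfolding abs_le_iff by linarith+
      from bd[OF this(1)] bd[OF this(2)] show "?K t - ?G t \<le> 2 * (C * (30 * b) powr (\<beta> - 1))" by linarith
    qed
    also have "\<dots> = 2 * 30 powr (\<beta> - 1) * C * b * b powr (\<beta> - 2)"
    proof -
      have "b powr (\<beta> - 1) = b powr (\<beta> - 2) * b" using b0 powr_mult_base[of b "\<beta> - 2"] by (simp add: mult.commute)
      then show ?thesis using b0 by (simp add: powr_mult)
    qed
    also have "\<dots> \<le> 2 * 30 powr \<beta> * C * b * (max p b) powr (\<beta> - 2)"
    proof -
      have "2 * 30 powr (\<beta> - 1) \<le> 2 * 30 powr \<beta>" by (intro mult_left_mono powr_mono) auto
      moreover have "b powr (\<beta> - 2) \<le> (max p b) powr (\<beta> - 2)" using b0 beta_ge_2 by (intro powr_mono2) auto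
      ultimately show ?thesis
        using C_pos b0 by (intro mult_mono[OF mult_right_mono[OF mult_right_mono]]) auto
    qed
    finally show ?thesis by (simp add: mult_ac)
  qed
qed

text \<open>
  The integrand is even in \<open>p\<close> because \<open>g\<close> is odd.
\<close>

lemma parabola_gap_1d:
  assumes b: "0 \<le> b"
  shows "integral {1..2} (\<lambda>s. g (p * s + b * s\<^sup>2) - g (p * s - b * s\<^sup>2))
           \<le> 2 * C * 30 powr \<beta> * b * (max \<bar>p\<bar> b) powr (\<beta> - 2)"
proof (cases "0 \<le> p")
  case True
  then show ?thesis using parabola_gap_1d_nonneg[OF True b] by simp
next
  case False
  have "g (p * s + b * s\<^sup>2) - g (p * s - b * s\<^sup>2) = g (- p * s + b * s\<^sup>2) - g (- p * s - b * s\<^sup>2)" for s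
    using g_odd[of "p * s + b * s\<^sup>2"] g_odd[of "p * s - b * s\<^sup>2"] by (simp add: algebra_simps)
  then show ?thesis using parabola_gap_1d_nonneg[of "- p" b] False b by simp
qed

lemma parabola_gap_1d_nn:
  assumes b: "0 \<le> b"
  shows "(\<integral>\<^sup>+s. ennreal (g (p * s + b * s\<^sup>2) - g (p * s - b * s\<^sup>2)) * indicator {1..2} s \<partial>lborel)
           \<le> ennreal (2 * C * 30 powr \<beta> * b * (max \<bar>p\<bar> b) powr (\<beta> - 2))"
proof -
  let ?h = "\<lambda>s. g (p * s + b * s\<^sup>2) - g (p * s - b * s\<^sup>2)"
  have c: "continuous_on {1..2} ?h" by (intro continuous_intros)
  have nn: "0 \<le> ?h s" for s using g_mono[of "p * s - b * s\<^sup>2" "p * s + b * s\<^sup>2"] b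
    by (simp add: mult_nonneg_nonneg)
  have "(\<integral>\<^sup>+s. ennreal (?h s) * indicator {1..2} s \<partial>lborel)
      = (\<integral>\<^sup>+s. ennreal (indicator {1..2} s * ?h s) \<partial>lborel)"
    by (intro nn_integral_cong) (auto simp: indicator_def)
  also have "\<dots> = ennreal (integral {1..2} ?h)"
    using c nn by (intro nn_integral_has_integral_lebesgue integrable_integral integrable_continuous_real)
  finally have "(\<integral>\<^sup>+s. ennreal (?h s) * indicator {1..2} s \<partial>lborel) = ennreal (integral {1..2} ?h)" .
  then show ?thesis using parabola_gap_1d[OF b, of p] by (simp add: ennreal_leI)
qed

text \<open>
  The one-dimensional estimate is applied along rays. Instead of polar coordinates one averages over
  the dilations \<open>z = s y\<close> with \<open>1 \<le> s \<le> 2\<close>: the integral of a homogeneous weight changes under such a dilation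
  only by a bounded factor, and Tonelli's theorem brings the integral over \<open>s\<close> inside. The remaining weight
  \<open>\<bar>y\<bar>\<close> to the power \<open>\<beta> - \<alpha> - n\<close> is integrable near \<open>0\<close> because \<open>\<alpha> < \<beta>\<close>.
\<close>

lemma parabola_gap:
  assumes al: "0 < \<alpha>" "\<alpha> < \<beta>"
  obtains C' where "0 < C'" and
    "\<And>(a::'a::euclidean_space) b Q r. 0 \<le> b \<Longrightarrow> norm a \<le> Q \<Longrightarrow> b * r \<le> Q \<Longrightarrow> 0 < r \<Longrightarrow>
       (\<integral>\<^sup>+z. ennreal ((g (a \<bullet> z + b * (norm z)\<^sup>2) - g (a \<bullet> z - b * (norm z)\<^sup>2)) * norm z powr (- \<alpha> - DIM('a)))
            * indicator (ball 0 r) z \<partial>lborel) \<le> ennreal (C' * (b * Q powr (\<beta> - 2) * r powr (\<beta> - \<alpha>)))"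
proof -
  let ?n = "DIM('a)"
  obtain P where P: "0 < P" "\<And>r. 0 < r \<Longrightarrow>
       (\<integral>\<^sup>+z. ennreal (norm z powr ((\<beta> - \<alpha>) - ?n)) * indicator (ball 0 r) z
           \<partial>(lborel :: 'a measure)) \<le> ennreal (P * r powr (\<beta> - \<alpha>))"
    using nn_integral_power_ball[where 'a='a, of "\<beta> - \<alpha>"] al by auto
  define c where "c = 2 * C * 30 powr \<beta>"
  have c: "0 < c" using C_pos by (simp add: c_def)
  show thesis
  proof (rule that)
    show "0 < c * P" using c P by simp
    fix a :: 'a and b Q r :: real
    assume b: "0 \<le> b" and aQ: "norm a \<le> Q" and bQ: "b * r \<le> Q" and r: "0 < r"
    have Q: "0 \<le> Q" using aQ norm_ge_zero order_trans by blast
    define H where "H z = g (a \<bullet> z + b * (norm z)\<^sup>2) - g (a \<bullet> z - b * (norm z)\<^sup>2)" for z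
    have [measurable]: "H \<in> borel_measurable borel" unfolding H_def[abs_def] by measurable
    have H0: "0 \<le> H z" for z unfolding H_def
      using g_mono[of "a \<bullet> z - b * (norm z)\<^sup>2" "a \<bullet> z + b * (norm z)\<^sup>2"] b by (simp add: mult_nonneg_nonneg)
    have [measurable]: "ball (0::'a) r \<in> sets borel" by simp
    define F where "F z = ennreal (H z * norm z powr (- \<alpha> - ?n)) * indicator (ball 0 r) z" for z
    have [measurable]: "F \<in> borel_measurable borel" unfolding F_def[abs_def] by measurable
    define G where "G s y = ennreal (H (s *\<^sub>R y) * norm y powr (- \<alpha> - ?n)) * indicator (ball 0 r) y * indicator {1..2} s" for s y
    have Gm: "(\<lambda>(s, y). G s y) \<in> borel_measurable (lborel \<Otimes>\<^sub>M lborel)"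
      unfolding G_def[abs_def] by measurable
    define X where "X = (\<integral>\<^sup>+z. F z \<partial>lborel)"
    have dil: "X * indicator {1..2} s \<le> (\<integral>\<^sup>+y. G s y \<partial>lborel)" for s
    proof (cases "s \<in> {1..2}")
      case True
      then have s: "0 < s" "1 \<le> s" by auto
      have "X = ennreal (s ^ ?n) * (\<integral>\<^sup>+y. F (s *\<^sub>R y) \<partial>lborel)"
        unfolding X_def by (intro nn_integral_lborel_scale s) simp
      also have "\<dots> = (\<integral>\<^sup>+y. ennreal (s ^ ?n) * F (s *\<^sub>R y) \<partial>lborel)"
        by (rule nn_integral_cmult[symmetric]) simp
      also have "\<dots> \<le> (\<integral>\<^sup>+y. G s y \<partial>lborel)"
      proof (rule nn_integral_mono)
        fix y :: 'a
        show "ennreal (s ^ ?n) * F (s *\<^sub>R y) \<le> G s y"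
        proof (cases "s * norm y < r")
          case inside: True
          have "norm y \<le> s * norm y" using s by (simp add: mult_le_cancel_right1)
          then have y: "y \<in> ball 0 r" using inside by simp
          have "s powr (- \<alpha>) \<le> s powr 0" using s al by (intro powr_mono) auto
          then have le: "s powr (- \<alpha>) * norm y powr (- \<alpha> - ?n) \<le> norm y powr (- \<alpha> - ?n)"
            using s mult_right_mono[of "s powr (- \<alpha>)" 1 "norm y powr (- \<alpha> - ?n)"] by simp
          have "s ^ ?n * (s * norm y) powr (- \<alpha> - ?n) = s powr (- \<alpha>) * norm y powr (- \<alpha> - ?n)"
            using s by (simp add: powr_mult flip: powr_realpow powr_add)
          then have "s ^ ?n * (H (s *\<^sub>R y) * (s * norm y) powr (- \<alpha> - ?n)) \<le> H (s *\<^sub>R y) * norm y powr (- \<alpha> - ?n)"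
            using mult_left_mono[OF le H0[of "s *\<^sub>R y"]] by (simp only: mult_ac)
          then show ?thesis
            using inside y True s by (simp add: F_def G_def ennreal_leI flip: ennreal_mult')
        qed (use s in \<open>simp add: F_def\<close>)
      qed
      finally show ?thesis using True by simp
    qed simp
    have "X = (\<integral>\<^sup>+s. X * indicator {1..2::real} s \<partial>lborel)"
      by (simp add: nn_integral_cmult_indicator)
    also have "\<dots> \<le> (\<integral>\<^sup>+s. (\<integral>\<^sup>+y. G s y \<partial>lborel) \<partial>lborel)"
      by (intro nn_integral_mono dil)
    also have "\<dots> = (\<integral>\<^sup>+y. (\<integral>\<^sup>+s. G s y \<partial>lborel) \<partial>lborel)"
      by (rule lborel_pair.Fubini'[OF Gm, symmetric])
    also have "\<dots> \<le> (\<integral>\<^sup>+y. ennreal (c * (b * Q powr (\<beta> - 2))) * (ennreal (norm y powr ((\<beta> - \<alpha>) - ?n)) * indicator (ball 0 r) y) \<partial>(lborel :: 'a measure))"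
    proof (rule nn_integral_mono)
      fix y :: 'a
      define b' where "b' = b * (norm y)\<^sup>2"
      have b': "0 \<le> b'" using b by (simp add: b'_def)
      show "(\<integral>\<^sup>+s. G s y \<partial>lborel) \<le> ennreal (c * (b * Q powr (\<beta> - 2))) * (ennreal (norm y powr ((\<beta> - \<alpha>) - ?n)) * indicator (ball 0 r) y)"
      proof (cases "y \<in> ball 0 r \<and> y \<noteq> 0")
        case True
        then have y: "0 < norm y" "norm y < r" by auto
        have Hs: "H (s *\<^sub>R y) = g ((a \<bullet> y) * s + b' * s\<^sup>2) - g ((a \<bullet> y) * s - b' * s\<^sup>2)" for s
          by (simp add: H_def b'_def power_mult_distrib mult_ac)
        have "(\<integral>\<^sup>+s. G s y \<partial>lborel)
          = (\<integral>\<^sup>+s. ennreal (norm y powr (- \<alpha> - ?n)) * (ennreal (H (s *\<^sub>R y)) * indicator {1..2} s) \<partial>lborel)"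
          using True H0 by (intro nn_integral_cong) (simp add: G_def ennreal_mult mult_ac)
        also have "\<dots> = ennreal (norm y powr (- \<alpha> - ?n)) * (\<integral>\<^sup>+s. ennreal (H (s *\<^sub>R y)) * indicator {1..2} s \<partial>lborel)"
          by (rule nn_integral_cmult) measurable
        also have "\<dots> \<le> ennreal (norm y powr (- \<alpha> - ?n)) * ennreal (c * b' * (max \<bar>a \<bullet> y\<bar> b') powr (\<beta> - 2))"
          unfolding Hs c_def by (intro mult_left_mono parabola_gap_1d_nn b') auto
        also have "\<dots> \<le> ennreal (norm y powr (- \<alpha> - ?n)) * ennreal (c * b' * (Q * norm y) powr (\<beta> - 2))"
        proof (intro mult_left_mono ennreal_leI powr_mono2)
          have "\<bar>a \<bullet> y\<bar> \<le> norm a * norm y" by (rule Cauchy_Schwarz_ineq2)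
          also have "\<dots> \<le> Q * norm y" using aQ by (intro mult_right_mono) auto
          finally have "\<bar>a \<bullet> y\<bar> \<le> Q * norm y" .
          moreover have "b * norm y \<le> Q" using b y bQ by (smt (verit) mult_left_mono)
          then have "b' \<le> Q * norm y" unfolding b'_def power2_eq_square mult.assoc[symmetric] by (intro mult_right_mono) auto
          ultimately show "max \<bar>a \<bullet> y\<bar> b' \<le> Q * norm y" by simp
        qed (use c b' beta_ge_2 in auto)
        also have "\<dots> = ennreal (norm y powr (- \<alpha> - ?n) * (c * b' * (Q * norm y) powr (\<beta> - 2)))"
          using c b' by (intro ennreal_mult[symmetric]) auto
        also have "norm y powr (- \<alpha> - ?n) * (c * b' * (Q * norm y) powr (\<beta> - 2))
           = c * (b * Q powr (\<beta> - 2)) * norm y powr ((\<beta> - \<alpha>) - ?n)"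
        proof -
          have "norm y powr (- \<alpha> - ?n) * ((norm y)\<^sup>2 * norm y powr (\<beta> - 2)) = norm y powr ((\<beta> - \<alpha>) - ?n)"
            using y by (simp flip: powr_numeral powr_add) (simp add: algebra_simps)
          then show ?thesis using Q by (simp add: b'_def powr_mult mult_ac)
        qed
        also have "ennreal (c * (b * Q powr (\<beta> - 2)) * norm y powr ((\<beta> - \<alpha>) - ?n))
           = ennreal (c * (b * Q powr (\<beta> - 2))) * ennreal (norm y powr ((\<beta> - \<alpha>) - ?n))"
          using c b by (intro ennreal_mult) auto
        finally show ?thesis using True by simp
      next
        case False
        then have "G s y = 0" for s by (auto simp: G_def H_def)
        then show ?thesis by simp
      qed
    qed
    also have "\<dots> = ennreal (c * (b * Q powr (\<beta> - 2))) * (\<integral>\<^sup>+y. ennreal (norm y powr ((\<beta> - \<alpha>) - ?n)) * indicator (ball 0 r) (y::'a) \<partial>lborel)"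
      by (rule nn_integral_cmult) measurable
    also have "\<dots> \<le> ennreal (c * (b * Q powr (\<beta> - 2))) * ennreal (P * r powr (\<beta> - \<alpha>))"
      by (intro mult_left_mono P r) auto
    also have "\<dots> = ennreal (c * P * (b * Q powr (\<beta> - 2) * r powr (\<beta> - \<alpha>)))"
      using c b P by (subst ennreal_mult[symmetric]) (auto simp: mult_ac)
    finally show "(\<integral>\<^sup>+z. ennreal ((g (a \<bullet> z + b * (norm z)\<^sup>2) - g (a \<bullet> z - b * (norm z)\<^sup>2)) * norm z powr (- \<alpha> - DIM('a)))
            * indicator (ball 0 r) z \<partial>lborel) \<le> ennreal (c * P * (b * Q powr (\<beta> - 2) * r powr (\<beta> - \<alpha>)))"
      unfolding X_def F_def H_def .
  qed
qed

end

lemma power_diff_le: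
  fixes p q :: real
  assumes "0 \<le> q" "q \<le> p"
  shows "p ^ Suc j - q ^ Suc j \<le> real (Suc j) * p ^ j * (p - q)"
proof (induction j)
  case (Suc j)
  have "p ^ Suc (Suc j) - q ^ Suc (Suc j) = p ^ Suc j * (p - q) + q * (p ^ Suc j - q ^ Suc j)"
    by (simp add: algebra_simps)
  also have "\<dots> \<le> p ^ Suc j * (p - q) + p * (real (Suc j) * p ^ j * (p - q))"
  proof -
    have "q ^ Suc j \<le> p ^ Suc j" using assms by (intro power_mono) auto
    then show ?thesis
      using mult_mono[OF assms(2) Suc.IH] assms by (simp del: power_Suc)
  qed
  also have "\<dots> = real (Suc (Suc j)) * p ^ Suc j * (p - q)" by (simp add: algebra_simps)
  finally show ?case .
qed simp

lemma power_lipschitz: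
  fixes p q :: real
  assumes "0 \<le> p" "p \<le> 1" "0 \<le> q" "q \<le> 1"
  shows "\<bar>p ^ Suc j - q ^ Suc j\<bar> \<le> real (Suc j) * \<bar>p - q\<bar>"
proof -
  have main: "a ^ Suc j - b ^ Suc j \<le> real (Suc j) * (a - b)" if "0 \<le> b" "b \<le> a" "a \<le> 1" for a b :: real
  proof -
    have "a ^ Suc j - b ^ Suc j \<le> real (Suc j) * a ^ j * (a - b)" by (rule power_diff_le[OF that(1,2)])
    also have "\<dots> \<le> real (Suc j) * 1 * (a - b)"
      using that by (intro mult_right_mono mult_left_mono power_le_one) auto
    finally show ?thesis by simp
  qed
  show ?thesis
  proof (cases "q \<le> p")
    case True
    then have "q ^ Suc j \<le> p ^ Suc j" using assms by (intro power_mono) auto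
    then show ?thesis using main[of q p] True assms by (simp del: power_Suc)
  next
    case False
    then have "p ^ Suc j \<le> q ^ Suc j" using assms by (intro power_mono) auto
    then show ?thesis using main[of p q] False assms by (simp del: power_Suc)
  qed
qed

context growth_nonlinearity
begin

text \<open>
  This is Young's inequality in the form needed for the Caccioppoli estimate, with \<open>p\<close> and \<open>q\<close> the values of the
  cutoff at two points. If \<open>c (p - q) \<le> s p \<bar>d\<bar>\<close>, the left side is absorbed by the energy term. Otherwise
  \<open>p \<bar>d\<bar>\<close> is at most \<open>c (p - q) / s\<close>, and since \<open>p\<^sup>j\<close> is at most \<open>p\<close> to the power \<open>\<beta> - 1\<close>, the
  growth bound on \<open>g\<close> turns the left side into the last term. The indicator of \<open>p \<noteq> q\<close> localises the energy
  term to the region where the cutoff varies.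
\<close>

lemma absorption_ordered:
  fixes d p q s M :: real
  assumes q: "0 \<le> q" "q \<le> p" "p \<le> 1" and s: "0 < s" and M: "0 < M" and j: "\<beta> - 1 \<le> real j"
  defines "c \<equiv> 4 * M * real (Suc j)"
  shows "2 * M * \<bar>g d\<bar> * (p ^ Suc j - q ^ Suc j)
    \<le> s * (g d * d) * ((p ^ Suc j + q ^ Suc j) / 2) * of_bool (p \<noteq> q)
       + C * c powr \<beta> * s powr (1 - \<beta>) * (p - q) powr \<beta>"
proof (cases "p = q")
  case False
  then have pq: "q < p" "0 < p" using q by auto
  define t where "t = \<bar>d\<bar>"
  have t: "0 \<le> t" "g d * d = g t * t" "\<bar>g d\<bar> = g t"
    using g_odd[of d] by (simp_all add: t_def g_abs) (auto simp: abs_if)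
  have gt: "0 \<le> g t" using t by (intro g_nonneg)
  have c: "0 < c" using M by (simp add: c_def)
  have lhs: "2 * M * \<bar>g d\<bar> * (p ^ Suc j - q ^ Suc j) \<le> (c / 2) * (g t * p ^ j * (p - q))"
  proof -
    have "2 * M * g t * (p ^ Suc j - q ^ Suc j) \<le> 2 * M * g t * (real (Suc j) * p ^ j * (p - q))"
      using M gt power_diff_le[OF q(1,2), of j] by (intro mult_left_mono) auto
    then show ?thesis unfolding t(3) c_def by (simp add: algebra_simps del: power_Suc of_nat_Suc)
  qed
  have Y0: "0 \<le> C * c powr \<beta> * s powr (1 - \<beta>) * (p - q) powr \<beta>" using C_pos by simp
  show ?thesis
  proof (cases "c * (p - q) \<le> s * (p * t)")
    case True
    have "(c / 2) * (g t * p ^ j * (p - q)) = (g t * p ^ j / 2) * (c * (p - q))" by simp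
    also have "\<dots> \<le> (g t * p ^ j / 2) * (s * (p * t))" using True gt pq by (intro mult_left_mono) auto
    also have "\<dots> = s * (g t * t) * (p ^ Suc j / 2)" by simp
    also have "\<dots> \<le> s * (g t * t) * ((p ^ Suc j + q ^ Suc j) / 2)"
      using s gt t q by (intro mult_left_mono) auto
    finally show ?thesis using lhs False Y0 t by simp
  next
    case False
    have "t * p \<le> c / s * (p - q)" using False s by (simp add: field_simps)
    have "p ^ j \<le> p powr (\<beta> - 1)"
      using pq q j by (simp add: powr_realpow[symmetric] powr_mono')
    then have "g t * p ^ j \<le> (C * t powr (\<beta> - 1)) * p powr (\<beta> - 1)"
      using t gt pq C_pos by (intro mult_mono g_growth) auto
    also have "\<dots> = C * (t * p) powr (\<beta> - 1)" using t pq by (simp add: powr_mult)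
    also have "\<dots> \<le> C * (c / s * (p - q)) powr (\<beta> - 1)"
      using \<open>t * p \<le> c / s * (p - q)\<close> t pq C_pos beta_ge_2 by (intro mult_left_mono powr_mono2) auto
    finally have "(c / 2) * (g t * p ^ j * (p - q)) \<le> (c / 2) * (C * (c / s * (p - q)) powr (\<beta> - 1) * (p - q))"
      using c pq by (intro mult_left_mono mult_right_mono) auto
    also have "\<dots> = (C * c powr \<beta> * s powr (1 - \<beta>) * (p - q) powr \<beta>) / 2"
    proof -
      have 1: "c powr \<beta> = c * c powr (\<beta> - 1)" using c powr_mult_base[of c "\<beta> - 1"] by simp
      have 2: "(p - q) powr \<beta> = (p - q) * (p - q) powr (\<beta> - 1)" using pq powr_mult_base[of "p - q" "\<beta> - 1"] by simp
      have 3: "s powr (1 - \<beta>) = 1 / s powr (\<beta> - 1)" using powr_minus_divide[of s "\<beta> - 1"] by simp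
      have 4: "(c / s * (p - q)) powr (\<beta> - 1) = c powr (\<beta> - 1) * (p - q) powr (\<beta> - 1) * (1 / s powr (\<beta> - 1))"
        using c s pq by (simp add: powr_mult powr_divide)
      have "c / 2 * (C * (P * X * T) * D) = C * (c * P) * T * (D * X) / 2" for P X T D :: real
        by (simp add: algebra_simps)
      then show ?thesis unfolding 1 2 3 4 .
    qed
    also have "\<dots> \<le> C * c powr \<beta> * s powr (1 - \<beta>) * (p - q) powr \<beta>" using Y0 by simp
    finally have "(c / 2) * (g t * p ^ j * (p - q)) \<le> C * c powr \<beta> * s powr (1 - \<beta>) * (p - q) powr \<beta>" .
    moreover have "0 \<le> s * (g d * d) * ((p ^ Suc j + q ^ Suc j) / 2) * of_bool (p \<noteq> q)"
      using s q pq g_mult_nonneg[of d] by simp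
    ultimately show ?thesis using lhs by linarith
  qed
qed (use C_pos in simp)

lemma absorption:
  fixes d p q s M m :: real
  assumes p: "0 \<le> p" "p \<le> 1" and q: "0 \<le> q" "q \<le> 1" and s: "0 < s" and M: "0 < M" and j: "\<beta> - 1 \<le> real j"
    and m: "0 \<le> m" "m \<le> 2 * M"
  shows "\<bar>g d * (m * (p ^ Suc j - q ^ Suc j))\<bar>
    \<le> s * (g d * d) * ((p ^ Suc j + q ^ Suc j) / 2) * of_bool (p \<noteq> q)
       + C * (4 * M * real (Suc j)) powr \<beta> * s powr (1 - \<beta>) * \<bar>p - q\<bar> powr \<beta>"
proof -
  have "\<bar>g d * (m * (p ^ Suc j - q ^ Suc j))\<bar> = m * (\<bar>g d\<bar> * \<bar>p ^ Suc j - q ^ Suc j\<bar>)"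
    using m by (simp add: abs_mult del: power_Suc)
  also have "\<dots> \<le> 2 * M * (\<bar>g d\<bar> * \<bar>p ^ Suc j - q ^ Suc j\<bar>)"
    using m by (intro mult_right_mono) (auto simp del: power_Suc)
  finally have 1: "\<bar>g d * (m * (p ^ Suc j - q ^ Suc j))\<bar> \<le> 2 * M * \<bar>g d\<bar> * \<bar>p ^ Suc j - q ^ Suc j\<bar>"
    by (simp add: mult.assoc del: power_Suc)
  show ?thesis
  proof (cases "q \<le> p")
    case True
    then have "q ^ Suc j \<le> p ^ Suc j" using q by (intro power_mono) auto
    then have e1: "\<bar>p ^ Suc j - q ^ Suc j\<bar> = p ^ Suc j - q ^ Suc j" by (simp del: power_Suc)
    have e2: "\<bar>p - q\<bar> = p - q" using True by simp
    from order_trans[OF 1[unfolded e1] absorption_ordered[OF q(1) True p(2) s M j, of d]]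
    show ?thesis unfolding e2 .
  next
    case False
    then have "p ^ Suc j \<le> q ^ Suc j" using p by (intro power_mono) auto
    then have e1: "\<bar>p ^ Suc j - q ^ Suc j\<bar> = q ^ Suc j - p ^ Suc j" by (simp del: power_Suc)
    have e2: "\<bar>p - q\<bar> = q - p" "p ^ Suc j + q ^ Suc j = q ^ Suc j + p ^ Suc j" "(p \<noteq> q) = (q \<noteq> p)"
      using False by auto
    have "p \<le> q" using False by simp
    from order_trans[OF 1[unfolded e1] absorption_ordered[OF p(1) this q(2) s M j, of d]]
    show ?thesis unfolding e2 .
  qed
qed

end

text \<open>
  Strict convexity of \<open>\<Phi>\<close> on the positive half-line and evenness give strict monotonicity on the line; at \<open>0\<close>
  continuity comes from the growth bound, as \<open>\<Phi>''\<close> need not exist there.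
\<close>

lemma potential_growth_nonlinearity:
  assumes \<Phi>: "admissible_potential \<Phi>" and \<beta>: "2 \<le> \<beta>" and C: "0 < C"
    and growth: "\<And>t. 0 < t \<Longrightarrow> deriv \<Phi> t \<le> C * t powr (\<beta> - 1)"
  shows "growth_nonlinearity (deriv \<Phi>) \<beta> C"
proof -
  let ?g = "deriv \<Phi>"
  have even: "\<Phi> (- t) = \<Phi> t" and d0: "(\<Phi> has_real_derivative 0) (at 0)" for t
    using \<Phi> by (auto simp: admissible_potential_def)
  have dif: "\<Phi> differentiable (at t)" "?g differentiable (at t)" "0 < ?g t" "0 < deriv ?g t" if "0 < t" for t
    using \<Phi> that by (auto simp: admissible_potential_def)
  have g0: "?g 0 = 0" by (rule DERIV_imp_deriv[OF d0])
  have odd_pos: "?g (- t) = - ?g t" if "0 < t" for t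
  proof (rule DERIV_imp_deriv)
    have "(\<Phi> has_real_derivative ?g t) (at t)"
      using dif(1)[OF that] by (simp add: DERIV_deriv_iff_real_differentiable)
    then have "((\<lambda>x. \<Phi> (- x)) has_real_derivative ?g t) (at t)" by (simp add: even)
    then show "(\<Phi> has_real_derivative - ?g t) (at (- t))" by (subst DERIV_mirror) simp
  qed
  have odd: "?g (- t) = - ?g t" for t
  proof -
    consider "0 < t" | "t = 0" | "0 < - t" by linarith
    then show ?thesis
    proof cases
      case 1
      then show ?thesis by (rule odd_pos)
    next
      case 2
      then show ?thesis by (simp add: g0)
    next
      case 3
      from odd_pos[OF this] show ?thesis by simp
    qed
  qed
  have mono_pos: "?g s < ?g t" if "0 < s" "s < t" for s t
  proof (rule DERIV_pos_imp_increasing[OF that(2)])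
    fix x assume "s \<le> x" "x \<le> t"
    then have "0 < x" using that by simp
    then show "\<exists>y. (?g has_real_derivative y) (at x) \<and> 0 < y"
      using dif(2,4)[of x] by (auto simp flip: DERIV_deriv_iff_real_differentiable)
  qed
  have mono: "?g s < ?g t" if "s < t" for s t
  proof -
    have pos: "0 < ?g t" if "0 < t" for t using dif(3)[OF that] .
    have neg: "?g t < 0" if "t < 0" for t using pos[of "- t"] odd[of t] that by simp
    consider "0 < s" | "s = 0" | "s < 0" "0 < t" | "s < 0" "t = 0" | "s < 0" "t < 0" by linarith
    then show ?thesis
    proof cases
      case 1
      then show ?thesis using mono_pos that by blast
    next
      case 2
      then show ?thesis using pos[of t] that g0 by simp
    next
      case 3
      then show ?thesis using neg[of s] pos[of t] by simp
    next
      case 4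
      then show ?thesis using neg[of s] g0 by simp
    next
      case 5
      then show ?thesis using mono_pos[of "- t" "- s"] that odd[of s] odd[of t] by simp
    qed
  qed
  have cont_pos: "isCont ?g t" if "0 < t" for t
    using differentiable_imp_continuous_within[OF dif(2)[OF that]] by simp
  have cont_neg: "isCont ?g t" if "t < 0" for t
  proof -
    have "isCont (\<lambda>x. ?g (- x)) t"
      by (rule isCont_o2[where f = uminus]) (use cont_pos[of "- t"] that in auto)
    then have "isCont (\<lambda>x. - ?g (- x)) t" by (rule continuous_minus)
    then show ?thesis by (simp add: odd)
  qed
  have cont_0: "isCont ?g 0"
    unfolding isCont_def g0
  proof (rule Lim_null_comparison)
    show "\<forall>\<^sub>F t in at 0. norm (?g t) \<le> C * \<bar>t\<bar> powr (\<beta> - 1)"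
    proof (intro always_eventually allI)
      fix t
      show "norm (?g t) \<le> C * \<bar>t\<bar> powr (\<beta> - 1)"
      proof (cases "t = 0")
        case False
        then have "?g \<bar>t\<bar> \<le> C * \<bar>t\<bar> powr (\<beta> - 1)" by (intro growth) simp
        moreover have "0 < ?g \<bar>t\<bar>" using False by (intro dif(3)) simp
        moreover have "norm (?g t) = \<bar>?g \<bar>t\<bar>\<bar>" using odd[of t] by (auto simp: abs_if)
        ultimately show ?thesis by simp
      qed (simp add: g0)
    qed
    have "((\<lambda>t. C * \<bar>t\<bar> powr (\<beta> - 1)) \<longlongrightarrow> C * \<bar>0\<bar> powr (\<beta> - 1)) (at (0::real))"
    proof (intro tendsto_mult tendsto_const)
      show "((\<lambda>t. \<bar>t\<bar> powr (\<beta> - 1)) \<longlongrightarrow> \<bar>0\<bar> powr (\<beta> - 1)) (at (0::real))"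
        using \<beta> by (intro tendsto_powr' tendsto_rabs tendsto_ident_at tendsto_const) auto
    qed
    then show "((\<lambda>t. C * \<bar>t\<bar> powr (\<beta> - 1)) \<longlongrightarrow> 0) (at (0::real))" by simp
  qed
  show ?thesis
  proof
    show "strict_mono ?g" using mono by (auto simp: strict_mono_def)
    have "isCont ?g t" for t using cont_pos[of t] cont_neg[of t] cont_0 by (cases "0 < t"; cases "t = 0") auto
    then show "continuous_on UNIV ?g" by (simp add: continuous_on_eq_continuous_at)
    show "?g (- t) = - ?g t" for t by (rule odd)
    show "?g t \<le> C * t powr (\<beta> - 1)" if "0 \<le> t" for t
      using growth[of t] that g0 by (cases "t = 0") auto
  qed (use \<beta> C in auto)
qed

section \<open>The truncated operator\<close>

text \<open>
  The kernel is comparable to the fractional one near the origin, and its moment of order \<open>\<beta>\<close> is finite;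
  both kernel classes of the theorem reduce to this. The power bounds hold at every point of the punctured ball and \<open>K\<close> is Borel,
  which is achieved by changing the given kernel on a null set.
\<close>

locale nonlocal_operator = growth_nonlinearity g \<beta> C for g \<beta> C +
  fixes K :: "'a::euclidean_space \<Rightarrow> real" and \<alpha> lam Lam \<rho> :: real
  assumes K_borel [measurable]: "K \<in> borel_measurable borel"
    and K_nonneg: "0 \<le> K z" and K_even: "K (- z) = K z"
    and alpha_pos: "0 < \<alpha>" and alpha_less: "\<alpha> < \<beta>"
    and lam_pos: "0 < lam" and rho_pos: "0 < \<rho>"
    and K_lower: "z \<noteq> 0 \<Longrightarrow> norm z \<le> \<rho> \<Longrightarrow> lam * norm z powr (- \<alpha> - DIM('a)) \<le> K z"
    and K_upper: "z \<noteq> 0 \<Longrightarrow> norm z \<le> \<rho> \<Longrightarrow> K z \<le> Lam * norm z powr (- \<alpha> - DIM('a))"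
    and K_moment: "integrable lborel (\<lambda>z. norm z powr \<beta> * K z)"
begin

lemma lam_le_Lam: "lam \<le> Lam"
proof -
  obtain z :: 'a where z: "norm z = \<rho>" using vector_choose_size[of \<rho>] rho_pos by auto
  then have "z \<noteq> 0" using rho_pos by auto
  then have "lam * \<rho> powr (- \<alpha> - DIM('a)) \<le> Lam * \<rho> powr (- \<alpha> - DIM('a))"
    using K_lower[of z] K_upper[of z] z by simp
  then show ?thesis using rho_pos by simp
qed

lemma Lam_pos: "0 < Lam"
  using lam_pos lam_le_Lam by simp

definition Kt :: "real \<Rightarrow> 'a \<Rightarrow> real" where
  "Kt \<epsilon> z = indicator {z. \<epsilon> \<le> norm z} z * K z"

lemma Kt_borel [measurable]: "Kt \<epsilon> \<in> borel_measurable borel"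
  unfolding Kt_def[abs_def] by measurable

lemma Kt_nonneg: "0 \<le> Kt \<epsilon> z"
  by (simp add: Kt_def K_nonneg)

lemma Kt_even: "Kt \<epsilon> (- z) = Kt \<epsilon> z"
  by (simp add: Kt_def K_even indicator_def)

lemma Kt_integrable:
  assumes "0 < \<epsilon>"
  shows "integrable lborel (Kt \<epsilon>)"
proof (rule Bochner_Integration.integrable_bound)
  show "integrable lborel (\<lambda>z. \<epsilon> powr (- \<beta>) * (norm z powr \<beta> * K z))" using K_moment by simp
  show "AE z in lborel. norm (Kt \<epsilon> z) \<le> norm (\<epsilon> powr (- \<beta>) * (norm z powr \<beta> * K z))"
  proof (rule AE_I2)
    fix z :: 'a
    have "1 * K z \<le> (\<epsilon> powr (- \<beta>) * norm z powr \<beta>) * K z" if "\<epsilon> \<le> norm z"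
    proof (rule mult_right_mono)
      have "\<epsilon> powr \<beta> \<le> norm z powr \<beta>" using that assms beta_ge_2 by (intro powr_mono2) auto
      then show "1 \<le> \<epsilon> powr (- \<beta>) * norm z powr \<beta>" using assms by (simp add: powr_minus field_simps)
    qed (rule K_nonneg)
    then show "norm (Kt \<epsilon> z) \<le> norm (\<epsilon> powr (- \<beta>) * (norm z powr \<beta> * K z))"
      using K_nonneg[of z] by (auto simp: Kt_def indicator_def mult.assoc)
  qed
qed measurable

lemma bounded_times_Kt_integrable:
  assumes [measurable]: "b \<in> borel_measurable borel" and "\<And>z. \<bar>b z\<bar> \<le> B" and "0 < \<epsilon>"
  shows "integrable lborel (\<lambda>z. b z * Kt \<epsilon> z)"
proof (rule Bochner_Integration.integrable_bound)
  show "integrable lborel (\<lambda>z. B * Kt \<epsilon> z)" using Kt_integrable[OF assms(3)] by simp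
  show "AE z in lborel. norm (b z * Kt \<epsilon> z) \<le> norm (B * Kt \<epsilon> z)"
  proof (rule AE_I2)
    fix z :: 'a
    have "0 \<le> B" using assms(2)[of z] by simp
    then show "norm (b z * Kt \<epsilon> z) \<le> norm (B * Kt \<epsilon> z)"
      using assms(2)[of z] Kt_nonneg[of \<epsilon> z] by (simp add: abs_mult mult_right_mono)
  qed
qed measurable

text \<open>
  The mass of \<open>K\<close> outside small balls therefore blows up, which is the source of all rigidity in the continuity
  argument.
\<close>

lemma shell_mass_lower:
  obtains c where "0 < c" and
    "\<And>\<epsilon>. 0 < \<epsilon> \<Longrightarrow> 2 * \<epsilon> \<le> \<rho> \<Longrightarrow>
       c * \<epsilon> powr (- \<alpha>) \<le> (LINT z|lborel. indicator (shell \<epsilon>) z * Kt \<epsilon> z)"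
proof
  let ?n = "DIM('a)"
  let ?c = "lam * 2 powr (- \<alpha> - ?n) * (unit_ball_vol ?n * (2 ^ ?n - 1))"
  have "(1::real) < 2 ^ ?n" by (simp add: one_less_power)
  then show "0 < ?c" using lam_pos by simp
  fix \<epsilon> :: real assume e: "0 < \<epsilon>" "2 * \<epsilon> \<le> \<rho>"
  let ?S = "ball 0 (2 * \<epsilon>) - ball 0 \<epsilon> :: 'a set"
  have S: "(shell \<epsilon>) = ?S" by auto
  have "measure lborel ?S = measure lborel (ball 0 (2 * \<epsilon>) :: 'a set) - measure lborel (ball 0 \<epsilon> :: 'a set)"
    by (intro measure_Diff) (use e in \<open>auto simp: emeasure_ball\<close>)
  then have vol: "measure lborel ?S = unit_ball_vol ?n * (2 ^ ?n - 1) * \<epsilon> ^ ?n"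
    using e by (simp add: content_ball power_mult_distrib algebra_simps)
  have finS: "emeasure lborel ?S < \<infinity>"
  proof (rule le_less_trans)
    show "emeasure lborel ?S \<le> emeasure lborel (ball 0 (2 * \<epsilon>) :: 'a set)" by (intro emeasure_mono) auto
  qed (use e in \<open>simp add: emeasure_ball\<close>)
  have "?c * \<epsilon> powr (- \<alpha>) = lam * (2 * \<epsilon>) powr (- \<alpha> - ?n) * measure lborel ?S"
  proof -
    have "\<epsilon> powr (- \<alpha> - ?n) * \<epsilon> ^ ?n = \<epsilon> powr (- \<alpha>)" using e by (simp flip: powr_realpow powr_add)
    then show ?thesis unfolding vol using e by (simp add: powr_mult mult_ac)
  qed
  also have "\<dots> = (LINT z|lborel. lam * (2 * \<epsilon>) powr (- \<alpha> - ?n) * indicator ?S z)"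
    using finS by simp
  also have "\<dots> \<le> (LINT z|lborel. indicator (shell \<epsilon>) z * Kt \<epsilon> z)"
    unfolding S
  proof (rule integral_mono)
    show "integrable lborel (\<lambda>z. lam * (2 * \<epsilon>) powr (- \<alpha> - ?n) * indicator ?S z)" using finS by simp
    show "integrable lborel (\<lambda>z. indicator ?S z * Kt \<epsilon> z)"
      using e by (intro bounded_times_Kt_integrable[of _ 1]) (auto simp: indicator_def)
    fix z :: 'a
    have "lam * (2 * \<epsilon>) powr (- \<alpha> - ?n) \<le> K z" if "\<epsilon> \<le> norm z" "norm z < 2 * \<epsilon>"
    proof -
      have "lam * (2 * \<epsilon>) powr (- \<alpha> - ?n) \<le> lam * norm z powr (- \<alpha> - ?n)"
        using that e lam_pos alpha_pos by (intro mult_left_mono powr_mono2') auto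
      also have "\<dots> \<le> K z" using that e by (intro K_lower) auto
      finally show ?thesis .
    qed
    then show "lam * (2 * \<epsilon>) powr (- \<alpha> - ?n) * indicator ?S z \<le> indicator ?S z * Kt \<epsilon> z"
      by (auto simp: indicator_def Kt_def)
  qed
  finally show "?c * \<epsilon> powr (- \<alpha>) \<le> (LINT z|lborel. indicator (shell \<epsilon>) z * Kt \<epsilon> z)" .
qed

lemma mass_unbounded:
  obtains e where "0 < e" "\<And>\<epsilon>. 0 < \<epsilon> \<Longrightarrow> \<epsilon> < e \<Longrightarrow> B < (LINT z|lborel. Kt \<epsilon> z)"
proof -
  obtain c where c: "0 < c" "\<And>\<epsilon>. 0 < \<epsilon> \<Longrightarrow> 2 * \<epsilon> \<le> \<rho> \<Longrightarrow>
       c * \<epsilon> powr (- \<alpha>) \<le> (LINT z|lborel. indicator (shell \<epsilon>) z * Kt \<epsilon> z)"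
    using shell_mass_lower by blast
  obtain r0 where r0: "0 < r0" "\<And>d. 0 < d \<Longrightarrow> d < r0 \<Longrightarrow> B / c < d powr (- \<alpha>)"
    using negative_power_unbounded[OF alpha_pos] by blast
  show thesis
  proof (rule that)
    show "0 < min r0 (\<rho> / 2)" using r0 rho_pos by simp
    fix \<epsilon> :: real assume e: "0 < \<epsilon>" "\<epsilon> < min r0 (\<rho> / 2)"
    then have "B < c * \<epsilon> powr (- \<alpha>)" using r0(2)[of \<epsilon>] c(1) by (simp add: field_simps)
    also have "\<dots> \<le> (LINT z|lborel. indicator (shell \<epsilon>) z * Kt \<epsilon> z)"
      using e by (intro c) auto
    also have "\<dots> \<le> (LINT z|lborel. Kt \<epsilon> z)"
      using e by (intro integral_mono Kt_integrable bounded_times_Kt_integrable[of _ 1])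
         (auto simp: indicator_def Kt_nonneg)
    finally show "B < (LINT z|lborel. Kt \<epsilon> z)" .
  qed
qed

lemma near_mass_upper:
  obtains c where "0 < c" and
    "\<And>\<epsilon>. 0 < \<epsilon> \<Longrightarrow> (LINT z|lborel. indicator {z. norm z < \<rho>} z * Kt \<epsilon> z) \<le> c * \<epsilon> powr (- \<alpha>)"
proof -
  obtain c where c: "0 < c" "\<And>r. 0 < r \<Longrightarrow>
       (\<integral>\<^sup>+z. ennreal (norm z powr (- \<alpha> - DIM('a))) * indicator {z. r \<le> norm z} z
           \<partial>(lborel :: 'a measure)) \<le> ennreal (c * r powr (- \<alpha>))"
    using nn_integral_power_outside_ball[where 'a='a, OF alpha_pos] by blast
  show thesis
  proof (rule that)
    show "0 < Lam * c" using c Lam_pos by simp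
    fix \<epsilon> :: real assume e: "0 < \<epsilon>"
    have "ennreal (LINT z|lborel. indicator {z. norm z < \<rho>} z * Kt \<epsilon> z)
        = (\<integral>\<^sup>+z. ennreal (indicator {z. norm z < \<rho>} z * Kt \<epsilon> z) \<partial>lborel)"
      using e by (intro nn_integral_eq_integral[symmetric] bounded_times_Kt_integrable[of _ 1])
         (auto simp: indicator_def Kt_nonneg)
    also have "\<dots> \<le> (\<integral>\<^sup>+z. ennreal Lam * (ennreal (norm z powr (- \<alpha> - DIM('a))) * indicator {z. \<epsilon> \<le> norm z} z) \<partial>(lborel :: 'a measure))"
      using e Lam_pos by (intro nn_integral_mono)
        (auto simp: indicator_def Kt_def intro!: K_upper ennreal_leI simp flip: ennreal_mult)
    also have "\<dots> = ennreal Lam * (\<integral>\<^sup>+z. ennreal (norm z powr (- \<alpha> - DIM('a))) * indicator {z. \<epsilon> \<le> norm z} z \<partial>(lborel :: 'a measure))"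
      by (rule nn_integral_cmult) measurable
    also have "\<dots> \<le> ennreal Lam * ennreal (c * \<epsilon> powr (- \<alpha>))"
      by (intro mult_left_mono c e) auto
    also have "\<dots> = ennreal (Lam * c * \<epsilon> powr (- \<alpha>))"
      using Lam_pos c(1) by (simp flip: ennreal_mult add: mult.assoc)
    finally show "(LINT z|lborel. indicator {z. norm z < \<rho>} z * Kt \<epsilon> z) \<le> Lam * c * \<epsilon> powr (- \<alpha>)"
      using Lam_pos c(1) by (simp add: ennreal_le_iff)
  qed
qed

text \<open>
  Transfers mass estimates around one centre to estimates around another centre at comparable distance, where \<open>K\<close>
  itself has no continuity.
\<close>

lemma K_compare:
  assumes "0 < d" "6 * d \<le> \<rho>" and z: "0 < norm z" "norm z \<le> 6 * d" and w: "2 * d \<le> norm w" "norm w \<le> 4 * d"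
  shows "lam / Lam * 3 powr (- \<alpha> - DIM('a)) * K w \<le> K z"
proof -
  let ?p = "- \<alpha> - DIM('a)"
  have "K w \<le> Lam * norm w powr ?p" using assms by (intro K_upper) auto
  also have "\<dots> \<le> Lam * (2 * d) powr ?p"
    using \<open>0 < d\<close> w(1) Lam_pos alpha_pos by (intro mult_left_mono powr_mono2') simp_all
  finally have "lam / Lam * 3 powr ?p * K w \<le> lam / Lam * 3 powr ?p * (Lam * (2 * d) powr ?p)"
    using lam_pos Lam_pos by (intro mult_left_mono) auto
  also have "\<dots> = lam * (3 powr ?p * (2 * d) powr ?p)" using Lam_pos by simp
  also have "3 powr ?p * (2 * d) powr ?p = (6 * d) powr ?p"
    using assms(1) powr_mult[of 3 "2 * d" ?p] by simp
  also have "lam * (6 * d) powr ?p \<le> lam * norm z powr ?p"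
    using z lam_pos alpha_pos by (intro mult_left_mono powr_mono2') simp_all
  also have "\<dots> \<le> K z" using assms by (intro K_lower) auto
  finally show ?thesis .
qed

lemma integral_symmetrize:
  assumes h [measurable]: "h \<in> borel_measurable borel" and "\<And>z. \<bar>h z\<bar> \<le> B" "0 < \<epsilon>"
  shows "2 * (LINT z|lborel. h z * Kt \<epsilon> z) = (LINT z|lborel. (h z + h (- z)) * Kt \<epsilon> z)"
proof -
  have i: "integrable lborel (\<lambda>z. h z * Kt \<epsilon> z)" "integrable lborel (\<lambda>z. h (- z) * Kt \<epsilon> z)"
    by (intro bounded_times_Kt_integrable[of _ B] assms; measurable)+
  have "(LINT z|lborel. h z * Kt \<epsilon> z) = (LINT z|lborel. h (- z) * Kt \<epsilon> z)"
    using integral_lborel_reflect[of "\<lambda>z. h z * Kt \<epsilon> z"] by (simp add: Kt_even)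
  then show ?thesis using i by (simp add: distrib_right)
qed

lemma parabola_truncated_integrable:
  assumes b: "0 \<le> b" and r: "0 \<le> r" and e: "0 < \<epsilon>"
  shows "integrable lborel (\<lambda>z. (g (a \<bullet> z + b * (norm z)\<^sup>2) * indicator (ball 0 r) z) * Kt \<epsilon> z)"
    and "\<bar>g (a \<bullet> z + b * (norm z)\<^sup>2) * indicator (ball 0 r) z\<bar> \<le> g (norm a * r + b * r\<^sup>2)"
proof -
  have [measurable]: "ball (0::'a) r \<in> sets borel" by simp
  have bound: "\<bar>g (a \<bullet> z + b * (norm z)\<^sup>2) * indicator (ball 0 r) z\<bar> \<le> g (norm a * r + b * r\<^sup>2)" for z
  proof (cases "norm z < r")
    case True
    have "\<bar>a \<bullet> z\<bar> \<le> norm a * norm z" by (rule Cauchy_Schwarz_ineq2)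
    also have "\<dots> \<le> norm a * r" using True by (intro mult_left_mono) auto
    finally have 1: "\<bar>a \<bullet> z\<bar> \<le> norm a * r" .
    have "b * (norm z)\<^sup>2 \<le> b * r\<^sup>2" using b True by (intro mult_left_mono power_mono) auto
    moreover have "0 \<le> b * (norm z)\<^sup>2" using b by simp
    ultimately have "\<bar>a \<bullet> z + b * (norm z)\<^sup>2\<bar> \<le> norm a * r + b * r\<^sup>2" using 1 by linarith
    then show ?thesis using True g_mono by (simp add: g_abs)
  next
    case False
    then show ?thesis using b r by (simp add: g_nonneg)
  qed
  then show "\<bar>g (a \<bullet> z + b * (norm z)\<^sup>2) * indicator (ball 0 r) z\<bar> \<le> g (norm a * r + b * r\<^sup>2)" .
  show "integrable lborel (\<lambda>z. (g (a \<bullet> z + b * (norm z)\<^sup>2) * indicator (ball 0 r) z) * Kt \<epsilon> z)"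
  proof (rule bounded_times_Kt_integrable[OF _ bound e])
    show "(\<lambda>z. g (a \<bullet> z + b * (norm z)\<^sup>2) * indicator (ball 0 r) z) \<in> borel_measurable borel" by measurable
  qed
qed

text \<open>
  Since \<open>K\<close> is even, \<open>g(a \<bullet> z + b \<bar>z\<bar>\<^sup>2)\<close> may be replaced by its even part, which is half of the nonnegative gap of
  \<open>parabola_gap\<close>; only the upper bound on \<open>K\<close> is then needed. The bound is uniform in the truncation.
\<close>

lemma parabola_truncated_upper:
  obtains c where "0 < c" and
    "\<And>a b Q r \<epsilon>. 0 \<le> b \<Longrightarrow> norm a \<le> Q \<Longrightarrow> b * r \<le> Q \<Longrightarrow> 0 < r \<Longrightarrow> r \<le> \<rho> \<Longrightarrow> 0 < \<epsilon> \<Longrightarrow>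
       (LINT z|lborel. (g (a \<bullet> z + b * (norm z)\<^sup>2) * indicator (ball 0 r) z) * Kt \<epsilon> z)
         \<le> c * (b * Q powr (\<beta> - 2) * r powr (\<beta> - \<alpha>))"
proof -
  let ?n = "DIM('a)"
  obtain c where c: "0 < c" "\<And>(a::'a) b Q r. 0 \<le> b \<Longrightarrow> norm a \<le> Q \<Longrightarrow> b * r \<le> Q \<Longrightarrow> 0 < r \<Longrightarrow>
       (\<integral>\<^sup>+z. ennreal ((g (a \<bullet> z + b * (norm z)\<^sup>2) - g (a \<bullet> z - b * (norm z)\<^sup>2)) * norm z powr (- \<alpha> - DIM('a)))
            * indicator (ball 0 r) z \<partial>lborel) \<le> ennreal (c * (b * Q powr (\<beta> - 2) * r powr (\<beta> - \<alpha>)))"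
    using parabola_gap[where 'a='a, OF alpha_pos alpha_less] by blast
  show thesis
  proof (rule that)
    show "0 < Lam * c" using c Lam_pos by simp
    fix a :: 'a and b Q r \<epsilon> :: real
    assume b: "0 \<le> b" and aQ: "norm a \<le> Q" and bQ: "b * r \<le> Q" and r: "0 < r" "r \<le> \<rho>" and e: "0 < \<epsilon>"
    have [measurable]: "ball (0::'a) r \<in> sets borel" by simp
    let ?D = "\<lambda>z. g (a \<bullet> z + b * (norm z)\<^sup>2) - g (a \<bullet> z - b * (norm z)\<^sup>2)"
    let ?h = "\<lambda>z. g (a \<bullet> z + b * (norm z)\<^sup>2) * indicator (ball 0 r) z"
    define X where "X = b * Q powr (\<beta> - 2) * r powr (\<beta> - \<alpha>)"
    have X: "0 \<le> X" using b by (simp add: X_def)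
    have D0: "0 \<le> ?D z" for z
      using g_mono[of "a \<bullet> z - b * (norm z)\<^sup>2" "a \<bullet> z + b * (norm z)\<^sup>2"] b by (simp add: mult_nonneg_nonneg)
    note par = parabola_truncated_integrable[OF b less_imp_le[OF r(1)] e]
    have bd: "\<bar>?h z\<bar> \<le> g (norm a * r + b * r\<^sup>2)" for z by (rule par(2))
    have hm: "?h \<in> borel_measurable borel" by measurable
    have sym: "?h z + ?h (- z) = ?D z * indicator (ball 0 r) z" for z
      using g_odd[of "a \<bullet> z - b * (norm z)\<^sup>2"] by (auto simp: indicator_def algebra_simps)
    have i: "integrable lborel (\<lambda>z. (?D z * indicator (ball 0 r) z) * Kt \<epsilon> z)"
      unfolding sym[symmetric]
    proof (rule bounded_times_Kt_integrable[OF _ _ e])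
      show "(\<lambda>z. ?h z + ?h (- z)) \<in> borel_measurable borel" by measurable
      show "\<bar>?h z + ?h (- z)\<bar> \<le> g (norm a * r + b * r\<^sup>2) + g (norm a * r + b * r\<^sup>2)" for z
        by (rule order_trans[OF abs_triangle_ineq add_mono[OF bd bd]])
    qed
    have "ennreal (LINT z|lborel. (?D z * indicator (ball 0 r) z) * Kt \<epsilon> z)
       = (\<integral>\<^sup>+z. ennreal ((?D z * indicator (ball 0 r) z) * Kt \<epsilon> z) \<partial>lborel)"
      using D0 by (intro nn_integral_eq_integral[symmetric] i) (auto simp: Kt_nonneg)
    also have "\<dots> \<le> (\<integral>\<^sup>+z. ennreal Lam * (ennreal (?D z * norm z powr (- \<alpha> - ?n)) * indicator (ball 0 r) z) \<partial>lborel)"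
    proof (rule nn_integral_mono)
      fix z :: 'a
      have "?D z * Kt \<epsilon> z \<le> ?D z * (Lam * norm z powr (- \<alpha> - ?n))" if "norm z < r"
        using that r e Lam_pos by (intro mult_left_mono D0) (auto simp: Kt_def indicator_def intro!: K_upper)
      then show "ennreal ((?D z * indicator (ball 0 r) z) * Kt \<epsilon> z)
          \<le> ennreal Lam * (ennreal (?D z * norm z powr (- \<alpha> - ?n)) * indicator (ball 0 r) z)"
        using Lam_pos D0[of z] by (auto simp: indicator_def mult_ac ennreal_leI simp flip: ennreal_mult)
    qed
    also have "\<dots> = ennreal Lam * (\<integral>\<^sup>+z. ennreal (?D z * norm z powr (- \<alpha> - ?n)) * indicator (ball 0 r) z \<partial>lborel)"
      by (rule nn_integral_cmult) measurable
    also have "\<dots> \<le> ennreal Lam * ennreal (c * X)"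
      unfolding X_def by (intro mult_left_mono c b aQ bQ r) auto
    also have "\<dots> = ennreal (Lam * c * X)"
      using Lam_pos c(1) X by (simp flip: ennreal_mult add: mult.assoc)
    finally have "(LINT z|lborel. (?D z * indicator (ball 0 r) z) * Kt \<epsilon> z) \<le> Lam * c * X"
      using Lam_pos c(1) X by (simp add: ennreal_le_iff)
    moreover have "2 * (LINT z|lborel. ?h z * Kt \<epsilon> z) = (LINT z|lborel. (?D z * indicator (ball 0 r) z) * Kt \<epsilon> z)"
      using integral_symmetrize[OF hm bd e] unfolding sym .
    moreover have "0 \<le> Lam * c * X" using Lam_pos c(1) X by simp
    ultimately show "(LINT z|lborel. ?h z * Kt \<epsilon> z) \<le> Lam * c * (b * Q powr (\<beta> - 2) * r powr (\<beta> - \<alpha>))"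
      unfolding X_def[symmetric] by linarith
  qed
qed

text \<open>
  The value \<open>s\<close> at the centre and the function \<open>h\<close> under the integral are kept apart: for a measurable function
  that is only known pointwise, \<open>h\<close> is a Borel version, while \<open>s\<close> must be the true value.
\<close>

definition trunc :: "real \<Rightarrow> real \<Rightarrow> ('a \<Rightarrow> real) \<Rightarrow> 'a \<Rightarrow> real" where
  "trunc \<epsilon> s h x = (LINT z|lborel. g (s - h (x + z)) * Kt \<epsilon> z)"

lemma trunc_integrable:
  assumes [measurable]: "h \<in> borel_measurable borel" and "\<And>y. \<bar>h y\<bar> \<le> M" "0 < \<epsilon>"
  shows "integrable lborel (\<lambda>z. g (s - h (x + z)) * Kt \<epsilon> z)"
proof (rule bounded_times_Kt_integrable[of _ "g (2 * max \<bar>s\<bar> M)"])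
  show "\<bar>g (s - h (x + z))\<bar> \<le> g (2 * max \<bar>s\<bar> M)" for z
    using assms(2)[of "x + z"] by (intro g_diff_bound) auto
qed (use assms(3) in auto)

lemma trunc_mono:
  assumes h: "h \<in> borel_measurable borel" "\<And>y. \<bar>h y\<bar> \<le> M" "0 < \<epsilon>" and "s \<le> t"
  shows "trunc \<epsilon> s h x \<le> trunc \<epsilon> t h x"
  unfolding trunc_def
  using assms by (intro integral_mono trunc_integrable[OF h] mult_right_mono g_mono) (auto simp: Kt_nonneg)

lemma trunc_uminus: "trunc \<epsilon> (- s) (\<lambda>y. - h y) x = - trunc \<epsilon> s h x"
proof -
  have "g (- s - - h (x + z)) * Kt \<epsilon> z = - (g (s - h (x + z)) * Kt \<epsilon> z)" for z
    using g_odd[of "s - h (x + z)"] by simp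
  then show ?thesis by (simp add: trunc_def)
qed

text \<open>
  Moving the translation to the kernel reduces this to continuity of translation in \<open>L\<^sup>1\<close>; neither \<open>h\<close> nor
  the kernel is continuous.
\<close>

lemma trunc_tendsto:
  assumes h [measurable]: "h \<in> borel_measurable borel" and M: "\<And>y. \<bar>h y\<bar> \<le> M" and e: "0 < \<epsilon>"
    and x: "X \<longlonglongrightarrow> x"
  shows "(\<lambda>j. trunc \<epsilon> s h (X j)) \<longlonglongrightarrow> trunc \<epsilon> s h x"
proof -
  define B where "B = g (2 * max \<bar>s\<bar> M)"
  have bd: "\<bar>g (s - h y)\<bar> \<le> B" for y
    unfolding B_def using M[of y] by (intro g_diff_bound) auto
  have B0: "0 \<le> B" using bd[of 0] by linarith
  have shift: "trunc \<epsilon> s h v = (LINT y|lborel. g (s - h y) * Kt \<epsilon> (- v + y))" for v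
    unfolding trunc_def using integral_lborel_translate[of "\<lambda>y. g (s - h y) * Kt \<epsilon> (- v + y)" v]
    by simp
  note Ki = Kt_integrable[OF e]
  have int: "integrable lborel (\<lambda>y. g (s - h y) * Kt \<epsilon> (- v + y))" for v
    by (rule Bochner_Integration.integrable_bound[OF integrable_mult_right[OF integrable_lborel_translate[OF Ki, of "- v"], of B]])
       (use bd B0 in \<open>auto simp: abs_mult Kt_nonneg intro!: mult_right_mono\<close>)
  have "(\<lambda>j. x - X j) \<longlonglongrightarrow> x - x" by (intro tendsto_intros x)
  then have "(\<lambda>j. LINT y|lborel. \<bar>Kt \<epsilon> ((x - X j) + y) - Kt \<epsilon> y\<bar>) \<longlonglongrightarrow> 0"
    by (intro L1_translation_continuous Ki) simp
  then have lim: "(\<lambda>j. B * (LINT y|lborel. \<bar>Kt \<epsilon> ((x - X j) + y) - Kt \<epsilon> y\<bar>)) \<longlonglongrightarrow> 0"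
    by (rule tendsto_mult_right_zero)
  have "norm (trunc \<epsilon> s h (X j) - trunc \<epsilon> s h x) \<le> B * (LINT y|lborel. \<bar>Kt \<epsilon> ((x - X j) + y) - Kt \<epsilon> y\<bar>)" for j
  proof -
    let ?d = "\<lambda>y. \<bar>Kt \<epsilon> (- X j + y) - Kt \<epsilon> (- x + y)\<bar>"
    have di: "integrable lborel ?d"
      using integrable_lborel_translate[OF Ki, of "- X j"] integrable_lborel_translate[OF Ki, of "- x"] by simp
    have "trunc \<epsilon> s h (X j) - trunc \<epsilon> s h x = (LINT y|lborel. g (s - h y) * (Kt \<epsilon> (- X j + y) - Kt \<epsilon> (- x + y)))"
      unfolding shift right_diff_distrib using int by simp
    also have "norm \<dots> \<le> (LINT y|lborel. B * ?d y)"
    proof (rule order_trans[OF integral_norm_bound], rule integral_mono)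
      show "integrable lborel (\<lambda>y. norm (g (s - h y) * (Kt \<epsilon> (- X j + y) - Kt \<epsilon> (- x + y))))"
        unfolding right_diff_distrib using int[of "X j"] int[of x] by simp
      show "integrable lborel (\<lambda>y. B * ?d y)" using di by simp
    qed (auto simp: abs_mult intro!: mult_right_mono bd)
    also have "\<dots> = B * (LINT y|lborel. ?d y)" by simp
    also have "(LINT y|lborel. ?d y) = (LINT y|lborel. ?d (x + y))"
      by (rule integral_lborel_translate[symmetric]) measurable
    also have "\<dots> = (LINT y|lborel. \<bar>Kt \<epsilon> ((x - X j) + y) - Kt \<epsilon> y\<bar>)"
      by (intro Bochner_Integration.integral_cong) (simp_all add: algebra_simps)
    finally show ?thesis .
  qed
  then have "\<forall>\<^sub>F j in sequentially. norm (trunc \<epsilon> s h (X j) - trunc \<epsilon> s h x)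
      \<le> B * (LINT y|lborel. \<bar>Kt \<epsilon> ((x - X j) + y) - Kt \<epsilon> y\<bar>)"
    by (intro always_eventually allI)
  then have "(\<lambda>j. trunc \<epsilon> s h (X j) - trunc \<epsilon> s h x) \<longlonglongrightarrow> 0"
    using lim by (rule Lim_null_comparison)
  then show ?thesis by (rule LIM_zero_cancel)
qed

lemma trunc_tendsto_level:
  assumes h [measurable]: "h \<in> borel_measurable borel" and M: "\<And>y. \<bar>h y\<bar> \<le> M" and e: "0 < \<epsilon>"
    and S: "S \<longlonglongrightarrow> s" and B: "\<And>j::nat. \<bar>S j\<bar> \<le> B"
  shows "(\<lambda>j. trunc \<epsilon> (S j) h x) \<longlonglongrightarrow> trunc \<epsilon> s h x"
  unfolding trunc_def
proof (rule integral_dominated_convergence[where w = "\<lambda>z. g (2 * max B M) * Kt \<epsilon> z"])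
  show "integrable lborel (\<lambda>z. g (2 * max B M) * Kt \<epsilon> z)" using Kt_integrable[OF e] by simp
  show "AE z in lborel. (\<lambda>j. g (S j - h (x + z)) * Kt \<epsilon> z) \<longlonglongrightarrow> g (s - h (x + z)) * Kt \<epsilon> z"
  proof (rule AE_I2)
    fix z
    have "(\<lambda>j. S j - h (x + z)) \<longlonglongrightarrow> s - h (x + z)" by (intro tendsto_intros S)
    moreover have "isCont g (s - h (x + z))" using g_cont by (simp add: continuous_on_eq_continuous_at)
    ultimately have "(\<lambda>j. g (S j - h (x + z))) \<longlonglongrightarrow> g (s - h (x + z))" by (rule isCont_tendsto_compose[rotated])
    then show "(\<lambda>j. g (S j - h (x + z)) * Kt \<epsilon> z) \<longlonglongrightarrow> g (s - h (x + z)) * Kt \<epsilon> z"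
      by (intro tendsto_intros)
  qed
  show "AE z in lborel. norm (g (S j - h (x + z)) * Kt \<epsilon> z) \<le> g (2 * max B M) * Kt \<epsilon> z" for j
  proof (rule AE_I2)
    fix z
    have "\<bar>g (S j - h (x + z))\<bar> \<le> g (2 * max B M)"
      using B[of j] M[of "x + z"] by (intro g_diff_bound) auto
    then show "norm (g (S j - h (x + z)) * Kt \<epsilon> z) \<le> g (2 * max B M) * Kt \<epsilon> z"
      by (simp add: abs_mult Kt_nonneg mult_right_mono)
  qed
qed measurable

lemma trunc_gap:
  assumes h [measurable]: "h \<in> borel_measurable borel" and M: "\<And>y. \<bar>h y\<bar> \<le> M" and e: "0 < \<epsilon>"
    and gap: "\<And>t. \<bar>t\<bar> \<le> B \<Longrightarrow> g t + m \<le> g (t + \<kappa>)" and B: "\<bar>s\<bar> + M \<le> B"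
  shows "trunc \<epsilon> s h x + m * (LINT z|lborel. Kt \<epsilon> z) \<le> trunc \<epsilon> (s + \<kappa>) h x"
proof -
  have "trunc \<epsilon> s h x + m * (LINT z|lborel. Kt \<epsilon> z)
      = (LINT z|lborel. g (s - h (x + z)) * Kt \<epsilon> z + m * Kt \<epsilon> z)"
    unfolding trunc_def using trunc_integrable[OF h M e] Kt_integrable[OF e] by simp
  also have "\<dots> \<le> trunc \<epsilon> (s + \<kappa>) h x"
    unfolding trunc_def
  proof (rule integral_mono)
    show "integrable lborel (\<lambda>z. g (s - h (x + z)) * Kt \<epsilon> z + m * Kt \<epsilon> z)"
      using trunc_integrable[OF h M e] Kt_integrable[OF e] by simp
    show "integrable lborel (\<lambda>z. g (s + \<kappa> - h (x + z)) * Kt \<epsilon> z)" by (rule trunc_integrable[OF h M e])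
    fix z
    have "\<bar>s - h (x + z)\<bar> \<le> B" using B M[of "x + z"] by linarith
    from gap[OF this] have "(g (s - h (x + z)) + m) * Kt \<epsilon> z \<le> g (s - h (x + z) + \<kappa>) * Kt \<epsilon> z"
      by (intro mult_right_mono Kt_nonneg)
    then show "g (s - h (x + z)) * Kt \<epsilon> z + m * Kt \<epsilon> z \<le> g (s + \<kappa> - h (x + z)) * Kt \<epsilon> z"
      by (simp add: distrib_right add_diff_eq diff_add_eq)
  qed
  finally show ?thesis .
qed

section \<open>Pointwise solutions are continuous\<close>

text \<open>
  If the central values \<open>S j\<close> stayed above \<open>s + \<kappa>\<close>, then for small \<open>\<epsilon>\<close> the truncated integrals at \<open>X j\<close> would
  exceed those with central value \<open>s\<close> by the exploding mass of the kernel, which contradicts the uniform bound. Hence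
  truncated integrals that are bounded uniformly in \<open>\<epsilon>\<close> pin down the central value in the limit, and the bound is
  inherited by the limit point.
\<close>

lemma trunc_bounded_limit:
  assumes h: "h \<in> borel_measurable borel" "\<And>y. \<bar>h y\<bar> \<le> M"
    and X: "X \<longlonglongrightarrow> x" and S: "\<And>j. \<bar>S j\<bar> \<le> M" and s: "\<bar>s\<bar> \<le> M"
    and e0: "0 < e0" "\<And>j \<epsilon>. 0 < \<epsilon> \<Longrightarrow> \<epsilon> < e0 \<Longrightarrow> \<bar>trunc \<epsilon> (S j) h (X j)\<bar> \<le> N"
    and e1: "0 < e1" "\<And>\<epsilon>. 0 < \<epsilon> \<Longrightarrow> \<epsilon> < e1 \<Longrightarrow> \<bar>trunc \<epsilon> s h x\<bar> \<le> N'"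
  shows "S \<longlonglongrightarrow> s" "\<And>\<epsilon>. 0 < \<epsilon> \<Longrightarrow> \<epsilon> < e0 \<Longrightarrow> \<bar>trunc \<epsilon> s h x\<bar> \<le> N"
proof -
  have M0: "0 \<le> M" using s by linarith
  \<comment> \<open>Monotonicity in the central value avoids passing to convergent subsequences of \<open>S\<close>.\<close>
  have near: "\<forall>\<^sub>F j in sequentially. S j < s + \<kappa> \<and> s - \<kappa> < S j" if k: "0 < \<kappa>" for \<kappa>
  proof -
    obtain m where m: "0 < m" "\<And>t. \<bar>t\<bar> \<le> 2 * M + \<kappa> \<Longrightarrow> g t + m \<le> g (t + \<kappa>)"
      using g_gap[OF k, of "2 * M + \<kappa>"] M0 k by auto
    obtain e where e: "0 < e" "\<And>\<epsilon>. 0 < \<epsilon> \<Longrightarrow> \<epsilon> < e \<Longrightarrow> (N + N') / m < (LINT z|lborel. Kt \<epsilon> z)"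
      using mass_unbounded by blast
    define \<epsilon> where "\<epsilon> = min e0 (min e1 e) / 2"
    have ep: "0 < \<epsilon>" "\<epsilon> < e0" "\<epsilon> < e1" "\<epsilon> < e" using e0 e1 e by (auto simp: \<epsilon>_def)
    have mass: "N + N' < m * (LINT z|lborel. Kt \<epsilon> z)"
      using e(2)[OF ep(1,4)] m(1) by (simp add: field_simps)
    have "trunc \<epsilon> s h x + m * (LINT z|lborel. Kt \<epsilon> z) \<le> trunc \<epsilon> (s + \<kappa>) h x"
      using s k by (intro trunc_gap[OF h ep(1) m(2)]) auto
    then have up: "N < trunc \<epsilon> (s + \<kappa>) h x" using mass e1(2)[OF ep(1,3)] by (simp add: abs_le_iff)
    have "trunc \<epsilon> (s - \<kappa>) h x + m * (LINT z|lborel. Kt \<epsilon> z) \<le> trunc \<epsilon> (s - \<kappa> + \<kappa>) h x"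
      using s k by (intro trunc_gap[OF h ep(1) m(2)]) auto
    then have lo: "trunc \<epsilon> (s - \<kappa>) h x < - N" using mass e1(2)[OF ep(1,3)] by (simp add: abs_le_iff)
    have "\<forall>\<^sub>F j in sequentially. N < trunc \<epsilon> (s + \<kappa>) h (X j)"
      by (rule order_tendstoD(1)[OF trunc_tendsto[OF h ep(1) X] up])
    moreover have "\<forall>\<^sub>F j in sequentially. trunc \<epsilon> (s - \<kappa>) h (X j) < - N"
      by (rule order_tendstoD(2)[OF trunc_tendsto[OF h ep(1) X] lo])
    ultimately show ?thesis
    proof eventually_elim
      case (elim j)
      have b: "\<bar>trunc \<epsilon> (S j) h (X j)\<bar> \<le> N" using e0(2)[OF ep(1,2)] .
      have "S j < s + \<kappa>"
      proof (rule ccontr)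
        assume "\<not> S j < s + \<kappa>"
        then have "trunc \<epsilon> (s + \<kappa>) h (X j) \<le> trunc \<epsilon> (S j) h (X j)" by (intro trunc_mono[OF h ep(1)]) simp
        with elim b show False by simp
      qed
      moreover have "s - \<kappa> < S j"
      proof (rule ccontr)
        assume "\<not> s - \<kappa> < S j"
        then have "trunc \<epsilon> (S j) h (X j) \<le> trunc \<epsilon> (s - \<kappa>) h (X j)" by (intro trunc_mono[OF h ep(1)]) simp
        with elim b show False by simp
      qed
      ultimately show ?case ..
    qed
  qed
  show "S \<longlonglongrightarrow> s"
  proof (rule tendstoI)
    fix \<kappa> :: real assume "0 < \<kappa>"
    from near[OF this] show "\<forall>\<^sub>F j in sequentially. dist (S j) s < \<kappa>"
      by eventually_elim (auto simp: dist_real_def abs_less_iff)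
  qed
  fix \<epsilon> assume ep: "0 < \<epsilon>" "\<epsilon> < e0"
  have ub: "trunc \<epsilon> (s - \<kappa>) h x \<le> N" and lb: "- N \<le> trunc \<epsilon> (s + \<kappa>) h x" if k: "0 < \<kappa>" for \<kappa>
  proof -
    have ev: "\<forall>\<^sub>F j in sequentially. trunc \<epsilon> (s - \<kappa>) h (X j) \<le> N \<and> - N \<le> trunc \<epsilon> (s + \<kappa>) h (X j)"
      using near[OF k]
    proof eventually_elim
      case (elim j)
      have "trunc \<epsilon> (s - \<kappa>) h (X j) \<le> trunc \<epsilon> (S j) h (X j)" "trunc \<epsilon> (S j) h (X j) \<le> trunc \<epsilon> (s + \<kappa>) h (X j)"
        using elim by (auto intro!: trunc_mono[OF h ep(1)])
      with e0(2)[OF ep, of j] show ?case by linarith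
    qed
    show "trunc \<epsilon> (s - \<kappa>) h x \<le> N"
      using ev by (intro tendsto_upperbound[OF trunc_tendsto[OF h ep(1) X]]) (auto elim: eventually_mono)
    show "- N \<le> trunc \<epsilon> (s + \<kappa>) h x"
      using ev by (intro tendsto_lowerbound[OF trunc_tendsto[OF h ep(1) X]]) (auto elim: eventually_mono)
  qed
  have "(\<lambda>i. s - 1 / real (Suc i)) \<longlonglongrightarrow> s - 0" "(\<lambda>i. s + 1 / real (Suc i)) \<longlonglongrightarrow> s + 0"
    by (intro tendsto_intros LIMSEQ_Suc lim_1_over_n)+
  then have l: "(\<lambda>i. s - 1 / real (Suc i)) \<longlonglongrightarrow> s" "(\<lambda>i. s + 1 / real (Suc i)) \<longlonglongrightarrow> s" by simp_all
  have bnd: "\<bar>s - 1 / real (Suc i)\<bar> \<le> M + 1" "\<bar>s + 1 / real (Suc i)\<bar> \<le> M + 1" for i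
  proof -
    have "0 \<le> 1 / real (Suc i)" "1 / real (Suc i) \<le> 1" by auto
    then show "\<bar>s - 1 / real (Suc i)\<bar> \<le> M + 1" "\<bar>s + 1 / real (Suc i)\<bar> \<le> M + 1" using s by linarith+
  qed
  have "trunc \<epsilon> s h x \<le> N"
    by (rule LIMSEQ_le_const2[OF trunc_tendsto_level[OF h ep(1) l(1) bnd(1)]]) (auto intro!: ub)
  moreover have "- N \<le> trunc \<epsilon> s h x"
    by (rule LIMSEQ_le_const[OF trunc_tendsto_level[OF h ep(1) l(2) bnd(2)]]) (auto intro!: lb)
  ultimately show "\<bar>trunc \<epsilon> s h x\<bar> \<le> N" by simp
qed

text \<open>
  Subtracting two truncations bounds the integral over the shell \<open>d \<le> \<bar>z\<bar> < 2 d\<close>. On the part where \<open>h\<close> is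
  smaller than \<open>s - k\<close> the integrand is at least \<open>g k\<close>, so the complementary part must carry a comparable share
  of the mass of the shell in order to compensate.
\<close>

lemma good_points_mass:
  assumes h [measurable]: "h \<in> borel_measurable borel" and M: "\<And>y. \<bar>h y\<bar> \<le> M" and s: "\<bar>s\<bar> \<le> M"
    and d: "0 < d"
    and N: "\<bar>trunc d s h p\<bar> \<le> N" "\<bar>trunc (2 * d) s h p\<bar> \<le> N" and k: "0 < k"
  shows "g k * (LINT z|lborel. indicator {z. d \<le> norm z \<and> norm z < 2 * d} z * Kt d z) - 2 * N
     \<le> (g k + g (2 * M)) * (LINT z|lborel. indicator {z. d \<le> norm z \<and> norm z < 2 * d \<and> s - k \<le> h (p + z)} z * Kt d z)"
proof -
  let ?A = "{z. d \<le> norm z \<and> norm z < 2 * d}" and ?S = "{z. d \<le> norm z \<and> norm z < 2 * d \<and> s - k \<le> h (p + z)}"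
  have d2: "0 < 2 * d" using d by simp
  have iA: "integrable lborel (\<lambda>z. indicator ?A z * Kt d z)"
    using d by (intro bounded_times_Kt_integrable[of _ 1]) (auto simp: indicator_def)
  have iS: "integrable lborel (\<lambda>z. indicator ?S z * Kt d z)"
    using d by (intro bounded_times_Kt_integrable[of _ 1]) (auto simp: indicator_def)
  note iT = trunc_integrable[OF h M d, of s p] trunc_integrable[OF h M d2, of s p]
  have "g k * (LINT z|lborel. indicator ?A z * Kt d z) - (g k + g (2 * M)) * (LINT z|lborel. indicator ?S z * Kt d z)
     = (LINT z|lborel. g k * (indicator ?A z * Kt d z) - (g k + g (2 * M)) * (indicator ?S z * Kt d z))"
    using iA iS by simp
  also have "\<dots> \<le> (LINT z|lborel. g (s - h (p + z)) * Kt d z - g (s - h (p + z)) * Kt (2 * d) z)"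
  proof (rule integral_mono)
    show "integrable lborel (\<lambda>z. g k * (indicator ?A z * Kt d z) - (g k + g (2 * M)) * (indicator ?S z * Kt d z))"
      using iA iS by simp
    show "integrable lborel (\<lambda>z. g (s - h (p + z)) * Kt d z - g (s - h (p + z)) * Kt (2 * d) z)"
      using iT by simp
    fix z :: 'a
    show "g k * (indicator ?A z * Kt d z) - (g k + g (2 * M)) * (indicator ?S z * Kt d z)
      \<le> g (s - h (p + z)) * Kt d z - g (s - h (p + z)) * Kt (2 * d) z"
    proof (cases "z \<in> ?A")
      case True
      then have K: "Kt d z = K z" "Kt (2 * d) z = 0" by (auto simp: Kt_def)
      show ?thesis
      proof (cases "z \<in> ?S")
        case True
        have "- g (2 * M) \<le> g (s - h (p + z))" using g_diff_bound[OF s M[of "p + z"]] by linarith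
        then have "- g (2 * M) * K z \<le> g (s - h (p + z)) * K z" by (intro mult_right_mono K_nonneg)
        then show ?thesis using K True by (simp add: algebra_simps)
      next
        case False
        then have "g k \<le> g (s - h (p + z))" using True by (intro g_mono) auto
        then have "g k * K z \<le> g (s - h (p + z)) * K z" by (intro mult_right_mono K_nonneg)
        then show ?thesis using K True False by simp
      qed
    next
      case False
      then have "z \<notin> ?S" "Kt d z = Kt (2 * d) z" using d by (auto simp: Kt_def indicator_def)
      then show ?thesis using False by simp
    qed
  qed
  also have "\<dots> = trunc d s h p - trunc (2 * d) s h p"
    unfolding trunc_def using iT by simp
  also have "\<dots> \<le> 2 * N" using N by linarith
  finally show ?thesis by simp
qed

text \<open>
  Let \<open>l\<close> be the lower limit of \<open>u\<close> at \<open>x0\<close> and suppose that \<open>u x0 = l + 4 k\<close> with \<open>k > 0\<close>. Take \<open>x\<close> very close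
  to \<open>x0\<close> with \<open>u x < l + \<eta>\<close>, at distance \<open>d\<close> from \<open>P\<close>, and minimise \<open>u + b \<bar>y - x\<bar>\<^sup>2\<close> over the ball of radius
  \<open>d/2\<close>, where \<open>u\<close> is continuous. With \<open>b = 32 \<eta> / d\<^sup>2\<close> the minimiser \<open>y\<close> lies in the ball of radius \<open>d/4\<close>, since
  \<open>u \<ge> l - \<eta>\<close> near \<open>x0\<close>. Write \<open>X\<close> for \<open>d\<close> to the power \<open>- \<alpha>\<close>. The truncated integral at \<open>y\<close> splits into four parts:

    \<^item> for \<open>\<bar>z\<bar> < d/4\<close> the parabola touching \<open>u\<close> from below at \<open>y\<close> gives at most a constant times \<open>\<eta>\<close> to the power \<open>\<beta> - 1\<close> times \<open>X\<close>;
    \<^item> at intermediate distances \<open>u y - u (y + z) \<le> 2 \<eta>\<close>, which gives at most a constant times \<open>g (2 \<eta>) X\<close>;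
    \<^item> on the set \<open>S\<close> of good points, seen from the point \<open>p\<close> of \<open>P\<close> nearest to \<open>x\<close>, the integrand is at most \<open>- g k\<close>,
      which gives at most \<open>- c3 X\<close> with a constant \<open>c3\<close> not depending on \<open>\<eta>\<close>;
    \<^item> far away the integral is bounded by \<open>Cr\<close>, where \<open>Cr\<close> does not depend on \<open>d\<close>.

  For small \<open>\<eta>\<close> and then small \<open>d\<close> the sum is below \<open>- H\<close>, which contradicts the bound on \<open>L\<close>.
\<close>

lemma lsc_at_uniformly_bounded_point:
  fixes u h :: "'a \<Rightarrow> real"
  assumes h: "h \<in> borel_measurable borel" "\<And>y. \<bar>h y\<bar> \<le> M"
    and u: "\<And>y. \<bar>u y\<bar> \<le> M" "AE y in lborel. h y = u y"
    and lim: "\<And>x. ((\<lambda>\<epsilon>. trunc \<epsilon> (u x) h x) \<longlongrightarrow> L x) (at_right 0)" "\<And>x. \<bar>L x\<bar> \<le> H"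
    and P: "closed P" "x0 \<in> P" and R0: "0 < R0"
    and bnd: "0 < e0" "\<And>p \<epsilon>. p \<in> P \<Longrightarrow> dist x0 p < R0 \<Longrightarrow> 0 < \<epsilon> \<Longrightarrow> \<epsilon> < e0 \<Longrightarrow> \<bar>trunc \<epsilon> (u p) h p\<bar> \<le> N"
    and cont: "\<And>x. dist x0 x < R0 \<Longrightarrow> x \<notin> P \<Longrightarrow> isCont u x"
    and contP: "\<And>\<kappa>. 0 < \<kappa> \<Longrightarrow> \<exists>r>0. \<forall>p\<in>P. dist x0 p < r \<longrightarrow> u x0 - \<kappa> < u p"
    and kappa: "0 < \<kappa>"
  shows "\<exists>r>0. \<forall>x. dist x0 x < r \<longrightarrow> u x0 - \<kappa> < u x"
proof -
  have [measurable]: "h \<in> borel_measurable borel" by (rule h)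
  \<comment> \<open>\<open>l\<close> is the lower limit of \<open>u\<close> at \<open>x0\<close>, with the value at \<open>x0\<close> included.\<close>
  define A where "A = {t. \<exists>r>0. \<forall>x. dist x0 x < r \<longrightarrow> t \<le> u x}"
  define l where "l = Sup A"
  have "- M \<in> A" unfolding A_def using u(1) by (intro CollectI exI[of _ 1]) (auto simp: abs_le_iff minus_le_iff)
  have bdd: "bdd_above A" unfolding A_def by (rule bdd_aboveI[of _ "u x0"]) auto
  have below: "\<exists>r>0. \<forall>x. dist x0 x < r \<longrightarrow> l - \<eta> \<le> u x" if "0 < \<eta>" for \<eta>
  proof -
    have "l - \<eta> < Sup A" using that by (simp add: l_def)
    then obtain t where t: "t \<in> A" "l - \<eta> < t"
      using less_cSup_iff[OF _ bdd] \<open>- M \<in> A\<close> by auto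
    then show ?thesis unfolding A_def by force
  qed
  have above: "\<exists>x. dist x0 x < r \<and> u x < l + \<eta>" if "0 < \<eta>" "0 < r" for \<eta> r
  proof (rule ccontr)
    assume "\<not> ?thesis"
    then have "\<forall>x. dist x0 x < r \<longrightarrow> l + \<eta> \<le> u x" by (meson not_less)
    then have "l + \<eta> \<in> A" unfolding A_def using that(2) by blast
    then have "l + \<eta> \<le> l" unfolding l_def by (rule cSup_upper[OF _ bdd])
    with that show False by simp
  qed
  show ?thesis
  proof (cases "u x0 \<le> l")
    case True
    then show ?thesis using below[of "\<kappa> / 2"] kappa by force
  next
    case False
    define k where "k = (u x0 - l) / 4"
    have "4 * k = u x0 - l" by (simp add: k_def)
    then have k: "0 < k" "u x0 = l + 4 * k" using False by linarith+
    obtain cm where cm: "0 < cm" "\<And>\<epsilon>. 0 < \<epsilon> \<Longrightarrow> 2 * \<epsilon> \<le> \<rho> \<Longrightarrow>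
       cm * \<epsilon> powr (- \<alpha>) \<le> (LINT z|lborel. indicator (shell \<epsilon>) z * Kt \<epsilon> z)"
      using shell_mass_lower by blast
    obtain Cu where Cu: "0 < Cu" "\<And>\<epsilon>. 0 < \<epsilon> \<Longrightarrow> (LINT z|lborel. indicator {z. norm z < \<rho>} z * Kt \<epsilon> z) \<le> Cu * \<epsilon> powr (- \<alpha>)"
      using near_mass_upper by blast
    obtain Cn where Cn: "0 < Cn" "\<And>a b Q r \<epsilon>. 0 \<le> b \<Longrightarrow> norm a \<le> Q \<Longrightarrow> b * r \<le> Q \<Longrightarrow> 0 < r \<Longrightarrow> r \<le> \<rho> \<Longrightarrow> 0 < \<epsilon> \<Longrightarrow>
       (LINT z|lborel. (g (a \<bullet> z + b * (norm z)\<^sup>2) * indicator (ball 0 r) z) * Kt \<epsilon> z)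
         \<le> Cn * (b * Q powr (\<beta> - 2) * r powr (\<beta> - \<alpha>))"
      using parabola_truncated_upper by blast
    have M0: "0 \<le> M" using u(1)[of x0] by linarith
    define G where "G = g (2 * M)"
    have G: "0 \<le> G" unfolding G_def using M0 by (intro g_nonneg) simp
    have gk: "0 < g k" using k by (intro g_pos)
    define cK where "cK = lam / Lam * 3 powr (- \<alpha> - DIM('a))"
    have cK: "0 < cK" using lam_pos Lam_pos by (simp add: cK_def)
    \<comment> \<open>Half of the mass of the shell of radius \<open>2 d\<close> is given up to absorb the constant \<open>2 N\<close>.\<close>
    define cg where "cg = g k * cm * 2 powr (- \<alpha>) / (2 * (g k + G))"
    have cg: "0 < cg" using gk cm G by (simp add: cg_def)
    define c3 where "c3 = g k * cK * cg"
    have c3: "0 < c3" using gk cK cg by (simp add: c3_def)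
    define A1 where "A1 = Cn * (32 * 16 powr (\<beta> - 2) * 4 powr (\<alpha> - \<beta>))"
    define B1 where "B1 = Cu * 4 powr \<alpha>"
    obtain \<eta> where eta: "0 < \<eta>" "\<eta> \<le> k" "A1 * \<eta> powr (\<beta> - 1) + B1 * g (2 * \<eta>) \<le> c3 / 2"
      using small_eta[of A1 B1 "c3 / 2" k] Cn Cu c3 k by (auto simp: A1_def B1_def)
    obtain r1 where r1: "0 < r1" "\<And>x. dist x0 x < r1 \<Longrightarrow> l - \<eta> \<le> u x" using below[OF eta(1)] by blast
    obtain r2 where r2: "0 < r2" "\<And>p. p \<in> P \<Longrightarrow> dist x0 p < r2 \<Longrightarrow> u x0 - k < u p" using contP[OF k(1)] by blast
    define r where "r = min (min r1 r2) (min R0 \<rho>)"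
    have r: "0 < r" "r \<le> r1" "r \<le> r2" "r \<le> R0" "r \<le> \<rho>" using r1 r2 R0 rho_pos by (auto simp: r_def)
    have r': "0 < r / 2" using r by simp
    define Cr where "Cr = G * (LINT z|lborel. Kt (r / 2) z)"
    obtain q1 where q1: "0 < q1" "\<And>d. 0 < d \<Longrightarrow> d < q1 \<Longrightarrow> 4 * N / (g k * cm) < d powr (- \<alpha>)"
      using negative_power_unbounded[OF alpha_pos] by blast
    obtain q2 where q2: "0 < q2" "\<And>d. 0 < d \<Longrightarrow> d < q2 \<Longrightarrow> 2 * (Cr + H) / c3 < d powr (- \<alpha>)"
      using negative_power_unbounded[OF alpha_pos] by blast
    \<comment> \<open>All distances below are at most \<open>8 q\<close>; the bounds \<open>q1\<close> and \<open>q2\<close> make \<open>d\<close> to the power \<open>- \<alpha>\<close> large.\<close>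
    define q where "q = min (min (q1 / 2) q2) (min (r / 16) (e0 / 8))"
    have q: "0 < q" "q \<le> q1 / 2" "q \<le> q2" "q \<le> r / 16" "q \<le> e0 / 8" using q1 q2 r bnd(1) by (auto simp: q_def)
    obtain x where x: "dist x0 x < q" "u x < l + \<eta>" using above[OF eta(1) q(1)] by blast
    have "x \<notin> P" using r2(2)[of x] x q r k eta by force
    define d where "d = infdist x P"
    have Pne: "P \<noteq> {}" using P by auto
    have d0: "0 < d"
      using in_closed_iff_infdist_zero[OF P(1) Pne, of x] \<open>x \<notin> P\<close> infdist_nonneg[of x P] by (auto simp: d_def)
    obtain p where p: "p \<in> P" "infdist x P = dist x p"
      using infdist_attains_inf[OF P(1) Pne] by blast
    have dp: "d = dist x p" using p(2) by (simp add: d_def)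
    have dq: "d < q" using infdist_le[OF P(2), of x] x by (simp add: d_def dist_commute)
    have xp: "dist x0 p < 2 * q" using dist_triangle[of x0 p x] x dp dq by linarith
    have up: "l + 3 * k < u p" using r2(2)[OF p(1)] xp q r k by simp
    have far_P: "y \<notin> P" if "dist x y < d" for y
      using infdist_le[of y P x] that by (auto simp: d_def)
    \<comment> \<open>The penalty equals \<open>2 \<eta>\<close> at distance \<open>d/4\<close>, the most by which \<open>u\<close> can fall below its value at \<open>x\<close>.\<close>
    define b where "b = 32 * \<eta> / d\<^sup>2"
    have b0: "0 < b" using eta d0 by (simp add: b_def)
    have inball: "dist x0 y < R0 \<and> y \<notin> P" if "dist x y \<le> d / 2" for y
    proof
      have "dist x0 y \<le> dist x0 x + dist x y" by (rule dist_triangle)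
      then show "dist x0 y < R0" using x that dq q r by linarith
      show "y \<notin> P" using far_P that d0 by simp
    qed
    have "continuous_on (cball x (d / 2)) u"
      using inball cont by (intro continuous_at_imp_continuous_on) auto
    then have "continuous_on (cball x (d / 2)) (\<lambda>y. u y + b * (norm (y - x))\<^sup>2)" by (intro continuous_intros)
    then have "\<exists>y\<in>cball x (d / 2). \<forall>w\<in>cball x (d / 2). u y + b * (norm (y - x))\<^sup>2 \<le> u w + b * (norm (w - x))\<^sup>2"
      using d0 by (intro continuous_attains_inf) auto
    then obtain y where y: "y \<in> cball x (d / 2)"
      "\<And>w. w \<in> cball x (d / 2) \<Longrightarrow> u y + b * (norm (y - x))\<^sup>2 \<le> u w + b * (norm (w - x))\<^sup>2"
      by blast
    have uy: "u y + b * (norm (y - x))\<^sup>2 \<le> u x" using y(2)[of x] d0 by simp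
    have uy': "u y < l + \<eta>" using uy x b0 zero_le_power2[of "norm (y - x)"] mult_nonneg_nonneg[of b "(norm (y - x))\<^sup>2"] by linarith
    have dy0: "dist x0 y < 2 * q" using dist_triangle[of x0 y x] y(1) x dq d0 unfolding mem_cball by linarith
    have ny: "norm (y - x) < d / 4"
    proof (rule ccontr)
      assume "\<not> norm (y - x) < d / 4"
      then have "(d / 4)\<^sup>2 \<le> (norm (y - x))\<^sup>2" using d0 by (intro power_mono) auto
      then have "b * (d / 4)\<^sup>2 \<le> b * (norm (y - x))\<^sup>2" using b0 by (intro mult_left_mono) auto
      moreover have "b * (d / 4)\<^sup>2 = 2 * \<eta>" using d0 by (simp add: b_def power_divide)
      moreover have "l - \<eta> \<le> u y" using dy0 q r by (intro r1(2)) auto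
      ultimately show False using uy x by linarith
    qed
    define a where "a = (2 * b) *\<^sub>R (y - x)"
    have touch: "u y - u (y + z) \<le> a \<bullet> z + b * (norm z)\<^sup>2" if "norm z < d / 4" for z
    proof -
      have "norm (y + z - x) \<le> norm (y - x) + norm z" using norm_triangle_ineq[of "y - x" z] by (simp add: algebra_simps)
      then have "y + z \<in> cball x (d / 2)" using ny that by (simp add: dist_norm norm_minus_commute)
      from y(2)[OF this] have "u y - u (y + z) \<le> b * ((norm (y + z - x))\<^sup>2 - (norm (y - x))\<^sup>2)"
        by (simp add: algebra_simps)
      also have "(norm (y + z - x))\<^sup>2 = (norm (y - x))\<^sup>2 + 2 * ((y - x) \<bullet> z) + (norm z)\<^sup>2"
        unfolding power2_norm_eq_inner by (simp add: algebra_simps inner_commute)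
      finally show ?thesis by (simp add: a_def algebra_simps)
    qed
    define Q where "Q = 16 * \<eta> / d"
    have aQ: "norm a \<le> Q"
    proof -
      have "norm a = 2 * b * norm (y - x)" using b0 by (simp add: a_def)
      also have "\<dots> \<le> 2 * b * (d / 4)" using b0 ny by (intro mult_left_mono) auto
      also have "\<dots> = Q" using d0 by (simp add: b_def Q_def power2_eq_square)
      finally show ?thesis .
    qed
    have bQ: "b * (d / 4) \<le> Q" using d0 eta by (simp add: b_def Q_def power2_eq_square field_simps)
    have near_bound: "(LINT z|lborel. (g (a \<bullet> z + b * (norm z)\<^sup>2) * indicator (ball 0 (d / 4)) z) * Kt \<epsilon> z)
        \<le> A1 * \<eta> powr (\<beta> - 1) * d powr (- \<alpha>)" if e: "0 < \<epsilon>" for \<epsilon>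
    proof -
      have "(LINT z|lborel. (g (a \<bullet> z + b * (norm z)\<^sup>2) * indicator (ball 0 (d / 4)) z) * Kt \<epsilon> z)
        \<le> Cn * (b * Q powr (\<beta> - 2) * (d / 4) powr (\<beta> - \<alpha>))"
        using b0 aQ bQ d0 e dq q r by (intro Cn(2)) auto
      also have "b * Q powr (\<beta> - 2) * (d / 4) powr (\<beta> - \<alpha>)
         = (32 * 16 powr (\<beta> - 2) * 4 powr (\<alpha> - \<beta>)) * (\<eta> powr (\<beta> - 1) * d powr (- \<alpha>))"
      proof -
        have e1: "\<eta> * \<eta> powr (\<beta> - 2) = \<eta> powr (\<beta> - 1)" using eta powr_mult_base[of \<eta> "\<beta> - 2"] by simp
        have Qp: "Q powr (\<beta> - 2) = 16 powr (\<beta> - 2) * \<eta> powr (\<beta> - 2) * d powr (2 - \<beta>)"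
          using eta d0 powr_minus_divide[of d "\<beta> - 2"] by (simp add: Q_def powr_divide powr_mult)
        have dp: "(d / 4) powr (\<beta> - \<alpha>) = d powr (\<beta> - \<alpha>) * 4 powr (\<alpha> - \<beta>)"
          using d0 powr_minus_divide[of 4 "\<beta> - \<alpha>"] by (simp add: powr_divide)
        have bb: "b = 32 * \<eta> * d powr (- 2)" using d0 by (simp add: b_def powr_minus_divide)
        have "d powr (- 2) * d powr (2 - \<beta>) * d powr (\<beta> - \<alpha>) = d powr (- \<alpha>)" by (simp flip: powr_add)
        then show ?thesis unfolding bb Qp dp e1[symmetric] by (simp add: mult_ac)
      qed
      finally show ?thesis by (simp add: A1_def mult_ac)
    qed
    define S where "S = {z. 2 * d \<le> norm (y + z - p) \<and> norm (y + z - p) < 4 * d \<and> u p - k \<le> h (y + z)}"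
    have Sm [measurable]: "S \<in> sets borel" unfolding S_def by measurable
    have yp: "norm (p - y) \<le> 5 * d / 4"
      using norm_triangle_ineq[of "p - x" "x - y"] dp ny by (simp add: dist_norm norm_minus_commute)
    have Snorm: "3 * d / 4 \<le> norm z \<and> norm z < 6 * d" if "z \<in> S" for z
    proof -
      have 1: "2 * d \<le> norm (y + z - p)" "norm (y + z - p) < 4 * d" using that by (auto simp: S_def)
      have "norm (y + z - p) \<le> norm z + norm (p - y)" using norm_triangle_ineq4[of z "p - y"] by (simp add: algebra_simps)
      moreover have "norm z \<le> norm (y + z - p) + norm (p - y)" using norm_triangle_ineq[of "y + z - p" "p - y"] by simp
      ultimately show ?thesis using 1 yp d0 by linarith
    qed
    have d4: "0 < d / 4" using d0 by simp
    have d2: "0 < 2 * d" using d0 by simp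
    have iS: "integrable lborel (\<lambda>z. indicator S z * Kt (d / 4) z)"
      using d4 by (intro bounded_times_Kt_integrable[of _ 1]) (auto simp: indicator_def)
    \<comment> \<open>The same points as \<open>S\<close>, seen from \<open>p\<close>: there the bound on the truncations gives them a definite share of the mass.\<close>
    define S0 where "S0 = {z. 2 * d \<le> norm z \<and> norm z < 2 * (2 * d) \<and> u p - k \<le> h (p + z)}"
    have S0m [measurable]: "S0 \<in> sets borel" unfolding S0_def by measurable
    have S_mass: "cK * cg * d powr (- \<alpha>) \<le> (LINT z|lborel. indicator S z * Kt (d / 4) z)"
    proof -
      have iS0: "integrable lborel (\<lambda>z. indicator S0 z * Kt (2 * d) z)"
        using d2 by (intro bounded_times_Kt_integrable[of _ 1]) (auto simp: indicator_def)
      have de: "2 * d < e0" "2 * (2 * d) < e0" using dq q d0 bnd(1) by linarith+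
      have pR: "dist x0 p < R0" using xp q r by linarith
      have b1: "\<bar>trunc (2 * d) (u p) h p\<bar> \<le> N" "\<bar>trunc (2 * (2 * d)) (u p) h p\<bar> \<le> N"
        using de d0 by (auto intro!: bnd(2) p pR)
      have "g k * (cm * (2 * d) powr (- \<alpha>)) - 2 * N
        \<le> g k * (LINT z|lborel. indicator {z. 2 * d \<le> norm z \<and> norm z < 2 * (2 * d)} z * Kt (2 * d) z) - 2 * N"
        using gk d2 dq q r by (intro diff_right_mono mult_left_mono cm(2)) auto
      also have "\<dots> \<le> (g k + G) * (LINT z|lborel. indicator S0 z * Kt (2 * d) z)"
        unfolding G_def S0_def by (rule good_points_mass[OF h u(1) d2 b1 k(1)])
      finally have 1: "g k * (cm * (2 * d) powr (- \<alpha>)) - 2 * N \<le> (g k + G) * (LINT z|lborel. indicator S0 z * Kt (2 * d) z)" .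
      have "4 * N / (g k * cm) < (2 * d) powr (- \<alpha>)" using d0 dq q by (intro q1(2)) auto
      then have "4 * N < g k * (cm * (2 * d) powr (- \<alpha>))" using gk cm(1) by (simp add: field_simps)
      with 1 have "g k * (cm * (2 * d) powr (- \<alpha>)) / 2 \<le> (g k + G) * (LINT z|lborel. indicator S0 z * Kt (2 * d) z)" by linarith
      moreover have "g k * (cm * (2 * d) powr (- \<alpha>)) / 2 = (g k + G) * (cg * d powr (- \<alpha>))"
      proof -
        have "g k + G \<noteq> 0" using gk G by linarith
        then show ?thesis using d0 by (simp add: cg_def powr_mult field_simps)
      qed
      ultimately have "cg * d powr (- \<alpha>) \<le> (LINT z|lborel. indicator S0 z * Kt (2 * d) z)"
        using gk G by simp
      then have "cK * (cg * d powr (- \<alpha>)) \<le> cK * (LINT z|lborel. indicator S0 z * Kt (2 * d) z)"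
        using cK by (intro mult_left_mono) auto
      also have "\<dots> = (LINT z|lborel. cK * (indicator S0 z * Kt (2 * d) z))" by simp
      also have "\<dots> \<le> (LINT z|lborel. indicator S ((p - y) + z) * Kt (d / 4) ((p - y) + z))"
      proof (rule integral_mono)
        show "integrable lborel (\<lambda>z. cK * (indicator S0 z * Kt (2 * d) z))" using iS0 by simp
        show "integrable lborel (\<lambda>z. indicator S ((p - y) + z) * Kt (d / 4) ((p - y) + z))"
          by (rule integrable_lborel_translate[OF iS])
        fix z :: 'a
        show "cK * (indicator S0 z * Kt (2 * d) z) \<le> indicator S ((p - y) + z) * Kt (d / 4) ((p - y) + z)"
        proof (cases "z \<in> S0")
          case True
          then have zS: "(p - y) + z \<in> S" by (simp add: S_def S0_def)
          from Snorm[OF this] have nz: "3 * d / 4 \<le> norm ((p - y) + z)" "norm ((p - y) + z) < 6 * d" by auto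
          have "cK * K z \<le> K ((p - y) + z)" unfolding cK_def
            using True nz d0 dq q r by (intro K_compare[of d]) (auto simp: S0_def)
          moreover have "Kt (2 * d) z = K z" using True by (simp add: Kt_def S0_def)
          moreover have "Kt (d / 4) ((p - y) + z) = K ((p - y) + z)" using nz d0 by (simp add: Kt_def)
          ultimately show ?thesis using True zS by simp
        qed (simp add: Kt_nonneg)
      qed
      also have "\<dots> = (LINT z|lborel. indicator S z * Kt (d / 4) z)"
        by (rule integral_lborel_translate) measurable
      finally show ?thesis by (simp add: mult.assoc)
    qed
    define X where "X = d powr (- \<alpha>)"
    have X0: "0 < X" using d0 by (simp add: X_def)
    have AEz: "AE z in lborel. h (y + z) = u (y + z)" by (rule AE_lborel_translate[OF u(2)])
    have key: "trunc \<epsilon> (u y) h y \<le> - (c3 / 2) * X + Cr" if e: "0 < \<epsilon>" "\<epsilon> < d / 4" for \<epsilon>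
    proof -
      let ?near = "\<lambda>z. (g (a \<bullet> z + b * (norm z)\<^sup>2) * indicator (ball 0 (d / 4)) z) * Kt \<epsilon> z"
      let ?mid = "\<lambda>z. g (2 * \<eta>) * (indicator {z. norm z < \<rho>} z * Kt (d / 4) z)"
      let ?good = "\<lambda>z. g k * (indicator S z * Kt (d / 4) z)"
      let ?far = "\<lambda>z. G * Kt (r / 2) z"
      have i1: "integrable lborel ?near"
        using b0 d4 e(1) by (intro parabola_truncated_integrable) auto
      have i2: "integrable lborel (\<lambda>z. indicator {z. norm z < \<rho>} z * Kt (d / 4) z)"
        using d4 by (intro bounded_times_Kt_integrable[of _ 1]) (auto simp: indicator_def)
      have i4: "integrable lborel ?far" using Kt_integrable[OF r'] by simp
      have "trunc \<epsilon> (u y) h y \<le> (LINT z|lborel. ?near z + ?mid z - ?good z + ?far z)"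
        unfolding trunc_def
      proof (rule integral_mono_AE)
        show "integrable lborel (\<lambda>z. g (u y - h (y + z)) * Kt \<epsilon> z)" by (rule trunc_integrable[OF h e(1)])
        show "integrable lborel (\<lambda>z. ?near z + ?mid z - ?good z + ?far z)" using i1 i2 iS i4 by simp
        show "AE z in lborel. g (u y - h (y + z)) * Kt \<epsilon> z \<le> ?near z + ?mid z - ?good z + ?far z"
          using AEz
        proof eventually_elim
          case (elim z)
          have far0: "0 \<le> ?far z" using G Kt_nonneg[of "r / 2" z] by simp
          have mid0: "0 \<le> ?mid z" using g_nonneg[of "2 * \<eta>"] eta Kt_nonneg[of "d / 4" z] by simp
          consider "norm z < d / 4" | "d / 4 \<le> norm z" "norm z < r / 2" | "r / 2 \<le> norm z" by linarith
          then show ?case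
          proof cases
            case 1
            have nS: "z \<notin> S" using Snorm[of z] 1 d0 by auto
            have "g (u y - h (y + z)) * Kt \<epsilon> z \<le> ?near z"
              using 1 touch[OF 1] unfolding elim by (auto intro!: mult_right_mono Kt_nonneg g_mono)
            with far0 mid0 nS show ?thesis by simp
          next
            case 2
            have K: "Kt \<epsilon> z = K z" "Kt (d / 4) z = K z" "norm z < \<rho>" "\<not> norm z < d / 4"
              using 2 e r by (auto simp: Kt_def)
            have dd: "dist x0 (y + z) < r1"
            proof -
              have "dist x0 (y + z) \<le> dist x0 y + norm z" using dist_triangle[of x0 "y + z" y] by (simp add: dist_norm)
              then show ?thesis using dy0 2 q r by linarith
            qed
            have "g (u y - h (y + z)) \<le> g (2 * \<eta>) - g k * indicator S z"
            proof (cases "z \<in> S")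
              case True
              then have "u y - h (y + z) \<le> - k" using uy' up eta(2) by (simp add: S_def)
              then have "g (u y - h (y + z)) \<le> - g k" using g_mono g_odd by metis
              then show ?thesis using True g_nonneg[of "2 * \<eta>"] eta by simp
            next
              case False
              have "u y - h (y + z) \<le> 2 * \<eta>" using r1(2)[OF dd] uy' elim by simp
              then show ?thesis using False by (simp add: g_mono)
            qed
            then have "g (u y - h (y + z)) * K z \<le> (g (2 * \<eta>) - g k * indicator S z) * K z"
              by (intro mult_right_mono K_nonneg)
            with far0 show ?thesis using K by (simp add: algebra_simps)
          next
            case 3
            have nS: "z \<notin> S" using Snorm[of z] 3 dq q by auto
            have n4: "\<not> norm z < d / 4" using 3 dq q d0 by simp
            have "Kt \<epsilon> z = K z" "Kt (r / 2) z = K z" using 3 e dq q by (auto simp: Kt_def)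
            moreover have "g (u y - h (y + z)) \<le> G"
              unfolding G_def using g_diff_bound[OF u(1)[of y] h(2)[of "y + z"]] by linarith
            then have "g (u y - h (y + z)) * K z \<le> G * K z" by (intro mult_right_mono K_nonneg)
            ultimately show ?thesis using mid0 nS n4 by simp
          qed
        qed
      qed
      also have "\<dots> = (LINT z|lborel. ?near z) + g (2 * \<eta>) * (LINT z|lborel. indicator {z. norm z < \<rho>} z * Kt (d / 4) z)
          - g k * (LINT z|lborel. indicator S z * Kt (d / 4) z) + Cr"
        unfolding Cr_def using i1 i2 iS i4 by simp
      also have "\<dots> \<le> A1 * \<eta> powr (\<beta> - 1) * X + g (2 * \<eta>) * (B1 * X) - g k * (cK * cg * X) + Cr"
      proof (intro add_right_mono diff_mono add_mono mult_left_mono)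
        show "(LINT z|lborel. ?near z) \<le> A1 * \<eta> powr (\<beta> - 1) * X" unfolding X_def by (rule near_bound[OF e(1)])
        have "(LINT z|lborel. indicator {z. norm z < \<rho>} z * Kt (d / 4) z) \<le> Cu * (d / 4) powr (- \<alpha>)"
          by (rule Cu(2)[OF d4])
        also have "\<dots> = B1 * X" using d0 by (simp add: B1_def X_def powr_divide powr_minus_divide)
        finally show "(LINT z|lborel. indicator {z. norm z < \<rho>} z * Kt (d / 4) z) \<le> B1 * X" .
        show "cK * cg * X \<le> (LINT z|lborel. indicator S z * Kt (d / 4) z)" unfolding X_def by (rule S_mass)
        show "0 \<le> g (2 * \<eta>)" using eta by (intro g_nonneg) simp
        show "0 \<le> g k" using gk by simp
      qed
      also have "\<dots> = (A1 * \<eta> powr (\<beta> - 1) + B1 * g (2 * \<eta>)) * X - c3 * X + Cr"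
        by (simp add: c3_def algebra_simps)
      also have "\<dots> \<le> c3 / 2 * X - c3 * X + Cr"
        using eta(3) X0 by (intro add_right_mono diff_right_mono mult_right_mono) auto
      finally show ?thesis by (simp add: algebra_simps)
    qed
    have "L y \<le> - (c3 / 2) * X + Cr"
    proof (rule tendsto_upperbound[OF lim(1)[of y]])
      show "\<forall>\<^sub>F \<epsilon> in at_right 0. trunc \<epsilon> (u y) h y \<le> - (c3 / 2) * X + Cr"
        unfolding eventually_at_right_field using key d4 by blast
    qed simp
    moreover have "- H \<le> L y" using lim(2)[of y] by linarith
    moreover have "2 * (Cr + H) / c3 < X" unfolding X_def using d0 dq q by (intro q2(2)) auto
    then have "Cr + H < c3 / 2 * X" using c3 by (simp add: field_simps)
    ultimately have False by simp
    then show ?thesis ..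
  qed
qed

text \<open>
  Baire's theorem is applied to the closed set \<open>P\<close> of points without a neighbourhood of continuity, covered by the
  closed sets \<open>F N\<close> on which the truncated integrals are bounded uniformly. Lower semicontinuity is applied to \<open>u\<close>
  and to \<open>- u\<close>.
\<close>

lemma pointwise_solution_continuous:
  fixes u h :: "'a \<Rightarrow> real"
  assumes h: "h \<in> borel_measurable borel" "\<And>y. \<bar>h y\<bar> \<le> M"
    and u: "\<And>y. \<bar>u y\<bar> \<le> M" "AE y in lborel. h y = u y"
    and lim: "\<And>x. ((\<lambda>\<epsilon>. trunc \<epsilon> (u x) h x) \<longlongrightarrow> L x) (at_right 0)" "\<And>x. \<bar>L x\<bar> \<le> H"
  shows "isCont u x"
proof -
  define F where "F N = {x. \<forall>\<epsilon>. 0 < \<epsilon> \<longrightarrow> \<epsilon> < 1 / real (Suc N) \<longrightarrow> \<bar>trunc \<epsilon> (u x) h x\<bar> \<le> real N}" for N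
  have ebd: "\<exists>e>0. \<forall>\<epsilon>. 0 < \<epsilon> \<longrightarrow> \<epsilon> < e \<longrightarrow> \<bar>trunc \<epsilon> (u x) h x\<bar> \<le> H + 1" for x
  proof -
    have "\<forall>\<^sub>F \<epsilon> in at_right 0. dist (trunc \<epsilon> (u x) h x) (L x) < 1" by (rule tendstoD[OF lim(1)]) simp
    then obtain e where e: "0 < e" "\<And>\<epsilon>. 0 < \<epsilon> \<Longrightarrow> \<epsilon> < e \<Longrightarrow> dist (trunc \<epsilon> (u x) h x) (L x) < 1"
      unfolding eventually_at_right_field by auto
    have "\<bar>trunc \<epsilon> (u x) h x\<bar> \<le> H + 1" if "0 < \<epsilon>" "\<epsilon> < e" for \<epsilon>
      using e(2)[OF that] lim(2)[of x] by (simp add: dist_real_def)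
    then show ?thesis using e(1) by blast
  qed
  have F_cover: "\<exists>N. x \<in> F N" for x
  proof -
    obtain e where e: "0 < e" "\<And>\<epsilon>. 0 < \<epsilon> \<Longrightarrow> \<epsilon> < e \<Longrightarrow> \<bar>trunc \<epsilon> (u x) h x\<bar> \<le> H + 1" using ebd[of x] by blast
    obtain N1 :: nat where N1: "1 / real (Suc N1) < e" using nat_approx_posE[OF e(1)] by blast
    obtain N2 :: nat where N2: "H + 1 \<le> real N2" using real_arch_simple by blast
    let ?N = "max N1 N2"
    have "1 / real (Suc ?N) \<le> 1 / real (Suc N1)" by (intro divide_left_mono) auto
    then have N1': "1 / real (Suc ?N) < e" using N1 by linarith
    have N2': "H + 1 \<le> real ?N" using N2 by simp
    have "\<bar>trunc \<epsilon> (u x) h x\<bar> \<le> real ?N" if "0 < \<epsilon>" "\<epsilon> < 1 / real (Suc ?N)" for \<epsilon>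
      using e(2)[of \<epsilon>] that N1' N2' by linarith
    then have "x \<in> F ?N" unfolding F_def by blast
    then show ?thesis ..
  qed
  have F_lim: "(\<lambda>j. u (X j)) \<longlonglongrightarrow> u z" "z \<in> F N" if X: "\<And>j. X j \<in> F N" "X \<longlonglongrightarrow> z" for X z N
  proof -
    obtain e where e: "0 < e" "\<And>\<epsilon>. 0 < \<epsilon> \<Longrightarrow> \<epsilon> < e \<Longrightarrow> \<bar>trunc \<epsilon> (u z) h z\<bar> \<le> H + 1" using ebd[of z] by blast
    have e0: "0 < 1 / real (Suc N)" by simp
    have b: "\<bar>trunc \<epsilon> (u (X j)) h (X j)\<bar> \<le> real N" if "0 < \<epsilon>" "\<epsilon> < 1 / real (Suc N)" for j \<epsilon>
      using X(1)[of j] that by (auto simp: F_def)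
    note R = trunc_bounded_limit[OF h X(2), where S = "\<lambda>j. u (X j)", OF u(1) u(1) e0 b e]
    show "(\<lambda>j. u (X j)) \<longlonglongrightarrow> u z" by (rule R(1))
    show "z \<in> F N" unfolding F_def using R(2) by blast
  qed
  have F_closed: "closed (F N)" for N
    unfolding closed_sequential_limits using F_lim(2) by blast
  have F_cont: "continuous_on (F N) u" for N
    unfolding continuous_on_sequentially o_def
    by (intro ballI allI impI, elim conjE, rule F_lim(1)) auto
  define U where "U = {x. \<exists>r>0. \<forall>y\<in>ball x r. isCont u y}"
  have "open U"
  proof (rule openI)
    fix x assume "x \<in> U"
    then obtain r where r: "0 < r" "\<forall>y\<in>ball x r. isCont u y" by (auto simp: U_def)
    have "ball x r \<subseteq> U"
    proof
      fix y assume y: "y \<in> ball x r"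
      then obtain r' where "0 < r'" "ball y r' \<subseteq> ball x r" using open_ball open_contains_ball by blast
      then show "y \<in> U" unfolding U_def using r(2) by blast
    qed
    then show "\<exists>e>0. ball x e \<subseteq> U" using r(1) by blast
  qed
  define P where "P = - U"
  have P_closed: "closed P" using \<open>open U\<close> by (simp add: P_def closed_def)
  have cont_off: "isCont u x" if "x \<notin> P" for x
  proof -
    from that obtain r where "0 < r" "\<forall>y\<in>ball x r. isCont u y" by (auto simp: P_def U_def)
    then show ?thesis by (auto dest: bspec[of _ _ x])
  qed
  have "P = {}"
  proof (rule ccontr)
    assume "P \<noteq> {}"
    have "\<exists>N. \<not> P \<subseteq> closure (P - F N)"
    proof (rule ccontr)
      assume "\<not> ?thesis"
      then have dense: "P \<subseteq> closure (P - F N)" for N by blast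
      have "P \<subseteq> closure (\<Inter> (range (\<lambda>N. P - F N)))"
      proof (rule Baire[OF P_closed])
        fix T assume "T \<in> range (\<lambda>N. P - F N)"
        then obtain N where "T = P - F N" by auto
        then show "openin (top_of_set P) T \<and> P \<subseteq> closure T"
          using dense[of N] F_closed[of N] by (auto simp: Diff_eq intro!: openin_open_Int)
      qed auto
      also have "\<Inter> (range (\<lambda>N. P - F N)) = {}" using F_cover by blast
      finally show False using \<open>P \<noteq> {}\<close> by simp
    qed
    then obtain N p where p: "p \<in> P" "p \<notin> closure (P - F N)" by blast
    then obtain R where R: "0 < R" "\<And>y. y \<in> P - F N \<Longrightarrow> R \<le> dist y p"
      unfolding closure_approachable by (auto simp: not_less)
    have inF: "y \<in> F N" if "y \<in> P" "dist p y < R" for y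
      using R(2)[of y] that by (auto simp: dist_commute)
    have "isCont u x0" if x0: "dist p x0 < R" for x0
    proof (cases "x0 \<in> P")
      case False
      then show ?thesis by (rule cont_off)
    next
      case True
      define R0 where "R0 = R - dist p x0"
      have R0: "0 < R0" using x0 by (simp add: R0_def)
      have inF': "y \<in> F N" if "y \<in> P" "dist x0 y < R0" for y
        using that dist_triangle[of p y x0] by (intro inF) (auto simp: R0_def)
      have x0F: "x0 \<in> F N" using inF[OF True x0] .
      have e0: "0 < 1 / real (Suc N)" by simp
      have bnd: "\<bar>trunc \<epsilon> (u q) h q\<bar> \<le> real N" if "q \<in> P" "dist x0 q < R0" "0 < \<epsilon>" "\<epsilon> < 1 / real (Suc N)" for q \<epsilon>
        using inF'[OF that(1,2)] that(3,4) by (auto simp: F_def)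
      have near: "\<exists>r>0. \<forall>q\<in>P. dist x0 q < r \<longrightarrow> dist (u q) (u x0) < \<kappa>" if k: "0 < \<kappa>" for \<kappa>
      proof -
        obtain r where r: "0 < r" "\<And>q. q \<in> F N \<Longrightarrow> dist q x0 < r \<Longrightarrow> dist (u q) (u x0) < \<kappa>"
          using F_cont[of N, unfolded continuous_on_iff, rule_format, OF x0F k] by blast
        have "\<forall>q\<in>P. dist x0 q < min r R0 \<longrightarrow> dist (u q) (u x0) < \<kappa>"
          using r(2) inF' by (auto simp: dist_commute)
        then show ?thesis using r(1) R0 by (intro exI[of _ "min r R0"]) simp
      qed
      have low: "\<exists>r>0. \<forall>x. dist x0 x < r \<longrightarrow> u x0 - \<kappa> < u x" if k: "0 < \<kappa>" for \<kappa>
      proof (rule lsc_at_uniformly_bounded_point[OF h u lim P_closed True R0 e0 bnd _ _ k])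
        show "isCont u x" if "x \<notin> P" for x by (rule cont_off[OF that])
        show "\<exists>r>0. \<forall>p\<in>P. dist x0 p < r \<longrightarrow> u x0 - \<kappa> < u p" if "0 < \<kappa>" for \<kappa>
          using near[OF that] by (fastforce simp: dist_real_def)
      qed
      have up: "\<exists>r>0. \<forall>x. dist x0 x < r \<longrightarrow> - u x0 - \<kappa> < - u x" if k: "0 < \<kappa>" for \<kappa>
      proof (rule lsc_at_uniformly_bounded_point[where h = "\<lambda>y. - h y" and L = "\<lambda>x. - L x", OF _ _ _ _ _ _ P_closed True R0 e0 _ _ _ k])
        show "(\<lambda>y. - h y) \<in> borel_measurable borel" using h(1) by measurable
        show "\<bar>- h y\<bar> \<le> M" "\<bar>- u y\<bar> \<le> M" for y using h(2)[of y] u(1)[of y] by simp_all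
        show "AE y in lborel. - h y = - u y" using u(2) by auto
        show "((\<lambda>\<epsilon>. trunc \<epsilon> (- u x) (\<lambda>y. - h y) x) \<longlongrightarrow> - L x) (at_right 0)" for x
          unfolding trunc_uminus by (intro tendsto_intros lim)
        show "\<bar>- L x\<bar> \<le> H" for x using lim(2)[of x] by simp
        show "\<bar>trunc \<epsilon> (- u p) (\<lambda>y. - h y) p\<bar> \<le> real N"
          if "p \<in> P" "dist x0 p < R0" "0 < \<epsilon>" "\<epsilon> < 1 / real (Suc N)" for p \<epsilon>
          unfolding trunc_uminus using bnd[OF that] by simp
        show "isCont (\<lambda>x. - u x) x" if "x \<notin> P" for x by (intro continuous_intros cont_off[OF that])
        show "\<exists>r>0. \<forall>p\<in>P. dist x0 p < r \<longrightarrow> - u x0 - \<kappa> < - u p" if "0 < \<kappa>" for \<kappa>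
          using near[OF that] by (fastforce simp: dist_real_def)
      qed
      show ?thesis
        unfolding continuous_at_eps_delta
      proof (intro allI impI)
        fix \<kappa> :: real assume k: "0 < \<kappa>"
        obtain r1 where r1: "0 < r1" "\<And>x. dist x0 x < r1 \<Longrightarrow> u x0 - \<kappa> < u x" using low[OF k] by blast
        obtain r2 where r2: "0 < r2" "\<And>x. dist x0 x < r2 \<Longrightarrow> - u x0 - \<kappa> < - u x" using up[OF k] by blast
        have "dist (u x) (u x0) < \<kappa>" if "dist x x0 < min r1 r2" for x
          using r1(2)[of x] r2(2)[of x] that by (auto simp: dist_real_def dist_commute abs_less_iff)
        then show "\<exists>d>0. \<forall>x. dist x x0 < d \<longrightarrow> dist (u x) (u x0) < \<kappa>"
          using r1(1) r2(1) by (intro exI[of _ "min r1 r2"]) simp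
      qed
    qed
    then have "p \<in> U" unfolding U_def using R(1) by auto
    with p(1) show False by (simp add: P_def)
  qed
  then show ?thesis using cont_off[of x] by simp
qed

section \<open>Weak form of the pointwise inequality\<close>

abbreviation Pm :: "('a \<times> 'a) measure" where "Pm \<equiv> lborel \<Otimes>\<^sub>M lborel"

definition moment :: real where "moment = (LINT z|lborel. norm z powr \<beta> * K z)"

lemma moment_nonneg: "0 \<le> moment"
  unfolding moment_def by (intro Bochner_Integration.integral_nonneg) (simp add: K_nonneg)

text \<open>
  A weight on pairs \<open>(x, z)\<close>, standing for the points \<open>x\<close> and \<open>x + z\<close>, that dominates every integrand vanishing
  unless one of the two points lies in the ball of radius \<open>R\<close>.
\<close>

abbreviation cover :: "real \<Rightarrow> 'a \<Rightarrow> 'a \<Rightarrow> real" where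
  "cover R x z \<equiv> (indicator (cball 0 R) x + indicator (cball 0 R) (x + z)) * (norm z powr \<beta> * K z)"

lemma pair_weight:
  assumes S [measurable]: "S \<in> sets borel" and fin: "emeasure lborel S < \<infinity>"
  shows "integrable Pm (\<lambda>(x, z). (indicator S x + indicator S (x + z)) * (norm z powr \<beta> * K z))" (is "integrable Pm ?f")
    and "(LINT p|Pm. (case p of (x, z) \<Rightarrow> (indicator S x + indicator S (x + z)) * (norm z powr \<beta> * K z)))
           = 2 * measure lborel S * moment"
proof -
  have m: "?f \<in> borel_measurable Pm" by measurable
  have nn: "0 \<le> ?f p" for p by (cases p) (simp add: K_nonneg)
  have eS: "emeasure lborel S = ennreal (measure lborel S)"
    using fin by (intro emeasure_eq_ennreal_measure) auto
  have inner: "(\<integral>\<^sup>+x. ennreal (?f (x, z)) \<partial>lborel) = ennreal (2 * measure lborel S * (norm z powr \<beta> * K z))" for z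
  proof -
    let ?k = "norm z powr \<beta> * K z"
    have k: "0 \<le> ?k" by (simp add: K_nonneg)
    have "(\<integral>\<^sup>+x. ennreal (?f (x, z)) \<partial>lborel)
      = (\<integral>\<^sup>+x. ennreal ?k * indicator S x + ennreal ?k * indicator S (z + x) \<partial>lborel)"
    proof (intro nn_integral_cong)
      fix x :: 'a
      have "ennreal (2 * ?k) = ennreal ?k + ennreal ?k" using k by (simp only: mult_2 ennreal_plus)
      then show "ennreal (?f (x, z)) = ennreal ?k * indicator S x + ennreal ?k * indicator S (z + x)"
        by (cases "x \<in> S"; cases "x + z \<in> S") (simp_all add: add.commute[of z x])
    qed
    also have "\<dots> = ennreal ?k * emeasure lborel S + (\<integral>\<^sup>+x. ennreal ?k * indicator S (z + x) \<partial>lborel)"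
      by (subst nn_integral_add) (auto simp: nn_integral_cmult_indicator)
    also have "(\<integral>\<^sup>+x. ennreal ?k * indicator S (z + x) \<partial>lborel) = ennreal ?k * emeasure lborel S"
      by (subst nn_integral_lborel_translate[of "\<lambda>x. ennreal ?k * indicator S x"])
         (auto simp: nn_integral_cmult_indicator)
    also have "ennreal ?k * emeasure lborel S = ennreal (?k * measure lborel S)"
      unfolding eS using k by (intro ennreal_mult[symmetric]) auto
    also have "ennreal (?k * measure lborel S) + ennreal (?k * measure lborel S)
        = ennreal (?k * measure lborel S + ?k * measure lborel S)"
      using k by (intro ennreal_plus[symmetric]) auto
    also have "?k * measure lborel S + ?k * measure lborel S = 2 * measure lborel S * ?k" by simp
    finally show ?thesis .
  qed
  have "(\<integral>\<^sup>+p. ennreal (?f p) \<partial>Pm) = (\<integral>\<^sup>+z. \<integral>\<^sup>+x. ennreal (?f (x, z)) \<partial>lborel \<partial>lborel)"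
    using m by (intro lborel_pair.nn_integral_snd[symmetric]) measurable
  also have "\<dots> = (\<integral>\<^sup>+z. ennreal (2 * measure lborel S * (norm z powr \<beta> * K z)) \<partial>lborel)"
    unfolding inner ..
  also have "\<dots> = ennreal (2 * measure lborel S * moment)"
    unfolding moment_def using K_moment
    by (subst nn_integral_eq_integral) (auto simp: K_nonneg)
  finally have val: "(\<integral>\<^sup>+p. ennreal (?f p) \<partial>Pm) = ennreal (2 * measure lborel S * moment)" .
  show int: "integrable Pm ?f"
    using val m nn by (intro integrableI_nonneg) auto
  have "(LINT p|Pm. ?f p) = enn2real (\<integral>\<^sup>+p. ennreal (?f p) \<partial>Pm)"
    using m nn by (intro integral_eq_nn_integral) auto
  then show "(LINT p|Pm. ?f p) = 2 * measure lborel S * moment"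
    unfolding val using moment_nonneg by simp
qed

lemma pair_integrable:
  assumes F [measurable]: "F \<in> borel_measurable Pm"
    and bd: "\<And>x z. \<bar>F (x, z)\<bar> \<le> B * cover R x z"
  shows "integrable Pm F"
proof (rule Bochner_Integration.integrable_bound)
  have fin: "emeasure lborel (cball 0 R :: 'a set) < \<infinity>"
    by (rule emeasure_bounded_finite) simp
  show "integrable Pm (\<lambda>p. B * (case p of (x, z) \<Rightarrow> cover R x z))"
    using pair_weight(1)[OF _ fin] by simp
  show "AE p in Pm. norm (F p) \<le> norm (B * (case p of (x, z) \<Rightarrow> cover R x z))"
  proof (rule AE_I2)
    fix p :: "'a \<times> 'a"
    obtain x z where p: "p = (x, z)" by (cases p) auto
    show "norm (F p) \<le> norm (B * (case p of (x, z) \<Rightarrow> cover R x z))"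
      unfolding p prod.case real_norm_def by (rule order_trans[OF bd abs_ge_self])
  qed
qed measurable

text \<open>
  Exchanging the two points is a translation in \<open>x\<close> followed by a reflection in \<open>z\<close>, so it preserves the measure on pairs.
\<close>

lemma pair_swap_integral:
  fixes F :: "'a \<Rightarrow> 'a \<Rightarrow> real"
  assumes F: "integrable Pm (\<lambda>(x, z). F x z)" and F': "integrable Pm (\<lambda>(x, z). F (x + z) (- z))"
  shows "(LINT p|Pm. (case p of (x, z) \<Rightarrow> F (x + z) (- z))) = (LINT p|Pm. (case p of (x, z) \<Rightarrow> F x z))"
proof -
  have [measurable]: "(\<lambda>(x, z). F x z) \<in> borel_measurable Pm" using F by simp
  have Fb [measurable]: "(\<lambda>p. F (fst p) (snd p)) \<in> borel_measurable (borel \<Otimes>\<^sub>M borel)"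
    using borel_measurable_integrable[OF F] by (simp add: case_prod_unfold cong: measurable_cong_sets)
  have sec: "(\<lambda>x. F x z) \<in> borel_measurable borel" for z
    using measurable_compose[OF _ Fb, of "\<lambda>x. (x, z)" borel] by simp
  have Gm: "(\<lambda>z. LINT x|lborel. F x z) \<in> borel_measurable borel"
    using borel_measurable_integrable[OF lborel_pair.integrable_snd[OF F]] by simp
  have "(LINT p|Pm. (case p of (x, z) \<Rightarrow> F (x + z) (- z))) = (LINT z|lborel. LINT x|lborel. F (x + z) (- z))"
    by (rule lborel_pair.integral_snd[OF F', symmetric])
  also have "\<dots> = (LINT z|lborel. LINT x|lborel. F x (- z))"
    using integral_lborel_translate[OF sec] by (simp add: add.commute)
  also have "\<dots> = (LINT z|lborel. LINT x|lborel. F x z)"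
    by (rule integral_lborel_reflect[OF Gm])
  also have "\<dots> = (LINT p|Pm. (case p of (x, z) \<Rightarrow> F x z))"
    by (rule lborel_pair.integral_snd[OF F])
  finally show ?thesis .
qed

end

lemma lipschitz_bound_continuous:
  fixes v :: "'a::real_normed_vector \<Rightarrow> real"
  assumes "0 \<le> L" "\<And>x y. \<bar>v x - v y\<bar> \<le> L * norm (x - y)"
  shows "continuous_on UNIV v"
  by (rule lipschitz_on_continuous_on[of L], rule lipschitz_onI)
    (use assms in \<open>auto simp: dist_norm\<close>)

text \<open>
  The supersolutions that admit a weak formulation: bounded, Lipschitz, and lying at each point below a
  parabola of fixed opening \<open>b\<close> that touches there. The last property is what bounds the truncated operator from below.
\<close>

locale semiconcave_supersolution = nonlocal_operator g \<beta> C K \<alpha> lam Lam \<rho>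
  for g \<beta> C and K :: "'a::euclidean_space \<Rightarrow> real" and \<alpha> lam Lam \<rho> +
  fixes v :: "'a \<Rightarrow> real" and M L A b :: real
  assumes v_bound: "\<bar>v x\<bar> \<le> M" and M_pos: "0 < M"
    and L_nonneg: "0 \<le> L" and A_nonneg: "0 \<le> A" and b_nonneg: "0 \<le> b"
    and v_lip: "\<bar>v x - v y\<bar> \<le> L * norm (x - y)"
    and v_touch: "\<exists>a. norm a \<le> A \<and> (\<forall>z. a \<bullet> z - b * (norm z)\<^sup>2 \<le> v x - v (x + z))"
    and v_super: "0 < \<delta> \<Longrightarrow> \<forall>\<^sub>F \<epsilon> in at_right 0. - \<delta> \<le> trunc \<epsilon> (v x) v x"
begin

lemma v_cont: "continuous_on UNIV v"
  by (rule lipschitz_bound_continuous[OF L_nonneg v_lip])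

lemma v_borel [measurable]: "v \<in> borel_measurable borel"
  using v_cont by (rule borel_measurable_continuous_onI)

text \<open>
  Near the centre, monotonicity compares \<open>v\<close> with the parabola touching it, whose truncated integrals are bounded
  uniformly; elsewhere the kernel is integrable.
\<close>

lemma trunc_lower_bound:
  obtains B where "0 \<le> B" "\<And>x \<epsilon>. 0 < \<epsilon> \<Longrightarrow> - B \<le> trunc \<epsilon> (v x) v x"
proof -
  obtain c where c: "0 < c" "\<And>a b Q r \<epsilon>. 0 \<le> b \<Longrightarrow> norm a \<le> Q \<Longrightarrow> b * r \<le> Q \<Longrightarrow> 0 < r \<Longrightarrow> r \<le> \<rho> \<Longrightarrow> 0 < \<epsilon> \<Longrightarrow>
       (LINT z|lborel. (g (a \<bullet> z + b * (norm z)\<^sup>2) * indicator (ball 0 r) z) * Kt \<epsilon> z)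
         \<le> c * (b * Q powr (\<beta> - 2) * r powr (\<beta> - \<alpha>))"
    using parabola_truncated_upper by blast
  have Ab: "0 \<le> A" "0 \<le> b" by (rule A_nonneg b_nonneg)+
  define Q where "Q = max A (b * \<rho>)"
  define G where "G = g (2 * M)"
  have G: "0 \<le> G" unfolding G_def using M_pos by (intro g_nonneg) simp
  define B where "B = c * (b * Q powr (\<beta> - 2) * \<rho> powr (\<beta> - \<alpha>)) + G * (LINT z|lborel. Kt \<rho> z)"
  show thesis
  proof (rule that)
    have "0 \<le> (LINT z|lborel. Kt \<rho> z)" by (intro Bochner_Integration.integral_nonneg Kt_nonneg)
    then show "0 \<le> B" using c(1) Ab G by (simp add: B_def)
    fix x :: 'a and \<epsilon> :: real assume e: "0 < \<epsilon>"
    obtain a where a: "norm a \<le> A" "\<And>z. a \<bullet> z - b * (norm z)\<^sup>2 \<le> v x - v (x + z)"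
      using v_touch[of x] by blast
    let ?near = "\<lambda>z. (g ((- a) \<bullet> z + b * (norm z)\<^sup>2) * indicator (ball 0 \<rho>) z) * Kt \<epsilon> z"
    have i1: "integrable lborel ?near"
      using Ab rho_pos e by (intro parabola_truncated_integrable) auto
    have i2: "integrable lborel (\<lambda>z. G * Kt \<rho> z)" using Kt_integrable[OF rho_pos] by simp
    have "- B \<le> - (LINT z|lborel. ?near z) - G * (LINT z|lborel. Kt \<rho> z)"
      using c(2)[OF Ab(2), of "- a" Q \<rho> \<epsilon>] a(1) rho_pos e by (simp add: B_def Q_def)
    also have "\<dots> = (LINT z|lborel. - ?near z - G * Kt \<rho> z)" using i1 i2 by simp
    also have "\<dots> \<le> trunc \<epsilon> (v x) v x"
      unfolding trunc_def
    proof (rule integral_mono)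
      show "integrable lborel (\<lambda>z. - ?near z - G * Kt \<rho> z)" using i1 i2 by simp
      show "integrable lborel (\<lambda>z. g (v x - v (x + z)) * Kt \<epsilon> z)" by (rule trunc_integrable[OF v_borel v_bound e])
      fix z :: 'a
      show "- ?near z - G * Kt \<rho> z \<le> g (v x - v (x + z)) * Kt \<epsilon> z"
      proof (cases "norm z < \<rho>")
        case True
        have "- g ((- a) \<bullet> z + b * (norm z)\<^sup>2) = g (a \<bullet> z - b * (norm z)\<^sup>2)"
          using g_odd[of "(- a) \<bullet> z + b * (norm z)\<^sup>2"] by simp
        also have "\<dots> \<le> g (v x - v (x + z))" by (rule g_mono[OF a(2)])
        finally have "- g ((- a) \<bullet> z + b * (norm z)\<^sup>2) * Kt \<epsilon> z \<le> g (v x - v (x + z)) * Kt \<epsilon> z"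
          by (intro mult_right_mono Kt_nonneg)
        moreover have "Kt \<rho> z = 0" using True by (simp add: Kt_def)
        ultimately show ?thesis using True by simp
      next
        case False
        have "- G \<le> g (v x - v (x + z))"
          unfolding G_def using g_diff_bound[OF v_bound[of x] v_bound[of "x + z"]] by linarith
        then have "- G * Kt \<epsilon> z \<le> g (v x - v (x + z)) * Kt \<epsilon> z" by (intro mult_right_mono Kt_nonneg)
        moreover have "Kt \<epsilon> z \<le> Kt \<rho> z" using False by (simp add: Kt_def indicator_def K_nonneg)
        then have "G * Kt \<epsilon> z \<le> G * Kt \<rho> z" using G by (intro mult_left_mono)
        ultimately show ?thesis using False by simp
      qed
    qed
    finally show "- B \<le> trunc \<epsilon> (v x) v x" .
  qed
qed

lemma g_increment_bound: "\<bar>g (v x - v (x + z))\<bar> \<le> C * L powr (\<beta> - 1) * norm z powr (\<beta> - 1)"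
proof -
  have "\<bar>g (v x - v (x + z))\<bar> = g \<bar>v x - v (x + z)\<bar>" by (rule g_abs)
  also have "\<dots> \<le> g (L * norm z)" using v_lip[of x "x + z"] by (intro g_mono) simp
  also have "\<dots> \<le> C * (L * norm z) powr (\<beta> - 1)" using L_nonneg by (intro g_growth) simp
  also have "\<dots> = C * L powr (\<beta> - 1) * norm z powr (\<beta> - 1)" using L_nonneg by (simp add: powr_mult)
  finally show ?thesis .
qed

text \<open>
  For fixed \<open>\<epsilon>\<close> everything is absolutely integrable, and symmetrising in the two points turns twice the integral of
  \<open>\<phi> T\<^sub>\<epsilon>\<close> into the double integral with \<open>\<phi> x - \<phi> (x + z)\<close>. The latter converges as \<open>\<epsilon> \<longrightarrow> 0\<close> because
  the product of the increments is of order \<open>\<bar>z\<bar>\<^sup>\<beta>\<close>. The negative parts of \<open>T\<^sub>\<epsilon>\<close> are uniformly bounded and tend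
  to \<open>0\<close> pointwise, so the limit is nonnegative.
\<close>

lemma weak_supersolution:
  fixes \<phi> :: "'a \<Rightarrow> real"
  assumes \<phi> [measurable]: "\<phi> \<in> borel_measurable borel" and \<phi>0: "\<And>x. 0 \<le> \<phi> x" "\<And>x. \<phi> x \<le> B\<phi>"
    and lip: "0 \<le> L\<phi>" "\<And>x y. \<bar>\<phi> x - \<phi> y\<bar> \<le> L\<phi> * norm (x - y)"
    and supp: "\<And>x. R < norm x \<Longrightarrow> \<phi> x = 0"
  shows "integrable Pm (\<lambda>(x, z). g (v x - v (x + z)) * (\<phi> x - \<phi> (x + z)) * K z)" (is "integrable Pm ?\<Phi>")
    and "0 \<le> (LINT p|Pm. (case p of (x, z) \<Rightarrow> g (v x - v (x + z)) * (\<phi> x - \<phi> (x + z)) * K z))"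
proof -
  have [measurable]: "cball (0::'a) R \<in> sets borel" by simp
  have base: "\<bar>g (v x - v (x + z)) * (\<phi> x - \<phi> (x + z)) * k\<bar>
     \<le> (C * L powr (\<beta> - 1) * L\<phi>) * ((indicator (cball 0 R) x + indicator (cball 0 R) (x + z)) * (norm z powr \<beta> * k))"
    if "0 \<le> k" for x z k
  proof (cases "norm x \<le> R \<or> norm (x + z) \<le> R")
    case True
    have "\<bar>g (v x - v (x + z)) * (\<phi> x - \<phi> (x + z)) * k\<bar> = \<bar>g (v x - v (x + z))\<bar> * \<bar>\<phi> x - \<phi> (x + z)\<bar> * k"
      using that by (simp add: abs_mult)
    also have "\<dots> \<le> (C * L powr (\<beta> - 1) * norm z powr (\<beta> - 1)) * (L\<phi> * norm z) * k"
      using lip(2)[of x "x + z"] lip(1) that C_pos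
      by (intro mult_right_mono mult_mono g_increment_bound) auto
    also have "\<dots> = (C * L powr (\<beta> - 1) * L\<phi>) * (1 * (norm z powr \<beta> * k))"
      using powr_mult_base[of "norm z" "\<beta> - 1"] by (simp add: mult_ac)
    also have "\<dots> \<le> (C * L powr (\<beta> - 1) * L\<phi>) * ((indicator (cball 0 R) x + indicator (cball 0 R) (x + z)) * (norm z powr \<beta> * k))"
      using True lip(1) that C_pos by (intro mult_left_mono mult_right_mono) (auto simp: indicator_def)
    finally show ?thesis .
  next
    case False
    then show ?thesis using supp[of x] supp[of "x + z"] lip(1) C_pos that by simp
  qed
  show int: "integrable Pm ?\<Phi>"
  proof (rule pair_integrable)
    show "?\<Phi> \<in> borel_measurable Pm" by measurable
  qed (use base[OF K_nonneg] in simp)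
  define G where "G = g (2 * M)"
  have G: "0 \<le> G" unfolding G_def using M_pos by (intro g_nonneg) simp
  have B\<phi>: "0 \<le> B\<phi>" using \<phi>0 order_trans by blast
  have Kt_le: "Kt \<epsilon> z \<le> \<epsilon> powr (- \<beta>) * (norm z powr \<beta> * K z)" if "0 < \<epsilon>" for \<epsilon> z
  proof (cases "\<epsilon> \<le> norm z")
    case True
    have "\<epsilon> powr \<beta> \<le> norm z powr \<beta>" using that True beta_ge_2 by (intro powr_mono2) auto
    then have "1 \<le> \<epsilon> powr (- \<beta>) * norm z powr \<beta>" using that by (simp add: powr_minus field_simps)
    from mult_right_mono[OF this K_nonneg[of z]] show ?thesis using True by (simp add: Kt_def mult.assoc)
  qed (simp add: Kt_def K_nonneg)
  have key: "2 * (LINT x|lborel. \<phi> x * trunc \<epsilon> (v x) v x)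
      = (LINT p|Pm. (case p of (x, z) \<Rightarrow> g (v x - v (x + z)) * (\<phi> x - \<phi> (x + z)) * Kt \<epsilon> z))"
    and intT: "integrable lborel (\<lambda>x. \<phi> x * trunc \<epsilon> (v x) v x)" if e: "0 < \<epsilon>" for \<epsilon>
  proof -
    define F where "F x z = \<phi> x * g (v x - v (x + z)) * Kt \<epsilon> z" for x z
    have bd: "\<bar>\<phi> y * g (v x - v (x + z)) * Kt \<epsilon> z\<bar>
       \<le> (B\<phi> * G * \<epsilon> powr (- \<beta>)) * cover R x z"
      if y: "y = x \<or> y = x + z" for x y z
    proof (cases "norm y \<le> R")
      case True
      have "\<bar>\<phi> y * g (v x - v (x + z)) * Kt \<epsilon> z\<bar> = \<phi> y * \<bar>g (v x - v (x + z))\<bar> * Kt \<epsilon> z"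
        using \<phi>0(1)[of y] Kt_nonneg[of \<epsilon> z] by (simp add: abs_mult)
      also have "\<dots> \<le> B\<phi> * G * (\<epsilon> powr (- \<beta>) * (norm z powr \<beta> * K z))"
        unfolding G_def using \<phi>0[of y] B\<phi> G[unfolded G_def] Kt_nonneg[of \<epsilon> z]
        by (intro mult_mono g_diff_bound v_bound Kt_le e) auto
      also have "\<dots> = (B\<phi> * G * \<epsilon> powr (- \<beta>)) * (1 * (norm z powr \<beta> * K z))" by simp
      also have "\<dots> \<le> (B\<phi> * G * \<epsilon> powr (- \<beta>)) * cover R x z"
        using True y B\<phi> G by (intro mult_left_mono mult_right_mono) (auto simp: indicator_def K_nonneg)
      finally show ?thesis .
    next
      case False
      then show ?thesis using supp[of y] B\<phi> G by (simp add: K_nonneg)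
    qed
    have iF: "integrable Pm (\<lambda>(x, z). F x z)"
    proof (rule pair_integrable)
      show "(\<lambda>(x, z). F x z) \<in> borel_measurable Pm" unfolding F_def by measurable
    qed (unfold F_def prod.case, rule bd, simp)
    have F': "F (x + z) (- z) = - (\<phi> (x + z) * g (v x - v (x + z)) * Kt \<epsilon> z)" for x z
      using g_odd[of "v x - v (x + z)"] by (simp add: F_def Kt_even)
    have iF': "integrable Pm (\<lambda>(x, z). F (x + z) (- z))"
      unfolding F'
    proof (rule pair_integrable)
      show "(\<lambda>(x, z). - (\<phi> (x + z) * g (v x - v (x + z)) * Kt \<epsilon> z)) \<in> borel_measurable Pm" by measurable
    qed (unfold prod.case abs_minus_cancel, rule bd, simp)
    have Fx: "(LINT z|lborel. F x z) = \<phi> x * trunc \<epsilon> (v x) v x" for x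
      by (simp add: F_def trunc_def mult.assoc)
    have I1: "(LINT x|lborel. \<phi> x * trunc \<epsilon> (v x) v x) = (LINT p|Pm. (case p of (x, z) \<Rightarrow> F x z))"
      using lborel_pair.integral_fst[OF iF] unfolding Fx .
    show "integrable lborel (\<lambda>x. \<phi> x * trunc \<epsilon> (v x) v x)"
      using lborel_pair.integrable_fst[OF iF] unfolding Fx .
    have "2 * (LINT x|lborel. \<phi> x * trunc \<epsilon> (v x) v x)
      = (LINT p|Pm. (case p of (x, z) \<Rightarrow> F x z)) + (LINT p|Pm. (case p of (x, z) \<Rightarrow> F (x + z) (- z)))"
      using I1 pair_swap_integral[OF iF iF'] by simp
    also have "\<dots> = (LINT p|Pm. (case p of (x, z) \<Rightarrow> F x z) + (case p of (x, z) \<Rightarrow> F (x + z) (- z)))"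
      by (rule Bochner_Integration.integral_add[OF iF iF', symmetric])
    also have "\<dots> = (LINT p|Pm. (case p of (x, z) \<Rightarrow> g (v x - v (x + z)) * (\<phi> x - \<phi> (x + z)) * Kt \<epsilon> z))"
    proof (intro Bochner_Integration.integral_cong refl)
      fix p :: "'a \<times> 'a"
      obtain x z where p: "p = (x, z)" by (cases p) auto
      show "(case p of (x, z) \<Rightarrow> F x z) + (case p of (x, z) \<Rightarrow> F (x + z) (- z))
        = (case p of (x, z) \<Rightarrow> g (v x - v (x + z)) * (\<phi> x - \<phi> (x + z)) * Kt \<epsilon> z)"
        unfolding p prod.case F' unfolding F_def by (simp add: algebra_simps)
    qed
    finally show "2 * (LINT x|lborel. \<phi> x * trunc \<epsilon> (v x) v x)
      = (LINT p|Pm. (case p of (x, z) \<Rightarrow> g (v x - v (x + z)) * (\<phi> x - \<phi> (x + z)) * Kt \<epsilon> z))" .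
  qed
  define e where "e j = 1 / real (Suc j)" for j
  have e0: "0 < e j" for j by (simp add: e_def)
  have elim: "e \<longlonglongrightarrow> 0" unfolding e_def by (rule LIMSEQ_Suc[OF lim_1_over_n])
  have eright: "filterlim e (at_right 0) sequentially"
    using elim e0 by (intro tendsto_imp_filterlim_at_right) (auto simp: eventually_sequentially)
  have limR: "(\<lambda>j. LINT p|Pm. (case p of (x, z) \<Rightarrow> g (v x - v (x + z)) * (\<phi> x - \<phi> (x + z)) * Kt (e j) z))
      \<longlonglongrightarrow> (LINT p|Pm. ?\<Phi> p)"
  proof (rule integral_dominated_convergence[where w = "\<lambda>p. \<bar>?\<Phi> p\<bar>"])
    show "integrable Pm (\<lambda>p. \<bar>?\<Phi> p\<bar>)" using int by (rule integrable_abs)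
    show "(\<lambda>p. case p of (x, z) \<Rightarrow> g (v x - v (x + z)) * (\<phi> x - \<phi> (x + z)) * Kt (e j) z) \<in> borel_measurable Pm" for j
      by measurable
    show "?\<Phi> \<in> borel_measurable Pm" by measurable
    show "AE p in Pm. (\<lambda>j. case p of (x, z) \<Rightarrow> g (v x - v (x + z)) * (\<phi> x - \<phi> (x + z)) * Kt (e j) z) \<longlonglongrightarrow> ?\<Phi> p"
    proof (rule AE_I2)
      fix p :: "'a \<times> 'a"
      obtain x z where p: "p = (x, z)" by fastforce
      show "(\<lambda>j. case p of (x, z) \<Rightarrow> g (v x - v (x + z)) * (\<phi> x - \<phi> (x + z)) * Kt (e j) z) \<longlonglongrightarrow> ?\<Phi> p"
      proof (cases "z = 0")
        case True
        then show ?thesis by (simp add: p)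
      next
        case False
        have "\<forall>\<^sub>F j in sequentially. e j < norm z" using order_tendstoD(2)[OF elim] False by simp
        then have "\<forall>\<^sub>F j in sequentially. Kt (e j) z = K z"
          by eventually_elim (simp add: Kt_def)
        then have "(\<lambda>j. Kt (e j) z) \<longlonglongrightarrow> K z" by (rule tendsto_eventually)
        then show ?thesis unfolding p prod.case by (intro tendsto_intros)
      qed
    qed
    show "AE p in Pm. norm (case p of (x, z) \<Rightarrow> g (v x - v (x + z)) * (\<phi> x - \<phi> (x + z)) * Kt (e j) z) \<le> \<bar>?\<Phi> p\<bar>" for j
    proof (rule AE_I2)
      fix p :: "'a \<times> 'a"
      show "norm (case p of (x, z) \<Rightarrow> g (v x - v (x + z)) * (\<phi> x - \<phi> (x + z)) * Kt (e j) z) \<le> \<bar>?\<Phi> p\<bar>"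
        by (cases p) (auto simp: Kt_def indicator_def)
    qed
  qed
  obtain B where B: "0 \<le> B" "\<And>x \<epsilon>. 0 < \<epsilon> \<Longrightarrow> - B \<le> trunc \<epsilon> (v x) v x"
    using trunc_lower_bound by blast
  define N where "N j x = \<phi> x * max 0 (- trunc (e j) (v x) v x)" for j x
  have Tm: "(\<lambda>x. trunc (e j) (v x) v x) \<in> borel_measurable borel" for j
    unfolding trunc_def by measurable
  have intI: "integrable lborel (\<lambda>x. B\<phi> * B * indicator (cball 0 R) (x::'a))"
    using emeasure_bounded_finite[of "cball (0::'a) R"] by simp
  have Nle: "norm (N j x) \<le> B\<phi> * B * indicator (cball 0 R) x" for j x
  proof (cases "norm x \<le> R")
    case True
    have "N j x \<le> B\<phi> * B" unfolding N_def
      using \<phi>0[of x] B\<phi> B(1) B(2)[OF e0, of j x] by (intro mult_mono) auto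
    moreover have "0 \<le> N j x" unfolding N_def using \<phi>0(1)[of x] by simp
    ultimately show ?thesis using True by simp
  qed (simp add: N_def supp)
  have Nm: "N j \<in> borel_measurable borel" for j unfolding N_def[abs_def] using Tm[of j] by measurable
  have "(\<lambda>j. LINT x|lborel. N j x) \<longlonglongrightarrow> (LINT x|(lborel :: 'a measure). (0::real))"
  proof (rule integral_dominated_convergence[OF _ _ intI])
    show "AE x in lborel. (\<lambda>j. N j x) \<longlonglongrightarrow> 0"
    proof (rule AE_I2)
      fix x :: 'a
      have "(\<lambda>j. max 0 (- trunc (e j) (v x) v x)) \<longlonglongrightarrow> 0"
      proof (rule tendstoI)
        fix \<delta> :: real assume d: "0 < \<delta>"
        have "\<forall>\<^sub>F j in sequentially. - (\<delta> / 2) \<le> trunc (e j) (v x) v x"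
          using eventually_compose_filterlim[OF v_super eright] d by simp
        then show "\<forall>\<^sub>F j in sequentially. dist (max 0 (- trunc (e j) (v x) v x)) 0 < \<delta>"
          by eventually_elim (use d in \<open>auto simp: dist_real_def max_def\<close>)
      qed
      from tendsto_mult_right_zero[OF this, of "\<phi> x"] show "(\<lambda>j. N j x) \<longlonglongrightarrow> 0" by (simp add: N_def)
    qed
  qed (use Nm Nle in auto)
  then have "(\<lambda>j. LINT x|lborel. N j x) \<longlonglongrightarrow> 0" by simp
  then have limN: "(\<lambda>j. - 2 * (LINT x|lborel. N j x)) \<longlonglongrightarrow> 0"
    by (rule tendsto_mult_right_zero)
  have iN: "integrable lborel (N j)" for j
  proof (rule Bochner_Integration.integrable_bound[OF intI])
    show "AE x in lborel. norm (N j x) \<le> norm (B\<phi> * B * indicator (cball 0 R) x)"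
    proof (rule AE_I2)
      fix x
      show "norm (N j x) \<le> norm (B\<phi> * B * indicator (cball 0 R) x)"
        using order_trans[OF Nle[of j x] abs_ge_self] by simp
    qed
  qed (use Nm in simp)
  have le: "- 2 * (LINT x|lborel. N j x)
     \<le> (LINT p|Pm. (case p of (x, z) \<Rightarrow> g (v x - v (x + z)) * (\<phi> x - \<phi> (x + z)) * Kt (e j) z))" for j
  proof -
    have "(LINT x|lborel. - N j x) \<le> (LINT x|lborel. \<phi> x * trunc (e j) (v x) v x)"
    proof (rule integral_mono)
      fix x
      have "\<phi> x * - max 0 (- trunc (e j) (v x) v x) \<le> \<phi> x * trunc (e j) (v x) v x"
        using \<phi>0(1)[of x] by (intro mult_left_mono) auto
      then show "- N j x \<le> \<phi> x * trunc (e j) (v x) v x" by (simp add: N_def)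
    qed (use iN intT[OF e0] in auto)
    then show ?thesis using key[OF e0, of j] by simp
  qed
  show "0 \<le> (LINT p|Pm. ?\<Phi> p)"
    by (intro LIMSEQ_le[OF limN limR] exI allI impI le)
qed

end

section \<open>Caccioppoli inequality and vanishing energy\<close>

definition cutoff :: "real \<Rightarrow> 'a::euclidean_space \<Rightarrow> real" where
  "cutoff R x = max 0 (min 1 (2 - norm x / R))"

lemma cutoff_range: "0 \<le> cutoff R x" "cutoff R x \<le> 1"
  by (auto simp: cutoff_def)

lemma cutoff_inside: "0 < R \<Longrightarrow> norm x \<le> R \<Longrightarrow> cutoff R x = 1"
  by (simp add: cutoff_def field_simps)

lemma cutoff_outside: "0 < R \<Longrightarrow> 2 * R < norm x \<Longrightarrow> cutoff R x = 0"
  by (simp add: cutoff_def field_simps)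

lemma cutoff_lipschitz:
  assumes "0 < R"
  shows "\<bar>cutoff R x - cutoff R y\<bar> \<le> norm (x - y) / R"
proof -
  have "\<bar>cutoff R x - cutoff R y\<bar> \<le> \<bar>norm x / R - norm y / R\<bar>"
    by (auto simp: cutoff_def max_def min_def)
  also have "\<dots> = \<bar>norm x - norm y\<bar> / R" using assms by (simp flip: diff_divide_distrib)
  also have "\<dots> \<le> norm (x - y) / R" using assms by (intro divide_right_mono norm_triangle_ineq3) simp
  finally show ?thesis .
qed

lemma cutoff_borel [measurable]: "cutoff R \<in> borel_measurable borel"
  unfolding cutoff_def[abs_def] by measurable

lemma locally_constant_uniform:
  fixes v :: "'a::euclidean_space \<Rightarrow> real"
  assumes r: "0 < r" and loc: "\<And>x z. norm z < r \<Longrightarrow> v (x + z) = v x"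
  shows "v x = v y"
proof -
  obtain n :: nat where n: "norm (y - x) / r < real n" using reals_Archimedean2 by blast
  have n0: "0 < real n" by (rule le_less_trans[OF _ n]) (use r in simp)
  define h where "h = (y - x) /\<^sub>R real n"
  have "norm (y - x) < real n * r" using n r by (simp add: pos_divide_less_eq)
  moreover have "real n * norm h = norm (y - x)" using n0 by (simp add: h_def)
  ultimately have h: "norm h < r" using n0 by (metis mult_less_cancel_left_pos)
  have "v (x + real k *\<^sub>R h) = v x" for k :: nat
  proof (induction k)
    case (Suc k)
    have "v (x + real (Suc k) *\<^sub>R h) = v ((x + real k *\<^sub>R h) + h)" by (simp add: algebra_simps)
    also have "\<dots> = v x" using loc[OF h] Suc by simp
    finally show ?case .
  qed simp
  from this[of n] show ?thesis using n0 by (simp add: h_def)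
qed

context semiconcave_supersolution
begin

abbreviation energy :: "'a \<Rightarrow> 'a \<Rightarrow> real" where
  "energy x z \<equiv> g (v x - v (x + z)) * (v x - v (x + z)) * K z"

abbreviation average :: "nat \<Rightarrow> real \<Rightarrow> 'a \<Rightarrow> 'a \<Rightarrow> real" where
  "average j R x z \<equiv> (cutoff R x ^ Suc j + cutoff R (x + z) ^ Suc j) / 2"

lemma energy_density_bound:
  "g (v x - v (x + z)) * (v x - v (x + z)) \<le> C * L powr (\<beta> - 1) * L * norm z powr \<beta>"
proof -
  have "g (v x - v (x + z)) * (v x - v (x + z)) \<le> \<bar>g (v x - v (x + z))\<bar> * \<bar>v x - v (x + z)\<bar>"
    using abs_ge_self[of "g (v x - v (x + z)) * (v x - v (x + z))"] by (simp add: abs_mult)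
  also have "\<dots> \<le> (C * L powr (\<beta> - 1) * norm z powr (\<beta> - 1)) * (L * norm z)"
    using v_lip[of x "x + z"] C_pos by (intro mult_mono g_increment_bound) auto
  also have "\<dots> = C * L powr (\<beta> - 1) * L * norm z powr \<beta>"
    using powr_mult_base[of "norm z" "\<beta> - 1"] by (simp add: mult_ac)
  finally show ?thesis .
qed

text \<open>
  Test with \<open>\<phi> = (M - v) \<eta>\<^sup>k\<close>. The increment of \<open>\<phi>\<close> is minus the increment of \<open>v\<close> times the mean of \<open>\<eta>\<^sup>k\<close>, plus the
  mean of \<open>M - v\<close>, which lies between \<open>0\<close> and \<open>2 M\<close>, times the increment of \<open>\<eta>\<^sup>k\<close>; the last term is absorbed. The cutoff is
  \<open>1/R\<close>-Lipschitz, so the remainder is at most \<open>R\<close> to the power \<open>- \<beta>\<close> times the volume of a ball of radius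
  \<open>2 R\<close> times the moment of \<open>K\<close>, and this is bounded for \<open>R \<ge> 1\<close> since the dimension is at most \<open>\<beta>\<close>.
\<close>

lemma caccioppoli:
  assumes dim: "real DIM('a) \<le> \<beta>" and j: "\<beta> - 1 \<le> real j"
  obtains D where "0 \<le> D" and
    "\<And>R. 1 \<le> R \<Longrightarrow> integrable Pm (\<lambda>(x, z). energy x z * average j R x z)" and
    "\<And>R s. 1 \<le> R \<Longrightarrow> 0 < s \<Longrightarrow>
       (LINT p|Pm. (case p of (x, z) \<Rightarrow> energy x z * average j R x z))
       \<le> s * (LINT p|Pm. (case p of (x, z) \<Rightarrow> energy x z * average j R x z * of_bool (cutoff R x \<noteq> cutoff R (x + z))))
         + D * s powr (1 - \<beta>)"
proof -
  let ?n = "DIM('a)"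
  note vb = v_bound and M0 = M_pos and L0 = L_nonneg and vl = v_lip
  define c where "c = C * (4 * M * real (Suc j)) powr \<beta>"
  have c0: "0 \<le> c" using C_pos by (simp add: c_def)
  define D0 where "D0 = 2 * (unit_ball_vol ?n * 2 ^ ?n) * moment"
  have D0: "0 \<le> D0" using moment_nonneg by (simp add: D0_def)
  define f where "f x z = energy x z" for x z
  have f0: "0 \<le> f x z" for x z unfolding f_def by (intro mult_nonneg_nonneg g_mult_nonneg K_nonneg)
  have fm [measurable]: "(\<lambda>(x, z). f x z) \<in> borel_measurable Pm" unfolding f_def by measurable
  define E where "E = C * L powr (\<beta> - 1) * L"
  have E0: "0 \<le> E" using C_pos L0 by (simp add: E_def)
  have fE: "f x z \<le> E * (norm z powr \<beta> * K z)" for x z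
    unfolding f_def E_def using mult_right_mono[OF energy_density_bound[of x z] K_nonneg[of z]] by (simp add: mult_ac)
  define W where "W R x z = (cutoff R x ^ Suc j + cutoff R (x + z) ^ Suc j) / 2" for R and x z :: 'a
  have Wm [measurable]: "(\<lambda>(x, z). W R x z) \<in> borel_measurable Pm" for R unfolding W_def by measurable
  have W0: "0 \<le> W R x z" for R x z unfolding W_def by (simp add: cutoff_range)
  have W_le: "W R x z \<le> indicator (cball 0 (2 * R)) x + indicator (cball 0 (2 * R)) (x + z)" if R: "1 \<le> R" for R x z
  proof -
    have cut: "cutoff R y ^ Suc j \<le> indicator (cball 0 (2 * R)) y" for y :: 'a
      using cutoff_outside[of R y] R power_le_one[OF cutoff_range, of R y "Suc j"]
      by (cases "norm y \<le> 2 * R") (auto simp del: power_Suc)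
    have "a / 2 \<le> b" if "a \<le> b" "0 \<le> b" for a b :: real using that by linarith
    from this[OF add_mono[OF cut cut]] show ?thesis unfolding W_def by simp
  qed
  define N where "N R x z = (of_bool (cutoff R x \<noteq> cutoff R (x + z)) :: real)" for R and x z :: 'a
  have Nm [measurable]: "(\<lambda>(x, z). N R x z) \<in> borel_measurable Pm" for R unfolding N_def by measurable
  have N01: "0 \<le> N R x z" "N R x z \<le> 1" for R x z by (auto simp: N_def)
  have bound: "\<bar>f x z * W R x z * k\<bar> \<le> E * cover (2 * R) x z"
    if "1 \<le> R" "0 \<le> k" "k \<le> 1" for R x z k
  proof -
    have "\<bar>f x z * W R x z * k\<bar> = f x z * (W R x z * k)" using f0[of x z] W0[of R x z] that by simp
    also have "\<dots> \<le> (E * (norm z powr \<beta> * K z)) * ((indicator (cball 0 (2 * R)) x + indicator (cball 0 (2 * R)) (x + z)) * 1)"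
      using that f0 W0[of R x z] W_le[OF that(1), of x z] E0 K_nonneg[of z]
      by (intro mult_mono fE) auto
    finally show ?thesis by (simp add: mult_ac)
  qed
  have iW: "integrable Pm (\<lambda>(x, z). f x z * W R x z)" if "1 \<le> R" for R
  proof (rule pair_integrable)
    show "\<bar>case (x, z) of (x, z) \<Rightarrow> f x z * W R x z\<bar> \<le> E * cover (2 * R) x z" for x z
      using bound[OF that, of 1 x z] by simp
  qed measurable
  have iN: "integrable Pm (\<lambda>(x, z). f x z * W R x z * N R x z)" if "1 \<le> R" for R
  proof (rule pair_integrable)
    show "\<bar>case (x, z) of (x, z) \<Rightarrow> f x z * W R x z * N R x z\<bar> \<le> E * cover (2 * R) x z" for x z
      using bound[OF that N01, of x z] by simp
  qed measurable
  define H where "H R x z = \<bar>cutoff R x - cutoff R (x + z)\<bar> powr \<beta> * K z" for R x z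
  have Hm [measurable]: "(\<lambda>(x, z). H R x z) \<in> borel_measurable Pm" for R unfolding H_def by measurable
  have H0: "0 \<le> H R x z" for R x z by (simp add: H_def K_nonneg)
  have H_le: "H R x z \<le> R powr (- \<beta>) * cover (2 * R) x z"
    if R: "1 \<le> R" for R x z
  proof (cases "norm x \<le> 2 * R \<or> norm (x + z) \<le> 2 * R")
    case True
    have "\<bar>cutoff R x - cutoff R (x + z)\<bar> powr \<beta> \<le> (norm z / R) powr \<beta>"
      using cutoff_lipschitz[of R x "x + z"] R beta_ge_2 by (intro powr_mono2) auto
    also have "\<dots> = R powr (- \<beta>) * norm z powr \<beta>" using R by (simp add: powr_divide powr_minus field_simps)
    finally have "H R x z \<le> R powr (- \<beta>) * norm z powr \<beta> * K z"
      unfolding H_def by (intro mult_right_mono K_nonneg)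
    also have "\<dots> = R powr (- \<beta>) * (1 * (norm z powr \<beta> * K z))" by simp
    also have "\<dots> \<le> R powr (- \<beta>) * cover (2 * R) x z"
      using True by (intro mult_left_mono mult_right_mono) (auto simp: indicator_def K_nonneg)
    finally show ?thesis .
  next
    case False
    then have "cutoff R x = 0" "cutoff R (x + z) = 0" using R by (auto intro: cutoff_outside)
    then have "H R x z = 0" by (simp add: H_def)
    then show ?thesis by (simp add: K_nonneg)
  qed
  have iH: "integrable Pm (\<lambda>(x, z). H R x z)" if "1 \<le> R" for R
  proof (rule pair_integrable)
    show "\<bar>case (x, z) of (x, z) \<Rightarrow> H R x z\<bar> \<le> R powr (- \<beta>) * cover (2 * R) x z" for x z
      using H_le[OF that, of x z] H0[of R x z] by simp
  qed measurable
  have H_int: "(LINT p|Pm. (case p of (x, z) \<Rightarrow> H R x z)) \<le> D0" if R: "1 \<le> R" for R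
  proof -
    have fin: "emeasure lborel (cball 0 (2 * R) :: 'a set) < \<infinity>" by (rule emeasure_bounded_finite) simp
    have cb: "cball (0::'a) (2 * R) \<in> sets borel" by simp
    note pw = pair_weight[OF cb fin]
    have "(LINT p|Pm. (case p of (x, z) \<Rightarrow> H R x z))
       \<le> (LINT p|Pm. R powr (- \<beta>) * (case p of (x, z) \<Rightarrow> cover (2 * R) x z))"
    proof (rule integral_mono)
      show "integrable Pm (\<lambda>p. R powr (- \<beta>) * (case p of (x, z) \<Rightarrow> cover (2 * R) x z))"
        by (intro integrable_mult_right pw(1))
      fix p :: "'a \<times> 'a"
      show "(case p of (x, z) \<Rightarrow> H R x z) \<le> R powr (- \<beta>) * (case p of (x, z) \<Rightarrow> cover (2 * R) x z)"
        unfolding split_beta by (rule H_le[OF R])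
    qed (rule iH[OF R])
    also have "\<dots> = R powr (- \<beta>) * (2 * measure lborel (cball 0 (2 * R) :: 'a set) * moment)"
      unfolding integral_mult_right_zero pw(2) ..
    also have "measure lborel (cball 0 (2 * R) :: 'a set) = unit_ball_vol ?n * (2 * R) ^ ?n"
      using R by (simp add: content_cball)
    also have "R powr (- \<beta>) * (2 * (unit_ball_vol ?n * (2 * R) ^ ?n) * moment) = (R powr (- \<beta>) * R ^ ?n) * D0"
      by (simp add: D0_def power_mult_distrib mult_ac)
    also have "R powr (- \<beta>) * R ^ ?n = R powr (?n - \<beta>)" using R by (simp flip: powr_realpow powr_add)
    also have "R powr (?n - \<beta>) * D0 \<le> R powr 0 * D0" using R dim D0 by (intro mult_right_mono powr_mono) auto
    finally show ?thesis using R by simp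
  qed
  show thesis
  proof (rule that)
    show "0 \<le> c * D0" using c0 D0 by simp
    fix R :: real assume R: "1 \<le> R"
    show "integrable Pm (\<lambda>(x, z). energy x z * average j R x z)"
      using iW[OF R] unfolding f_def W_def .
    fix s :: real assume s: "0 < s"
    define \<phi> where "\<phi> x = (M - v x) * cutoff R x ^ Suc j" for x
    have \<phi>m: "\<phi> \<in> borel_measurable borel" unfolding \<phi>_def[abs_def] by measurable
    have Mv: "0 \<le> M - v x" "M - v x \<le> 2 * M" for x using vb[of x] by (auto simp: abs_le_iff)
    have ck: "0 \<le> cutoff R x ^ Suc j" "cutoff R x ^ Suc j \<le> 1" for x :: 'a
      by (simp_all add: cutoff_range power_le_one del: power_Suc)
    have \<phi>0: "0 \<le> \<phi> x" "\<phi> x \<le> 2 * M" for x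
    proof -
      show "0 \<le> \<phi> x" unfolding \<phi>_def by (intro mult_nonneg_nonneg Mv ck)
      have "\<phi> x \<le> 2 * M * 1" unfolding \<phi>_def using M0 by (intro mult_mono Mv ck) auto
      then show "\<phi> x \<le> 2 * M" by simp
    qed
    have \<phi>l: "\<bar>\<phi> x - \<phi> y\<bar> \<le> (L + 2 * M * real (Suc j)) * norm (x - y)" for x y
    proof -
      have "\<phi> x - \<phi> y = (v y - v x) * cutoff R x ^ Suc j + (M - v y) * (cutoff R x ^ Suc j - cutoff R y ^ Suc j)"
        unfolding \<phi>_def by (simp add: algebra_simps del: power_Suc)
      also have "\<bar>\<dots>\<bar> \<le> \<bar>v y - v x\<bar> * cutoff R x ^ Suc j + (M - v y) * \<bar>cutoff R x ^ Suc j - cutoff R y ^ Suc j\<bar>"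
        using abs_triangle_ineq[of "(v y - v x) * cutoff R x ^ Suc j" "(M - v y) * (cutoff R x ^ Suc j - cutoff R y ^ Suc j)"]
          Mv[of y] ck[of x] by (simp add: abs_mult del: power_Suc)
      also have "\<dots> \<le> (L * norm (x - y)) * 1 + (2 * M) * (real (Suc j) * norm (x - y))"
      proof (intro add_mono mult_mono)
        show "\<bar>v y - v x\<bar> \<le> L * norm (x - y)" using vl[of y x] by (simp add: norm_minus_commute)
        have "\<bar>cutoff R x ^ Suc j - cutoff R y ^ Suc j\<bar> \<le> real (Suc j) * \<bar>cutoff R x - cutoff R y\<bar>"
          by (intro power_lipschitz cutoff_range)
        also have "\<dots> \<le> real (Suc j) * norm (x - y)"
        proof (intro mult_left_mono)
          have "\<bar>cutoff R x - cutoff R y\<bar> \<le> norm (x - y) / R" using R by (intro cutoff_lipschitz) simp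
          also have "\<dots> \<le> norm (x - y) / 1" using R by (intro divide_left_mono) auto
          finally show "\<bar>cutoff R x - cutoff R y\<bar> \<le> norm (x - y)" by simp
        qed simp
        finally show "\<bar>cutoff R x ^ Suc j - cutoff R y ^ Suc j\<bar> \<le> real (Suc j) * norm (x - y)" .
      qed (use L0 M0 ck[of x] Mv[of y] in \<open>auto simp del: power_Suc\<close>)
      finally show ?thesis by (simp add: algebra_simps)
    qed
    have \<phi>s: "\<phi> x = 0" if "2 * R < norm x" for x
      using cutoff_outside[of R x] that R by (simp add: \<phi>_def)
    have Lp: "0 \<le> L + 2 * M * real (Suc j)" using L0 M0 by simp
    note ws = weak_supersolution[OF \<phi>m \<phi>0 Lp \<phi>l \<phi>s]
    let ?\<Phi> = "\<lambda>p. case p of (x, z) \<Rightarrow> g (v x - v (x + z)) * (\<phi> x - \<phi> (x + z)) * K z"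
    let ?fW = "\<lambda>p. case p of (x, z) \<Rightarrow> f x z * W R x z"
    let ?fN = "\<lambda>p. case p of (x, z) \<Rightarrow> f x z * W R x z * N R x z"
    let ?H = "\<lambda>p. case p of (x, z) \<Rightarrow> H R x z"
    have pw: "f x z * W R x z \<le> s * (f x z * W R x z * N R x z) + (c * s powr (1 - \<beta>)) * H R x z
         - g (v x - v (x + z)) * (\<phi> x - \<phi> (x + z)) * K z" for x z
    proof -
      define d where "d = v x - v (x + z)"
      define p where "p = cutoff R x"
      define q where "q = cutoff R (x + z)"
      define m where "m = M - (v x + v (x + z)) / 2"
      have m: "0 \<le> m" "m \<le> 2 * M" 
      proof -
        have "0 \<le> M - (a + b) / 2 \<and> M - (a + b) / 2 \<le> 2 * M"
          if "0 \<le> M - a" "M - a \<le> 2 * M" "0 \<le> M - b" "M - b \<le> 2 * M" for a b :: real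
          using that by (simp add: field_simps)
        from this[OF Mv Mv] show "0 \<le> m" "m \<le> 2 * M" unfolding m_def by blast+
      qed
      have id: "g d * d * W R x z = g d * (m * (p ^ Suc j - q ^ Suc j)) - g d * (\<phi> x - \<phi> (x + z))"
        unfolding W_def \<phi>_def p_def[symmetric] q_def[symmetric] m_def d_def by (simp add: field_simps del: power_Suc)
      have "\<bar>g d * (m * (p ^ Suc j - q ^ Suc j))\<bar>
         \<le> s * (g d * d) * ((p ^ Suc j + q ^ Suc j) / 2) * of_bool (p \<noteq> q)
            + C * (4 * M * real (Suc j)) powr \<beta> * s powr (1 - \<beta>) * \<bar>p - q\<bar> powr \<beta>"
        unfolding p_def q_def by (intro absorption cutoff_range s M0 j m)
      also have "s * (g d * d) * ((p ^ Suc j + q ^ Suc j) / 2) * of_bool (p \<noteq> q) = s * (g d * d) * W R x z * N R x z"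
        unfolding W_def N_def p_def q_def ..
      finally have "g d * (m * (p ^ Suc j - q ^ Suc j))
          \<le> s * (g d * d) * W R x z * N R x z + c * s powr (1 - \<beta>) * \<bar>p - q\<bar> powr \<beta>"
        unfolding c_def by (rule order_trans[OF abs_ge_self])
      then have "g d * d * W R x z \<le> s * (g d * d) * W R x z * N R x z + c * s powr (1 - \<beta>) * \<bar>p - q\<bar> powr \<beta>
            - g d * (\<phi> x - \<phi> (x + z))"
        unfolding id by (rule diff_right_mono)
      then have "(g d * d * W R x z) * K z \<le> (s * (g d * d) * W R x z * N R x z + c * s powr (1 - \<beta>) * \<bar>p - q\<bar> powr \<beta>
            - g d * (\<phi> x - \<phi> (x + z))) * K z"
        by (intro mult_right_mono K_nonneg)
      then show ?thesis
        unfolding f_def H_def d_def[symmetric] p_def[symmetric] q_def[symmetric] by (simp add: algebra_simps)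
    qed
    have "(LINT p|Pm. ?fW p) \<le> (LINT p|Pm. s * ?fN p + (c * s powr (1 - \<beta>)) * ?H p - ?\<Phi> p)"
    proof (rule integral_mono)
      show "integrable Pm ?fW" by (rule iW[OF R])
      show "integrable Pm (\<lambda>p. s * ?fN p + (c * s powr (1 - \<beta>)) * ?H p - ?\<Phi> p)"
        by (intro Bochner_Integration.integrable_add Bochner_Integration.integrable_diff integrable_mult_right iN[OF R] iH[OF R] ws(1))
      fix p :: "'a \<times> 'a"
      show "?fW p \<le> s * ?fN p + (c * s powr (1 - \<beta>)) * ?H p - ?\<Phi> p"
        unfolding split_beta by (rule pw)
    qed
    also have "\<dots> = s * (LINT p|Pm. ?fN p) + (c * s powr (1 - \<beta>)) * (LINT p|Pm. ?H p) - (LINT p|Pm. ?\<Phi> p)"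
      by (rule integral_linear_combination[OF iN[OF R] iH[OF R] ws(1)])
    also have "\<dots> \<le> s * (LINT p|Pm. ?fN p) + (c * s powr (1 - \<beta>)) * D0"
    proof -
      have "X + Y - Z \<le> X + Y'" if "Y \<le> Y'" "0 \<le> Z" for X Y Y' Z :: real using that by linarith
      then show ?thesis
      proof this
        show "(c * s powr (1 - \<beta>)) * (LINT p|Pm. ?H p) \<le> (c * s powr (1 - \<beta>)) * D0"
          using c0 by (intro mult_left_mono H_int[OF R]) auto
      qed (rule ws(2))
    qed
    finally show "(LINT p|Pm. (case p of (x, z) \<Rightarrow> energy x z * average j R x z))
       \<le> s * (LINT p|Pm. (case p of (x, z) \<Rightarrow> energy x z * average j R x z * of_bool (cutoff R x \<noteq> cutoff R (x + z))))
         + c * D0 * s powr (1 - \<beta>)"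
      unfolding f_def W_def N_def by (simp only: mult_ac)
  qed
qed

text \<open>
  Taking \<open>s = 1/2\<close> bounds the energy in every ball, hence the total energy. The energy of the pairs at which the cutoff
  differs then tends to \<open>0\<close> as the radius grows, and the inequality that remains, valid for all \<open>s\<close>, forces the energy to vanish.
\<close>

lemma energy_vanishes:
  assumes dim: "real DIM('a) \<le> \<beta>"
  shows "AE p in Pm. (case p of (x, z) \<Rightarrow> energy x z) = 0"
proof -
  define f where "f p = (case p of (x, z) \<Rightarrow> energy x z)" for p
  have f0: "0 \<le> f p" for p unfolding f_def split_beta by (intro mult_nonneg_nonneg g_mult_nonneg K_nonneg)
  have fm [measurable]: "f \<in> borel_measurable Pm" unfolding f_def[abs_def] by measurable
  define j where "j = nat \<lceil>\<beta>\<rceil>"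
  have j: "\<beta> - 1 \<le> real j" unfolding j_def using beta_ge_2 by linarith
  define W where "W i p = (case p of (x, z) \<Rightarrow> (cutoff (real (Suc i)) x ^ Suc j + cutoff (real (Suc i)) (x + z) ^ Suc j) / 2)" for i and p :: "'a \<times> 'a"
  define N where "N i p = (case p of (x, z) \<Rightarrow> (of_bool (cutoff (real (Suc i)) x \<noteq> cutoff (real (Suc i)) (x + z)) :: real))" for i and p :: "'a \<times> 'a"
  have Wm [measurable]: "W i \<in> borel_measurable Pm" for i unfolding W_def[abs_def] by measurable
  have Nm [measurable]: "N i \<in> borel_measurable Pm" for i unfolding N_def[abs_def] by measurable
  obtain D where D: "0 \<le> D" "\<And>i. integrable Pm (\<lambda>p. f p * W i p)"
    "\<And>i s. 0 < s \<Longrightarrow> (LINT p|Pm. f p * W i p) \<le> s * (LINT p|Pm. f p * W i p * N i p) + D * s powr (1 - \<beta>)"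
  proof -
    obtain D where D: "0 \<le> D"
      "\<And>R. 1 \<le> R \<Longrightarrow> integrable Pm (\<lambda>(x, z). energy x z * average j R x z)"
      "\<And>R s. 1 \<le> R \<Longrightarrow> 0 < s \<Longrightarrow>
       (LINT p|Pm. (case p of (x, z) \<Rightarrow> energy x z * average j R x z))
       \<le> s * (LINT p|Pm. (case p of (x, z) \<Rightarrow> energy x z * average j R x z * of_bool (cutoff R x \<noteq> cutoff R (x + z))))
         + D * s powr (1 - \<beta>)"
      by (rule caccioppoli[OF dim j]) (rule that; assumption)
    show thesis
    proof (rule that[OF D(1)])
      fix i
      have R: "1 \<le> real (Suc i)" by simp
      show "integrable Pm (\<lambda>p. f p * W i p)"
        using D(2)[OF R] unfolding f_def W_def split_beta .
      fix s :: real assume "0 < s"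
      from D(3)[OF R this]
      show "(LINT p|Pm. f p * W i p) \<le> s * (LINT p|Pm. f p * W i p * N i p) + D * s powr (1 - \<beta>)"
        unfolding f_def W_def N_def split_beta .
    qed
  qed
  have W01: "0 \<le> W i p" "W i p \<le> 1" for i p
  proof -
    have "0 \<le> cutoff (real (Suc i)) x ^ Suc j" "cutoff (real (Suc i)) x ^ Suc j \<le> 1" for x :: 'a
      by (simp_all add: cutoff_range power_le_one del: power_Suc)
    note cut = this
    have "0 \<le> (a + b) / 2 \<and> (a + b) / 2 \<le> 1" if "0 \<le> a" "a \<le> 1" "0 \<le> b" "b \<le> 1" for a b :: real
      using that by simp
    from this[OF cut cut] show "0 \<le> W i p" "W i p \<le> 1" unfolding W_def split_beta by blast+
  qed
  have N01: "0 \<le> N i p" "N i p \<le> 1" for i p by (auto simp: N_def split_beta)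
  have ev1: "\<forall>\<^sub>F i in sequentially. cutoff (real (Suc i)) x = 1" for x :: 'a
  proof -
    obtain i0 :: nat where "norm x \<le> real i0" using real_arch_simple by blast
    then have "cutoff (real (Suc i)) x = 1" if "i0 \<le> i" for i using that by (intro cutoff_inside) auto
    then show ?thesis unfolding eventually_sequentially by blast
  qed
  have W_lim: "(\<lambda>i. W i p) \<longlonglongrightarrow> 1" and N_lim: "(\<lambda>i. N i p) \<longlonglongrightarrow> 0" for p
  proof -
    have "\<forall>\<^sub>F i in sequentially. W i p = 1 \<and> N i p = 0"
      using ev1[of "fst p"] ev1[of "fst p + snd p"]
      by eventually_elim (simp add: W_def N_def split_beta)
    then have "\<forall>\<^sub>F i in sequentially. W i p = 1" "\<forall>\<^sub>F i in sequentially. N i p = 0"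
      by (auto elim: eventually_mono)
    then show "(\<lambda>i. W i p) \<longlonglongrightarrow> 1" "(\<lambda>i. N i p) \<longlonglongrightarrow> 0" by (auto intro: tendsto_eventually)
  qed
  define B where "B = 2 * (D * (1 / 2) powr (1 - \<beta>))"
  have B: "(LINT p|Pm. f p * W i p) \<le> B" for i
  proof -
    have "(LINT p|Pm. f p * W i p * N i p) \<le> (LINT p|Pm. f p * W i p)"
    proof (rule integral_mono')
      show "integrable Pm (\<lambda>p. f p * W i p)" by (rule D(2))
      show "f p * W i p * N i p \<le> f p * W i p" for p
        using N01[of i p] f0[of p] W01[of i p] by (intro mult_left_le mult_nonneg_nonneg) auto
      show "0 \<le> f p * W i p" for p using f0[of p] W01[of i p] by simp
    qed
    then show ?thesis using D(3)[of "1 / 2" i] by (simp add: B_def)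
  qed
  have nn: "(\<integral>\<^sup>+p. ennreal (f p) \<partial>Pm) \<le> ennreal B"
  proof (rule nn_integral_limit_le[where F = "\<lambda>i p. ennreal (f p * W i p)"])
    show "(\<lambda>i. ennreal (f p * W i p)) \<longlonglongrightarrow> ennreal (f p)" for p
    proof -
      have "(\<lambda>i. f p * W i p) \<longlonglongrightarrow> f p * 1" by (intro tendsto_mult tendsto_const W_lim)
      then show ?thesis by (intro tendsto_ennrealI) simp
    qed
    show "(\<integral>\<^sup>+p. ennreal (f p * W i p) \<partial>Pm) \<le> ennreal B" for i
      using B[of i] f0 W01 by (subst nn_integral_eq_integral[OF D(2)]) (auto intro: ennreal_leI)
  qed measurable
  then have "(\<integral>\<^sup>+p. ennreal (f p) \<partial>Pm) < \<infinity>" by (rule le_less_trans) simp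
  then have fi: "integrable Pm f" using f0 by (intro integrableI_nonneg) auto
  have l1: "(\<lambda>i. LINT p|Pm. f p * W i p) \<longlonglongrightarrow> (LINT p|Pm. f p)"
  proof (rule integral_dominated_convergence[where w = f])
    show "AE p in Pm. (\<lambda>i. f p * W i p) \<longlonglongrightarrow> f p"
    proof (rule AE_I2)
      fix p
      have "(\<lambda>i. f p * W i p) \<longlonglongrightarrow> f p * 1" by (intro tendsto_mult tendsto_const W_lim)
      then show "(\<lambda>i. f p * W i p) \<longlonglongrightarrow> f p" by simp
    qed
    show "AE p in Pm. norm (f p * W i p) \<le> f p" for i
    proof (rule AE_I2)
      fix p
      show "norm (f p * W i p) \<le> f p" using f0[of p] W01[of i p] by (simp add: mult_left_le)
    qed
  qed (use fi in measurable)
  have l2: "(\<lambda>i. LINT p|Pm. f p * W i p * N i p) \<longlonglongrightarrow> (LINT p|(Pm). (0::real))"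
  proof (rule integral_dominated_convergence[where w = f])
    show "AE p in Pm. (\<lambda>i. f p * W i p * N i p) \<longlonglongrightarrow> 0"
    proof (rule AE_I2)
      fix p
      have "(\<lambda>i. f p * W i p * N i p) \<longlonglongrightarrow> f p * 1 * 0" by (intro tendsto_mult tendsto_const W_lim N_lim)
      then show "(\<lambda>i. f p * W i p * N i p) \<longlonglongrightarrow> 0" by simp
    qed
    show "AE p in Pm. norm (f p * W i p * N i p) \<le> f p" for i
    proof (rule AE_I2)
      fix p
      have "f p * W i p * N i p \<le> f p * 1 * 1" using f0[of p] W01[of i p] N01[of i p] by (intro mult_mono) auto
      then show "norm (f p * W i p * N i p) \<le> f p" using f0[of p] W01[of i p] N01[of i p] by simp
    qed
  qed (use fi in measurable)
  have le: "(LINT p|Pm. f p) \<le> D * s powr (1 - \<beta>)" if s: "0 < s" for s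
  proof -
    have "(\<lambda>i. s * (LINT p|Pm. f p * W i p * N i p) + D * s powr (1 - \<beta>)) \<longlonglongrightarrow> s * (LINT p|(Pm). (0::real)) + D * s powr (1 - \<beta>)"
      by (intro tendsto_add tendsto_mult tendsto_const l2)
    then have "(LINT p|Pm. f p) \<le> s * (LINT p|(Pm). (0::real)) + D * s powr (1 - \<beta>)"
      by (rule LIMSEQ_le[OF l1]) (intro exI allI impI D(3)[OF s])
    then show ?thesis by simp
  qed
  have "(LINT p|Pm. f p) \<le> 0"
  proof (rule ccontr)
    assume "\<not> ?thesis"
    then have I: "0 < (LINT p|Pm. f p)" by simp
    \<comment> \<open>As \<open>\<beta> \<ge> 2\<close>, the right side of \<open>le\<close> is at most \<open>D / s\<close> for \<open>s \<ge> 1\<close>.\<close>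
    define s where "s = max 1 ((D + 1) / (LINT p|Pm. f p))"
    have s: "1 \<le> s" "D + 1 \<le> s * (LINT p|Pm. f p)" using I by (auto simp: s_def max_def field_simps)
    have "s powr (1 - \<beta>) \<le> s powr (- 1)" using s(1) beta_ge_2 by (intro powr_mono) auto
    also have "\<dots> = 1 / s" using s(1) by (simp add: powr_minus_divide)
    finally have "D * s powr (1 - \<beta>) \<le> D * (1 / s)" using D(1) by (intro mult_left_mono)
    with le[of s] s(1) have "(LINT p|Pm. f p) \<le> D / s" by simp
    then have "s * (LINT p|Pm. f p) \<le> D" using s(1) by (simp add: field_simps)
    with s(2) show False by simp
  qed
  moreover have "0 \<le> (LINT p|Pm. f p)" by (intro Bochner_Integration.integral_nonneg f0)
  ultimately have "(LINT p|Pm. f p) = 0" by simp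
  then have "AE p in Pm. f p = 0"
    using integral_nonneg_eq_0_iff_AE[OF fi] f0 by simp
  then show ?thesis unfolding f_def .
qed

text \<open>
  Where \<open>K > 0\<close>, vanishing energy density means \<open>v (x + z) = v x\<close>; this covers almost all \<open>x\<close> and almost all small \<open>z\<close>,
  and by continuity all of them.
\<close>

lemma supersolution_constant:
  assumes dim: "real DIM('a) \<le> \<beta>"
  shows "v x = v y"
proof -
  have cv: "continuous_on UNIV v" by (rule v_cont)
  have "AE p in Pm. norm (snd p) < \<rho> \<longrightarrow> v (fst p + snd p) = v (fst p)"
    using energy_vanishes[OF dim]
  proof eventually_elim
    case (elim p)
    show ?case
    proof
      assume z: "norm (snd p) < \<rho>"
      show "v (fst p + snd p) = v (fst p)"
      proof (cases "snd p = 0")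
        case False
        have "0 < lam * norm (snd p) powr (- \<alpha> - DIM('a))" using lam_pos False by simp
        also have "\<dots> \<le> K (snd p)" using False z by (intro K_lower) auto
        finally have "0 < K (snd p)" .
        then have eq: "g (v (fst p) - v (fst p + snd p)) * (v (fst p) - v (fst p + snd p)) = 0"
          using elim by (simp add: split_beta)
        have "v (fst p) - v (fst p + snd p) = 0"
        proof (rule ccontr)
          assume "v (fst p) - v (fst p + snd p) \<noteq> 0"
          from g_mult_pos[OF this] eq show False by simp
        qed
        then show ?thesis by simp
      qed simp
    qed
  qed
  from lborel_pair.AE_pair[OF this]
  have AE2: "AE x in lborel. AE z in lborel. norm z < \<rho> \<longrightarrow> v (x + z) = v x" by simp
  have "AE x in lborel. \<forall>z. norm z < \<rho> \<longrightarrow> v (x + z) = v x"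
    using AE2
  proof eventually_elim
    case (elim x)
    have c1: "continuous_on UNIV (\<lambda>z. v (x + z))"
      by (rule continuous_on_compose2[OF cv]) (auto intro!: continuous_intros)
    have "open {z. norm z < \<rho> \<and> v (x + z) \<noteq> v x}"
      by (intro open_Collect_conj open_Collect_less open_Collect_neq continuous_intros c1)
    then have "open {z. \<not> (norm z < \<rho> \<longrightarrow> v (x + z) = v x)}" by simp
    from AE_open_everywhere[OF elim this] show ?case by blast
  qed
  moreover have "open {x. \<not> (\<forall>z. norm z < \<rho> \<longrightarrow> v (x + z) = v x)}"
  proof -
    have "open {x. v (x + z) \<noteq> v x}" for z
    proof (intro open_Collect_neq)
      show "continuous_on UNIV (\<lambda>x. v (x + z))"
        by (rule continuous_on_compose2[OF cv]) (auto intro!: continuous_intros)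
    qed (rule cv)
    then have "open (\<Union>z\<in>{z. norm z < \<rho>}. {x. v (x + z) \<noteq> v x})" by blast
    moreover have "(\<Union>z\<in>{z. norm z < \<rho>}. {x. v (x + z) \<noteq> v x}) = {x. \<not> (\<forall>z. norm z < \<rho> \<longrightarrow> v (x + z) = v x)}"
      by auto
    ultimately show ?thesis by simp
  qed
  ultimately have "\<forall>z. norm z < \<rho> \<longrightarrow> v (x + z) = v x" for x by (rule AE_open_everywhere)
  then have "v (x + z) = v x" if "norm z < \<rho>" for x z using that by blast
  then show ?thesis by (rule locally_constant_uniform[OF rho_pos])
qed

end

section \<open>Regularisation by inf-convolution\<close>

context nonlocal_operator
begin

text \<open>
  Let \<open>Y x\<close> be a point where the infimum of \<open>w y + b \<bar>x - y\<bar>\<^sup>2\<close> is attained. Using \<open>Y x\<close> as a competitor at \<open>x + z\<close> gives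
  the touching parabola, and hence the Lipschitz bound; using \<open>Y x + z\<close> gives \<open>v x - v (x + z) \<ge> w (Y x) - w (Y x + z)\<close>, so
  that \<open>v\<close> inherits the inequality satisfied by \<open>w\<close> at \<open>Y x\<close>.
\<close>

lemma inf_convolution:
  fixes w :: "'a \<Rightarrow> real"
  assumes w: "continuous_on UNIV w" "\<And>x. \<bar>w x\<bar> \<le> M" "0 < M"
    and super: "\<And>x \<delta>. 0 < \<delta> \<Longrightarrow> \<forall>\<^sub>F \<epsilon> in at_right 0. - \<delta> \<le> trunc \<epsilon> (w x) w x"
    and b: "0 < b"
  obtains v L A where "semiconcave_supersolution g \<beta> C K \<alpha> lam Lam \<rho> v M L A b" "\<And>x. v x \<le> w x"
    "\<And>x. \<exists>y. w y \<le> v x \<and> b * (norm (x - y))\<^sup>2 \<le> 2 * M"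
proof -
  have wb: "w \<in> borel_measurable borel" using w(1) by (rule borel_measurable_continuous_onI)
  \<comment> \<open>Beyond the distance \<open>r\<close> the penalty exceeds the oscillation of \<open>w\<close>, so the infimum is attained in a ball.\<close>
  define r where "r = 2 * M / b + 1"
  have r: "1 \<le> r" "2 * M < b * r" using w(3) b by (auto simp: r_def field_simps)
  have "\<exists>y. \<forall>y'. w y + b * (norm (x - y))\<^sup>2 \<le> w y' + b * (norm (x - y'))\<^sup>2" for x
  proof -
    have "continuous_on (cball x r) (\<lambda>y. w y + b * (norm (x - y))\<^sup>2)"
      using continuous_on_subset[OF w(1)] by (intro continuous_intros) auto
    then have "\<exists>y\<in>cball x r. \<forall>y'\<in>cball x r. w y + b * (norm (x - y))\<^sup>2 \<le> w y' + b * (norm (x - y'))\<^sup>2"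
      using r by (intro continuous_attains_inf) auto
    then obtain y where y0: "\<forall>y'\<in>cball x r. w y + b * (norm (x - y))\<^sup>2 \<le> w y' + b * (norm (x - y'))\<^sup>2" by blast
    have y: "w y + b * (norm (x - y))\<^sup>2 \<le> w y' + b * (norm (x - y'))\<^sup>2" if "norm (x - y') \<le> r" for y'
      using that by (intro bspec[OF y0]) (simp add: dist_norm)
    have "w y + b * (norm (x - y))\<^sup>2 \<le> w y' + b * (norm (x - y'))\<^sup>2" for y'
    proof (cases "norm (x - y') \<le> r")
      case False
      have "b * r \<le> b * r\<^sup>2" using b r by (intro mult_left_mono) (auto simp: power2_eq_square)
      also have "\<dots> \<le> b * (norm (x - y'))\<^sup>2" using False b r by (intro mult_left_mono power_mono) auto
      finally have "2 * M < b * (norm (x - y'))\<^sup>2" using r(2) by linarith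
      moreover have "w y + b * (norm (x - y))\<^sup>2 \<le> w x" using y[of x] r by simp
      ultimately show ?thesis using w(2)[of x] w(2)[of y'] by (auto simp: abs_le_iff)
    qed (rule y)
    then show ?thesis by blast
  qed
  then obtain Y where Y: "\<And>x y'. w (Y x) + b * (norm (x - Y x))\<^sup>2 \<le> w y' + b * (norm (x - y'))\<^sup>2" by metis
  define v where "v x = w (Y x) + b * (norm (x - Y x))\<^sup>2" for x
  have v_le: "v x \<le> w y + b * (norm (x - y))\<^sup>2" for x y unfolding v_def by (rule Y)
  have vw: "v x \<le> w x" for x using v_le[of x x] by simp
  have nn: "0 \<le> b * (norm (x - Y x))\<^sup>2" for x using b by simp
  have wv: "w (Y x) \<le> v x" for x using nn[of x] by (simp add: v_def)
  have vM: "\<bar>v x\<bar> \<le> M" for x using vw[of x] wv[of x] w(2)[of x] w(2)[of "Y x"] by (auto simp: abs_le_iff)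
  have dist: "b * (norm (x - Y x))\<^sup>2 \<le> 2 * M" for x
    using vw[of x] w(2)[of x] w(2)[of "Y x"] by (auto simp: v_def abs_le_iff)
  have Yr: "norm (x - Y x) \<le> r" for x
  proof (rule ccontr)
    assume "\<not> ?thesis"
    then have "b * r\<^sup>2 \<le> b * (norm (x - Y x))\<^sup>2" using b r by (intro mult_left_mono power_mono) auto
    moreover have "b * r \<le> b * r\<^sup>2" using b r by (intro mult_left_mono) (auto simp: power2_eq_square)
    ultimately show False using dist[of x] r(2) by linarith
  qed
  define A where "A = 2 * b * r"
  have A0: "0 \<le> A" using b r by (simp add: A_def)
  have touch: "(- (2 * b)) *\<^sub>R (x - Y x) \<bullet> z - b * (norm z)\<^sup>2 \<le> v x - v (x + z)" for x z
  proof -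
    have "v (x + z) \<le> w (Y x) + b * (norm (x + z - Y x))\<^sup>2" by (rule v_le)
    also have "(norm (x + z - Y x))\<^sup>2 = (norm (x - Y x))\<^sup>2 + 2 * ((x - Y x) \<bullet> z) + (norm z)\<^sup>2"
      unfolding power2_norm_eq_inner by (simp add: algebra_simps inner_commute)
    finally show ?thesis by (simp add: v_def algebra_simps)
  qed
  have aA: "norm ((- (2 * b)) *\<^sub>R (x - Y x)) \<le> A" for x
    using Yr[of x] b by (simp add: A_def)
  define L where "L = A + b + 2 * M"
  have L0: "0 \<le> L" using A0 b w(3) by (simp add: L_def)
  have one: "v y - v x \<le> L * norm (x - y)" for x y
  proof (cases "norm (x - y) \<le> 1")
    case True
    let ?z = "y - x"
    have z: "norm ?z = norm (x - y)" by (rule norm_minus_commute)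
    have "v y - v x \<le> - ((- (2 * b)) *\<^sub>R (x - Y x) \<bullet> ?z) + b * (norm ?z)\<^sup>2" using touch[of x ?z] by simp
    also have "- ((- (2 * b)) *\<^sub>R (x - Y x) \<bullet> ?z) \<le> norm ((- (2 * b)) *\<^sub>R (x - Y x)) * norm ?z"
      using Cauchy_Schwarz_ineq2[of "(- (2 * b)) *\<^sub>R (x - Y x)" ?z] by linarith
    also have "\<dots> \<le> A * norm ?z" using aA by (intro mult_right_mono) auto
    finally have "v y - v x \<le> A * norm (x - y) + b * (norm (x - y))\<^sup>2" unfolding z by simp
    also have "b * (norm (x - y))\<^sup>2 \<le> b * norm (x - y)"
      using True b by (intro mult_left_mono) (auto simp: power2_eq_square mult_left_le)
    also have "A * norm (x - y) + b * norm (x - y) \<le> L * norm (x - y)"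
      using w(3) by (simp add: L_def distrib_right)
    finally show ?thesis by simp
  next
    case False
    have "v y - v x \<le> 2 * M * 1" using vM[of x] vM[of y] by (auto simp: abs_le_iff)
    also have "\<dots> \<le> L * norm (x - y)" using False A0 b w(3) by (intro mult_mono) (auto simp: L_def)
    finally show ?thesis .
  qed
  have lip: "\<bar>v x - v y\<bar> \<le> L * norm (x - y)" for x y
    using one[of x y] one[of y x] by (auto simp: abs_le_iff norm_minus_commute)
  have "continuous_on UNIV v" by (rule lipschitz_bound_continuous[OF L0 lip])
  then have vb: "v \<in> borel_measurable borel" by (rule borel_measurable_continuous_onI)
  have tr: "trunc \<epsilon> (w (Y x)) w (Y x) \<le> trunc \<epsilon> (v x) v x" if e: "0 < \<epsilon>" for \<epsilon> x
    unfolding trunc_def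
  proof (rule integral_mono)
    show "integrable lborel (\<lambda>z. g (w (Y x) - w (Y x + z)) * Kt \<epsilon> z)" by (rule trunc_integrable[OF wb w(2) e])
    show "integrable lborel (\<lambda>z. g (v x - v (x + z)) * Kt \<epsilon> z)" by (rule trunc_integrable[OF vb vM e])
    fix z
    have "v (x + z) \<le> w (Y x + z) + b * (norm (x + z - (Y x + z)))\<^sup>2" by (rule v_le)
    then have "w (Y x) - w (Y x + z) \<le> v x - v (x + z)" by (simp add: v_def)
    then show "g (w (Y x) - w (Y x + z)) * Kt \<epsilon> z \<le> g (v x - v (x + z)) * Kt \<epsilon> z"
      by (intro mult_right_mono g_mono Kt_nonneg)
  qed
  have vs: "\<forall>\<^sub>F \<epsilon> in at_right 0. - \<delta> \<le> trunc \<epsilon> (v x) v x" if "0 < \<delta>" for \<delta> x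
    using super[OF that, of "Y x"] eventually_at_right_less[of 0]
    by eventually_elim (use tr in \<open>force intro: order_trans\<close>)
  have "semiconcave_supersolution g \<beta> C K \<alpha> lam Lam \<rho> v M L A b"
  proof unfold_locales
    show "\<exists>a. norm a \<le> A \<and> (\<forall>z. a \<bullet> z - b * (norm z)\<^sup>2 \<le> v x - v (x + z))" for x
      by (intro exI[of _ "(- (2 * b)) *\<^sub>R (x - Y x)"] conjI allI aA touch)
    show "0 \<le> b" using b by simp
  qed (rule vM w(3) L0 A0 lip vs, assumption?)+
  then show thesis
  proof (rule that)
    show "v x \<le> w x" for x by (rule vw)
    show "\<exists>y. w y \<le> v x \<and> b * (norm (x - y))\<^sup>2 \<le> 2 * M" for x using wv[of x] dist[of x] by blast
  qed
qed

text \<open>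
  The inf-convolutions are constant, lie below \<open>w\<close>, and for large \<open>b\<close> are at each point no smaller than some nearby value of \<open>w\<close>.
\<close>

theorem bounded_supersolution_constant:
  fixes w :: "'a \<Rightarrow> real"
  assumes dim: "real DIM('a) \<le> \<beta>"
    and w: "continuous_on UNIV w" "\<And>x. \<bar>w x\<bar> \<le> M"
    and super: "\<And>x \<delta>. 0 < \<delta> \<Longrightarrow> \<forall>\<^sub>F \<epsilon> in at_right 0. - \<delta> \<le> trunc \<epsilon> (w x) w x"
  shows "w x = w y"
proof -
  have M1: "\<bar>w x\<bar> \<le> \<bar>M\<bar> + 1" for x using w(2)[of x] by linarith
  have Mp: "0 < \<bar>M\<bar> + 1" by simp
  have le: "w x \<le> w y" for x y
  proof (rule field_le_epsilon)
    fix \<kappa> :: real assume k: "0 < \<kappa>"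
    obtain d where d: "0 < d" "\<And>x'. dist x' x < d \<Longrightarrow> dist (w x') (w x) < \<kappa>"
      using w(1)[unfolded continuous_on_iff, rule_format, OF UNIV_I k, of x] by blast
    \<comment> \<open>With this \<open>b\<close> the infimum at \<open>x\<close> is attained at a point closer to \<open>x\<close> than \<open>d\<close>.\<close>
    define b where "b = (2 * (\<bar>M\<bar> + 1) + 1) / d\<^sup>2"
    have b: "0 < b" using d by (simp add: b_def)
    obtain v L A where v: "semiconcave_supersolution g \<beta> C K \<alpha> lam Lam \<rho> v (\<bar>M\<bar> + 1) L A b" "\<And>x. v x \<le> w x"
      "\<And>x. \<exists>y. w y \<le> v x \<and> b * (norm (x - y))\<^sup>2 \<le> 2 * (\<bar>M\<bar> + 1)"
      using inf_convolution[OF w(1) M1 Mp super b] by blast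
    obtain x' where x': "w x' \<le> v x" "b * (norm (x - x'))\<^sup>2 \<le> 2 * (\<bar>M\<bar> + 1)" using v(3) by blast
    have "norm (x - x') < d"
    proof (rule ccontr)
      assume "\<not> ?thesis"
      then have "b * d\<^sup>2 \<le> b * (norm (x - x'))\<^sup>2" using b d by (intro mult_left_mono power_mono) auto
      moreover have "b * d\<^sup>2 = 2 * (\<bar>M\<bar> + 1) + 1" using d by (simp add: b_def)
      ultimately show False using x'(2) by linarith
    qed
    then have "dist (w x') (w x) < \<kappa>" by (intro d(2)) (simp add: dist_norm norm_minus_commute)
    then have "w x \<le> w x' + \<kappa>" by (simp add: dist_real_def)
    also have "w x' \<le> v x" by (rule x')
    also have "v x = v y" by (rule semiconcave_supersolution.supersolution_constant[OF v(1) dim])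
    also have "v y \<le> w y" by (rule v(2))
    finally show "w x \<le> w y + \<kappa>" by simp
  qed
  show ?thesis using le[of x y] le[of y x] by simp
qed

text \<open>
  Truncating at \<open>0\<close> preserves supersolutions: where \<open>u < 0\<close> the truncation only raises the difference of the values,
  and elsewhere the truncated function is at its maximum.
\<close>

lemma negative_part_constant:
  fixes u :: "'a \<Rightarrow> real"
  assumes dim: "real DIM('a) \<le> \<beta>" and u: "continuous_on UNIV u" "\<And>x. \<bar>u x\<bar> \<le> M"
    and super: "\<And>x \<delta>. 0 < \<delta> \<Longrightarrow> u x < 0 \<Longrightarrow> \<forall>\<^sub>F \<epsilon> in at_right 0. - \<delta> \<le> trunc \<epsilon> (u x) u x"
  shows "min (u x) 0 = min (u y) 0"
proof (rule bounded_supersolution_constant[OF dim, where M = M])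
  let ?w = "\<lambda>x. min (u x) 0"
  show cw: "continuous_on UNIV ?w" by (intro continuous_intros u(1))
  show wM: "\<bar>?w x\<bar> \<le> M" for x using u(2)[of x] by auto
  have um: "u \<in> borel_measurable borel" and wm: "?w \<in> borel_measurable borel"
    using u(1) cw by (auto intro: borel_measurable_continuous_onI)
  fix x and \<delta> :: real assume d: "0 < \<delta>"
  show "\<forall>\<^sub>F \<epsilon> in at_right 0. - \<delta> \<le> trunc \<epsilon> (?w x) ?w x"
  proof (cases "u x < 0")
    case True
    have le: "trunc \<epsilon> (u x) u x \<le> trunc \<epsilon> (?w x) ?w x" if "0 < \<epsilon>" for \<epsilon>
      unfolding trunc_def using True
      by (intro integral_mono trunc_integrable[OF um u(2) that] trunc_integrable[OF wm wM that] mult_right_mono g_mono Kt_nonneg) auto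
    show ?thesis
      using super[OF d True] eventually_at_right_less[of 0]
      by eventually_elim (use le in \<open>force intro: order_trans\<close>)
  next
    case False
    have "0 \<le> trunc \<epsilon> (?w x) ?w x" for \<epsilon>
      unfolding trunc_def using False
      by (intro Bochner_Integration.integral_nonneg mult_nonneg_nonneg g_nonneg Kt_nonneg) auto
    note nonneg = this
    have "- \<delta> \<le> trunc \<epsilon> (?w x) ?w x" for \<epsilon> using nonneg[of \<epsilon>] d by linarith
    then show ?thesis by (rule always_eventually[OF allI])
  qed
qed

end

section \<open>Kernels and solutions that are only Lebesgue measurable\<close>

text \<open>
  A Borel version of \<open>K\<close> is symmetrised, made nonnegative and clipped between the two power bounds in the ball of radius \<open>\<rho>\<close>.
  None of these operations changes it outside a null set, as \<open>K\<close> has these properties at every \<open>z \<noteq> 0\<close>.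
\<close>

lemma borel_kernel_version:
  fixes K c :: "real ^ 'n \<Rightarrow> real"
  assumes gn: "growth_nonlinearity g \<beta> C" and K: "admissible_kernel K"
    and al: "0 < \<alpha>" "\<alpha> < \<beta>" and lam: "0 < lam" "\<And>z. lam \<le> c z" "\<And>z. c z \<le> Lam"
    and cond: "finite_range_kernel K c \<alpha> \<or> decaying_kernel K c \<alpha> \<beta>"
  obtains K' \<rho> where "nonlocal_operator g \<beta> C K' \<alpha> lam Lam \<rho>" "AE z in lborel. K z = K' z"
proof -
  note result = that
  let ?n = "real CARD('n)"
  have Dim: "real DIM(real ^ 'n) = ?n" by simp
  interpret growth_nonlinearity g \<beta> C by (rule gn)
  have K0: "0 \<le> K z" and Keven: "K (- z) = K z" for z using K by (auto simp: admissible_kernel_def)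
  have cq: "c z / norm z powr (?n + \<alpha>) = c z * norm z powr (- \<alpha> - ?n)" for z
    using powr_minus_divide[of "norm z" "?n + \<alpha>"] by (simp add: algebra_simps)
  have Lam: "0 < Lam" using lam(1) lam(2)[of 0] lam(3)[of 0] by linarith
  have clo: "lam * norm z powr (- \<alpha> - ?n) \<le> c z * norm z powr (- \<alpha> - ?n)"
    and cup: "c z * norm z powr (- \<alpha> - ?n) \<le> Lam * norm z powr (- \<alpha> - ?n)" for z
    using lam by (auto intro!: mult_right_mono)
  obtain K1 where K1 [measurable]: "K1 \<in> borel_measurable borel" and K1_eq: "AE z in lborel. K z = K1 z"
    using completion_ex_borel_measurable_real[of K lborel] K by (auto simp: admissible_kernel_def)
  have K1_eq': "AE z in lborel. K z = K1 (- z)"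
  proof -
    have "AE z in lborel. K (- z) = K1 (- z)"
    proof (rule AE_distrD[where M' = borel and f = uminus])
      show "AE z in distr lborel borel uminus. K z = K1 z"
        by (subst lborel_distr_reflect) (rule K1_eq)
    qed simp
    then show ?thesis by (simp add: Keven)
  qed
  define K2 where "K2 z = max 0 ((K1 z + K1 (- z)) / 2)" for z
  have K2m [measurable]: "K2 \<in> borel_measurable borel" unfolding K2_def[abs_def] by measurable
  have K2_eq: "AE z in lborel. K z = K2 z"
    using K1_eq K1_eq'
  proof eventually_elim
    case (elim z)
    show ?case unfolding K2_def elim(1)[symmetric] elim(2)[symmetric] using K0[of z] by simp
  qed
  define clip where "clip \<rho> z = (if norm z \<le> \<rho> then max (lam * norm z powr (- \<alpha> - ?n)) (min (Lam * norm z powr (- \<alpha> - ?n)) (K2 z)) else K2 z)"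
    for \<rho> z
  have clip_m [measurable]: "clip \<rho> \<in> borel_measurable borel" for \<rho> unfolding clip_def[abs_def] by measurable
  have lL: "lam * norm z powr (- \<alpha> - ?n) \<le> Lam * norm z powr (- \<alpha> - ?n)" for z :: "real ^ 'n"
    using order_trans[OF clo cup] .
  \<comment> \<open>Both kernel classes provide the power bounds in a ball and a finite moment outside it.\<close>
  have finish: thesis
    if \<rho>: "0 < \<rho>" and near: "\<And>z. z \<noteq> 0 \<Longrightarrow> norm z \<le> \<rho> \<Longrightarrow>
        lam * norm z powr (- \<alpha> - ?n) \<le> K z \<and> K z \<le> Lam * norm z powr (- \<alpha> - ?n)"
      and tail: "(\<integral>\<^sup>+z. ennreal (norm z powr \<beta> * K2 z) * indicator {z. \<rho> < norm z} z \<partial>lborel) < \<infinity>" for \<rho>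
  proof (rule result)
    show "AE z in lborel. K z = clip \<rho> z"
      using K2_eq AE_lborel_singleton[of "0 :: real ^ 'n"]
    proof eventually_elim
      case (elim z)
      show ?case
      proof (cases "norm z \<le> \<rho>")
        case True
        from near[OF elim(2) True] show ?thesis unfolding elim(1) clip_def using True by simp
      qed (simp add: clip_def elim(1))
    qed
    have cl0: "0 \<le> clip \<rho> z" for z
      using lam(1) by (auto simp: clip_def K2_def le_max_iff_disj)
    show "nonlocal_operator g \<beta> C (clip \<rho>) \<alpha> lam Lam \<rho>"
    proof
      show "clip \<rho> \<in> borel_measurable borel" by measurable
      show "0 \<le> clip \<rho> z" for z by (rule cl0)
      show "clip \<rho> (- z) = clip \<rho> z" for z by (simp add: clip_def K2_def add.commute)
      show "lam * norm z powr (- \<alpha> - DIM(real ^ 'n)) \<le> clip \<rho> z" if "norm z \<le> \<rho>" for z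
        unfolding Dim using that by (simp add: clip_def)
      show "clip \<rho> z \<le> Lam * norm z powr (- \<alpha> - DIM(real ^ 'n))" if "norm z \<le> \<rho>" for z
        unfolding Dim using that lL[of z] by (simp add: clip_def)
      obtain P where P: "0 < P" "\<And>r. 0 < r \<Longrightarrow>
       (\<integral>\<^sup>+z. ennreal (norm z powr ((\<beta> - \<alpha>) - DIM(real ^ 'n))) * indicator (ball 0 r) z
           \<partial>(lborel :: (real ^ 'n) measure)) \<le> ennreal (P * r powr (\<beta> - \<alpha>))"
        using nn_integral_power_ball[where 'a="real ^ 'n", of "\<beta> - \<alpha>"] al by auto
      have "(\<integral>\<^sup>+z. ennreal (norm z powr \<beta> * clip \<rho> z) \<partial>lborel)
        \<le> (\<integral>\<^sup>+z. ennreal Lam * (ennreal (norm z powr ((\<beta> - \<alpha>) - ?n)) * indicator (ball 0 (2 * \<rho>)) z)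
              + ennreal (norm z powr \<beta> * K2 z) * indicator {z. \<rho> < norm z} z \<partial>lborel)"
      proof (rule nn_integral_mono)
        fix z :: "real ^ 'n"
        show "ennreal (norm z powr \<beta> * clip \<rho> z)
           \<le> ennreal Lam * (ennreal (norm z powr ((\<beta> - \<alpha>) - ?n)) * indicator (ball 0 (2 * \<rho>)) z)
              + ennreal (norm z powr \<beta> * K2 z) * indicator {z. \<rho> < norm z} z"
        proof (cases "norm z \<le> \<rho>")
          case True
          have "norm z powr \<beta> * clip \<rho> z \<le> norm z powr \<beta> * (Lam * norm z powr (- \<alpha> - ?n))"
            using True lL[of z] by (intro mult_left_mono) (auto simp: clip_def)
          also have "\<dots> = Lam * norm z powr ((\<beta> - \<alpha>) - ?n)"
          proof -
            have "norm z powr \<beta> * norm z powr (- \<alpha> - ?n) = norm z powr ((\<beta> - \<alpha>) - ?n)"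
              by (simp flip: powr_add add: algebra_simps)
            then show ?thesis by simp
          qed
          finally have "ennreal (norm z powr \<beta> * clip \<rho> z) \<le> ennreal Lam * ennreal (norm z powr ((\<beta> - \<alpha>) - ?n))"
            using Lam by (simp add: ennreal_leI flip: ennreal_mult)
          then show ?thesis using True \<rho> by simp
        next
          case False
          then show ?thesis by (simp add: clip_def)
        qed
      qed
      also have "\<dots> = ennreal Lam * (\<integral>\<^sup>+z. ennreal (norm z powr ((\<beta> - \<alpha>) - ?n)) * indicator (ball 0 (2 * \<rho>)) z \<partial>(lborel :: (real ^ 'n) measure))
          + (\<integral>\<^sup>+z. ennreal (norm z powr \<beta> * K2 z) * indicator {z. \<rho> < norm z} z \<partial>lborel)"
      proof -
        have [measurable]: "ball (0 :: real ^ 'n) (2 * \<rho>) \<in> sets borel" by simp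
        show ?thesis
          by (subst nn_integral_add, measurable, subst nn_integral_cmult, measurable)
      qed
      also have "\<dots> < \<infinity>"
      proof -
        have "(\<integral>\<^sup>+z. ennreal (norm z powr ((\<beta> - \<alpha>) - ?n)) * indicator (ball 0 (2 * \<rho>)) z \<partial>(lborel :: (real ^ 'n) measure)) < \<infinity>"
          using P(2)[of "2 * \<rho>"] \<rho> unfolding Dim by (auto intro: le_less_trans)
        then show ?thesis using tail by (simp add: ennreal_mult_less_top)
      qed
      finally show "integrable lborel (\<lambda>z. norm z powr \<beta> * clip \<rho> z)"
        using cl0 by (intro integrableI_nonneg) auto
    qed (use al lam \<rho> in auto)
  qed
  from cond show thesis
  proof
    assume "finite_range_kernel K c \<alpha>"
    then obtain r R where rR: "0 < r" "r \<le> R" and b: "\<And>z. z \<noteq> 0 \<Longrightarrow>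
          c z * norm z powr (- \<alpha> - ?n) * indicator {z. norm z \<le> r} z \<le> K z \<and>
          K z \<le> c z * norm z powr (- \<alpha> - ?n) * indicator {z. norm z \<le> R} z"
      unfolding finite_range_kernel_def cq by blast
    show thesis
    proof (rule finish[OF rR(1)])
      fix z :: "real ^ 'n" assume z: "z \<noteq> 0" "norm z \<le> r"
      show "lam * norm z powr (- \<alpha> - ?n) \<le> K z \<and> K z \<le> Lam * norm z powr (- \<alpha> - ?n)"
        using b[OF z(1)] z(2) rR clo[of z] cup[of z] by simp
    next
      have fin: "emeasure lborel (cball (0 :: real ^ 'n) R) < \<infinity>" by (rule emeasure_bounded_finite) simp
      have "(\<integral>\<^sup>+z. ennreal (norm z powr \<beta> * K2 z) * indicator {z. r < norm z} z \<partial>lborel)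
        \<le> (\<integral>\<^sup>+z. ennreal (R powr \<beta> * (Lam * r powr (- \<alpha> - ?n))) * indicator (cball (0 :: real ^ 'n) R) z \<partial>lborel)"
      proof (rule nn_integral_mono_AE)
        show "AE z in lborel. ennreal (norm z powr \<beta> * K2 z) * indicator {z. r < norm z} z
           \<le> ennreal (R powr \<beta> * (Lam * r powr (- \<alpha> - ?n))) * indicator (cball (0 :: real ^ 'n) R) z"
          using K2_eq
        proof eventually_elim
          case (elim z)
          show ?case
          proof (cases "r < norm z")
            case True
            then have z0: "z \<noteq> 0" using rR by auto
            show ?thesis
            proof (cases "norm z \<le> R")
              case inR: True
              have "K z \<le> Lam * norm z powr (- \<alpha> - ?n)" using b[OF z0] inR cup[of z] by simp
              also have "\<dots> \<le> Lam * r powr (- \<alpha> - ?n)"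
                using True rR Lam al by (intro mult_left_mono powr_mono2') auto
              finally have "norm z powr \<beta> * K z \<le> R powr \<beta> * (Lam * r powr (- \<alpha> - ?n))"
                using inR K0[of z] beta_ge_2 by (intro mult_mono powr_mono2) auto
              then show ?thesis using True inR elim by (simp add: ennreal_leI)
            next
              case False
              then have "K z = 0" using b[OF z0] K0[of z] by simp
              then show ?thesis using elim by simp
            qed
          qed simp
        qed
      qed
      also have "\<dots> < \<infinity>"
        using fin by (simp add: nn_integral_cmult_indicator ennreal_mult_less_top)
      finally show "(\<integral>\<^sup>+z. ennreal (norm z powr \<beta> * K2 z) * indicator {z. r < norm z} z \<partial>lborel) < \<infinity>" .
    qed
  next
    assume "decaying_kernel K c \<alpha> \<beta>"
    then obtain R D C1 C2 \<theta> where R: "0 < R"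
      and near: "\<And>z. z \<noteq> 0 \<Longrightarrow> norm z \<le> R \<Longrightarrow> K z = c z * norm z powr (- \<alpha> - ?n)"
      and C1: "0 < C1" and sh: "\<And>r. R < r \<Longrightarrow> (\<integral>\<^sup>+z\<in>(open_shell r). ennreal \<bar>K z\<bar> \<partial>lebesgue) \<le> ennreal (C1 * D r)"
      and C2: "0 < C2" and th: "\<beta> + 1 < \<theta>" and Dle: "\<And>r. R < r \<Longrightarrow> D r < C2 * r powr (- \<theta>)"
      unfolding decaying_kernel_def cq by blast
    show thesis
    proof (rule finish[OF R])
      fix z :: "real ^ 'n" assume z: "z \<noteq> 0" "norm z \<le> R"
      show "lam * norm z powr (- \<alpha> - ?n) \<le> K z \<and> K z \<le> Lam * norm z powr (- \<alpha> - ?n)"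
        using near[OF z] clo[of z] cup[of z] by simp
    next
      show "(\<integral>\<^sup>+z. ennreal (norm z powr \<beta> * K2 z) * indicator {z. R < norm z} z \<partial>lborel) < \<infinity>"
      proof (rule tail_moment_finite[where B = "C1 * C2" and \<theta> = \<theta>])
        show "(\<integral>\<^sup>+z. ennreal (K2 z) * indicator (open_shell r) z \<partial>lborel) \<le> ennreal (C1 * C2 * r powr (- \<theta>))"
          if r: "R < r" for r
        proof -
          have "(\<integral>\<^sup>+z. ennreal (K2 z) * indicator (open_shell r) z \<partial>lborel)
             = (\<integral>\<^sup>+z. ennreal \<bar>K z\<bar> * indicator (open_shell r) z \<partial>lborel)"
            by (rule nn_integral_cong_AE, use K2_eq in eventually_elim) (simp add: K2_def)
          also have "\<dots> \<le> ennreal (C1 * D r)"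
            using sh[OF r] unfolding nn_integral_completion .
          also have "\<dots> \<le> ennreal (C1 * (C2 * r powr (- \<theta>)))"
            using Dle[OF r] C1 by (intro ennreal_leI mult_left_mono) auto
          finally show ?thesis by (simp add: mult.assoc)
        qed
      qed (use R C1 C2 th beta_ge_2 in \<open>auto simp: K2_def\<close>)
    qed
  qed
qed

text \<open>
  The integral does not see null sets, so \<open>K\<close> and the values of \<open>u\<close> under the integral may be replaced by Borel versions.
  The value \<open>u x\<close> at the centre is kept.
\<close>

lemma (in nonlocal_operator) principal_value_eq_trunc:
  fixes u h K0 :: "'a \<Rightarrow> real"
  assumes h [measurable]: "h \<in> borel_measurable borel" and hu: "AE y in lborel. h y = u y"
    and K0: "AE z in lborel. K0 z = K z" 
    and int: "set_integrable lebesgue (- ball x \<epsilon>) (\<lambda>y. g (u x - u y) * K0 (y - x))"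
  shows "set_lebesgue_integral lebesgue (- ball x \<epsilon>) (\<lambda>y. g (u x - u y) * K0 (y - x)) = trunc \<epsilon> (u x) h x"
proof -
  let ?G = "\<lambda>y. g (u x - h y) * Kt \<epsilon> (- x + y)"
  have G: "?G \<in> borel_measurable borel" by measurable
  have "AE y in lborel. K0 (- x + y) = K (- x + y)" by (rule AE_lborel_translate[OF K0])
  then have "AE y in lborel. indicator (- ball x \<epsilon>) y *\<^sub>R (g (u x - u y) * K0 (y - x)) = ?G y"
    using hu by eventually_elim (auto simp: Kt_def indicator_def dist_norm norm_minus_commute)
  then have ae: "AE y in lebesgue. indicator (- ball x \<epsilon>) y *\<^sub>R (g (u x - u y) * K0 (y - x)) = ?G y"
    by (rule AE_completion)
  have "set_lebesgue_integral lebesgue (- ball x \<epsilon>) (\<lambda>y. g (u x - u y) * K0 (y - x)) = (LINT y|lebesgue. ?G y)"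
    unfolding set_lebesgue_integral_def
    using int G by (intro integral_cong_AE ae)
      (auto simp: set_integrable_def intro: borel_measurable_integrable measurable_completion)
  also have "\<dots> = (LINT y|lborel. ?G y)" using G by (intro integral_completion) simp
  also have "\<dots> = (LINT z|lborel. ?G (x + z))" by (rule integral_lborel_translate[OF G, symmetric])
  also have "\<dots> = trunc \<epsilon> (u x) h x" by (simp add: trunc_def)
  finally show ?thesis .
qed

section \<open>The Liouville theorem\<close>

theorem theorem3p2:
  fixes u K c :: "real ^ 'n \<Rightarrow> real"
    and \<Phi> F f :: "real \<Rightarrow> real"
    and \<alpha> \<beta> lam Lam :: real
  assumes "admissible_kernel K"
    and "admissible_potential \<Phi>"
    and "\<And>t. (F has_real_derivative f t) (at t)" and "continuous_on UNIV f"
    and "u \<in> borel_measurable lebesgue" and "bounded (range u)"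
    and "\<And>x. T_has_value \<Phi> K u x (f (u x))"
    and "\<alpha> > 0" and "\<beta> \<ge> 2" and "\<beta> > \<alpha>"
    and "\<exists>C>0. \<forall>t>0. deriv \<Phi> t \<le> C * t powr (\<beta> - 1)"
    and "0 < lam" and "lam \<le> Lam" and "\<And>z. lam \<le> c z \<and> c z \<le> Lam"
    and "finite_range_kernel K c \<alpha> \<or> decaying_kernel K c \<alpha> \<beta>"
    and "(\<forall>x. f (u x) \<ge> 0) \<or> (\<forall>x. u x * f (u x) \<le> 0)"
    and "real CARD('n) \<le> \<beta>"
  shows "u constant_on UNIV"
proof -
  obtain C where C: "0 < C" "\<And>t. 0 < t \<Longrightarrow> deriv \<Phi> t \<le> C * t powr (\<beta> - 1)" using assms(11) by blast
  have gn: "growth_nonlinearity (deriv \<Phi>) \<beta> C"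
    by (rule potential_growth_nonlinearity[OF assms(2,9) C])
  obtain K' \<rho> where K': "nonlocal_operator (deriv \<Phi>) \<beta> C K' \<alpha> lam Lam \<rho>" "AE z in lborel. K z = K' z"
    by (rule borel_kernel_version[OF gn assms(1,8,10,12) _ _ assms(15)]) (use assms(14) in auto)
  interpret nonlocal_operator "deriv \<Phi>" \<beta> C K' \<alpha> lam Lam \<rho> by (rule K'(1))
  obtain M where M: "\<And>x. \<bar>u x\<bar> \<le> M" using assms(6) by (auto simp: bounded_iff)
  have M0: "0 \<le> M" using M[of 0] by linarith
  obtain h0 where h0 [measurable]: "h0 \<in> borel_measurable borel" and h0_eq: "AE y in lborel. u y = h0 y"
    using completion_ex_borel_measurable_real[of u lborel] assms(5) by auto
  define h where "h y = max (- M) (min M (h0 y))" for y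
  have hm: "h \<in> borel_measurable borel" unfolding h_def[abs_def] by measurable
  have hM: "\<bar>h y\<bar> \<le> M" for y using M0 by (auto simp: h_def)
  have hu: "AE y in lborel. h y = u y"
    using h0_eq
  proof eventually_elim
    case (elim y)
    show ?case using M[of y] unfolding h_def elim[symmetric] by (auto simp: abs_le_iff)
  qed
  have lim_h: "((\<lambda>\<epsilon>. trunc \<epsilon> (u x) h x) \<longlongrightarrow> f (u x)) (at_right 0)" for x
  proof (rule Lim_transform_eventually)
    let ?I = "\<lambda>\<epsilon>. set_lebesgue_integral lebesgue (- ball x \<epsilon>) (T_integrand \<Phi> K u x)"
    have T: "T_has_value \<Phi> K u x (f (u x))" by (rule assms(7))
    then show "(?I \<longlongrightarrow> f (u x)) (at_right 0)" by (simp add: T_has_value_def)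
    show "\<forall>\<^sub>F \<epsilon> in at_right 0. ?I \<epsilon> = trunc \<epsilon> (u x) h x"
      using eventually_at_right_less[of 0]
    proof eventually_elim
      case (elim \<epsilon>)
      then have "set_integrable lebesgue (- ball x \<epsilon>) (T_integrand \<Phi> K u x)"
        using T by (simp add: T_has_value_def)
      then show ?case
        unfolding T_integrand_def by (rule principal_value_eq_trunc[OF hm hu K'(2)])
    qed
  qed
  have "compact (f ` {- M..M})"
    by (intro compact_continuous_image continuous_on_subset[OF assms(4)]) auto
  then obtain H where H: "\<And>t. t \<in> {- M..M} \<Longrightarrow> \<bar>f t\<bar> \<le> H"
    using compact_imp_bounded by (fastforce simp: bounded_iff)
  have fH: "\<bar>f (u x)\<bar> \<le> H" for x using M[of x] by (intro H) (auto simp: abs_le_iff)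
  have "isCont u x" for x
    by (rule pointwise_solution_continuous[OF hm hM M hu lim_h fH])
  then have cu: "continuous_on UNIV u" by (simp add: continuous_on_eq_continuous_at)
  then have um: "u \<in> borel_measurable borel" by (rule borel_measurable_continuous_onI)
  have tr: "trunc \<epsilon> (u x) u x = trunc \<epsilon> (u x) h x" for \<epsilon> x
  proof -
    have measurable_trunc: "(\<lambda>z. deriv \<Phi> (u x - w (x + z)) * Kt \<epsilon> z) \<in> borel_measurable borel"
      if w [measurable]: "w \<in> borel_measurable borel" for w
      by measurable
    have "AE z in lborel. h (x + z) = u (x + z)" by (rule AE_lborel_translate[OF hu])
    then have "AE z in lborel. deriv \<Phi> (u x - u (x + z)) * Kt \<epsilon> z = deriv \<Phi> (u x - h (x + z)) * Kt \<epsilon> z"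
      by eventually_elim simp
    then show ?thesis
      unfolding trunc_def using measurable_trunc[OF um] measurable_trunc[OF hm] by (intro integral_cong_AE) auto
  qed
  have lim: "((\<lambda>\<epsilon>. trunc \<epsilon> (u x) u x) \<longlongrightarrow> f (u x)) (at_right 0)" for x
    unfolding tr by (rule lim_h)
  have dim: "real DIM(real ^ 'n) \<le> \<beta>" using assms(17) by simp
  have ev: "\<forall>\<^sub>F \<epsilon> in at_right 0. - \<delta> \<le> trunc \<epsilon> (u x) u x" if "0 < \<delta>" "0 \<le> f (u x)" for x \<delta>
  proof -
    have "- \<delta> < f (u x)" using that by linarith
    from order_tendstoD(1)[OF lim this] show ?thesis by (rule eventually_mono) simp
  qed
  have "u x = u y" for x y
    using assms(16)
  proof
    assume f0: "\<forall>x. f (u x) \<ge> 0"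
    show ?thesis
      by (rule bounded_supersolution_constant[OF dim cu M]) (use ev f0 in blast)
  next
    assume uf: "\<forall>x. u x * f (u x) \<le> 0"
    have neg: "min (u x) 0 = min (u y) 0"
    proof (rule negative_part_constant[OF dim cu M])
      fix x and \<delta> :: real assume d: "0 < \<delta>" and x: "u x < 0"
      have "0 \<le> f (u x)" using uf[rule_format, of x] x by (simp add: mult_le_0_iff)
      then show "\<forall>\<^sub>F \<epsilon> in at_right 0. - \<delta> \<le> trunc \<epsilon> (u x) u x" by (rule ev[OF d])
    qed
    have pos: "min (- u x) 0 = min (- u y) 0"
    proof (rule negative_part_constant[OF dim, where u = "\<lambda>x. - u x"])
      show "continuous_on UNIV (\<lambda>x. - u x)" by (intro continuous_intros cu)
      show "\<bar>- u x\<bar> \<le> M" for x using M[of x] by simp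
      fix x and \<delta> :: real assume d: "0 < \<delta>" and x: "- u x < 0"
      have "f (u x) \<le> 0" using uf[rule_format, of x] x by (simp add: mult_le_0_iff)
      then have "f (u x) < \<delta>" using d by simp
      from order_tendstoD(2)[OF lim this]
      show "\<forall>\<^sub>F \<epsilon> in at_right 0. - \<delta> \<le> trunc \<epsilon> (- u x) (\<lambda>x. - u x) x"
        unfolding trunc_uminus by (rule eventually_mono) simp
    qed
    from neg pos show ?thesis by (auto simp: min_def split: if_splits)
  qed
  then show ?thesis unfolding constant_on_def by blast
qed

end
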